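(* For every $n\ge2$, $$\sum_{w\in\mathcal A^B_n}F_{n,\mathrm{Des}(w)}(x)=\mathrm{ch}\Big(2\sum_{k=1}^{n-1}\chi^{(k,1^{n-k-1})}\big\uparrow^{\mathfrak S_n}_{\mathfrak S_{n-1}}+n\sum_{k=1}^n\chi^{(k,1^{n-k})}\Big).$$
   Context: $B_n$: signed permutations $w=(w(1),\dots,w(n))$ (permutations of $[n]$ with some entries barred). Identify $\Omega_n=\{1,\dots,n,\bar1,\dots,\bar n\}$ with $\mathbb Z_{2n}$ via $i\mapsto i$ and $\bar i\mapsto n+i$. $w\in B_n$ is a $B$-arc permutation if for every $i\in[n]$ the set $\{w(i),w(i+1),\dots,w(n)\}$ is an interval (a set of cyclically consecutive residues) in $\mathbb Z_{2n}$; $\mathcal A^B_n$ is the set of these. $\mathrm{Des}(w)=\{i\in[n-1]:w(i)>_rw(i+1)\}$ with respect to the total order $\bar1<_r\cdots<_r\bar n<_r1<_r\cdots<_rn$. For $S\subseteq[n-1]$, $F_{n,S}(x)=\sum x_{i_1}\cdots x_{i_n}$ over $i_1\le\dots\le i_n$ with $i_j<i_{j+1}$ for $j\in S$ (Gessel's fundamental quasisymmetric function). $\chi^\lambda$ is the irreducible character of $\mathfrak S_n$ indexed by $\lambda\vdash n$, $\mathrm{ch}$ is the Frobenius characteristic of $\mathfrak S_n$ (so $\mathrm{ch}(\chi^\lambda)=s_\lambda(x)$), and $\uparrow^{\mathfrak S_n}_{\mathfrak S_{n-1}}$ denotes induction from the subgroup fixing $n$. *)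

theory Defs
  imports
    Complex_Main
    "HOL-Library.Multiset"
    "HOL-Library.Function_Algebras"
    "HOL-Combinatorics.Combinatorics"
begin

section \<open>Formal power series in countably many commuting variables\<close>

text \<open>A monomial is a finite multiset of variable indices. The variables are indexed by
  \<^typ>\<open>nat\<close>, hence from 0; only the order type of the index set is relevant below.\<close>

typedef 'a mps = "UNIV :: (nat multiset \<Rightarrow> 'a) set"
  morphisms mps_coeff Abs_mps ..

setup_lifting type_definition_mps

lemma mps_eqI: "(\<And>M. mps_coeff f M = mps_coeff g M) \<Longrightarrow> f = g"
  by transfer auto

lemma finite_msubsets: "finite {A. A \<subseteq># (M :: 'b multiset)}"
proof (induction M)
  case (add x M)
  have "{A. A \<subseteq># add_mset x M} \<subseteq> {A. A \<subseteq># M} \<union> add_mset x ` {A. A \<subseteq># M}"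
  proof
    fix A assume A: "A \<in> {A. A \<subseteq># add_mset x M}"
    show "A \<in> {A. A \<subseteq># M} \<union> add_mset x ` {A. A \<subseteq># M}"
    proof (cases "x \<in># A")
      case True
      then obtain B where "A = add_mset x B" by (meson multi_member_split)
      with A show ?thesis by auto
    next
      case False
      with A have "A \<subseteq># M"
        by (metis diff_single_trivial mem_Collect_eq subset_eq_diff_conv add_mset_add_single)
      then show ?thesis by auto
    qed
  qed
  with add.IH show ?case by (meson finite_UnI finite_imageI finite_subset)
qed simp

instantiation mps :: (comm_ring_1) comm_ring_1
begin

lift_definition zero_mps :: "'a mps" is "\<lambda>M. 0" .
lift_definition one_mps :: "'a mps" is "\<lambda>M. if M = {#} then 1 else 0" .
lift_definition plus_mps :: "'a mps \<Rightarrow> 'a mps \<Rightarrow> 'a mps" is "\<lambda>f g M. f M + g M" .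
lift_definition minus_mps :: "'a mps \<Rightarrow> 'a mps \<Rightarrow> 'a mps" is "\<lambda>f g M. f M - g M" .
lift_definition uminus_mps :: "'a mps \<Rightarrow> 'a mps" is "\<lambda>f M. - f M" .
lift_definition times_mps :: "'a mps \<Rightarrow> 'a mps \<Rightarrow> 'a mps" is
  "\<lambda>f g M. \<Sum>A | A \<subseteq># M. f A * g (M - A)" .

instance
proof
  fix f g h :: "'a mps"
  show "f * g * h = f * (g * h)"
  proof (transfer, rule ext)
    fix f g h :: "nat multiset \<Rightarrow> 'a" and M
    have "(\<Sum>A | A \<subseteq># M. (\<Sum>B | B \<subseteq># A. f B * g (A - B)) * h (M - A)) =
      (\<Sum>(A, B) \<in> Sigma {A. A \<subseteq># M} (\<lambda>A. {B. B \<subseteq># A}). f B * g (A - B) * h (M - A))"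
      by (simp add: sum.Sigma finite_msubsets sum_distrib_right)
    also have "\<dots> = (\<Sum>(B, C) \<in> Sigma {B. B \<subseteq># M} (\<lambda>B. {C. C \<subseteq># M - B}).
        f B * (g C * h (M - B - C)))"
    proof (rule sum.reindex_bij_witness[where j = "\<lambda>(A, B). (B, A - B)" and i = "\<lambda>(B, C). (B + C, B)"],
        goal_cases)
      case (2 x)
      then show ?case
        by (auto intro: subset_mset.order_trans) (metis subset_mset.diff_add subset_mset.add_le_cancel_right subset_mset.order_trans)
    next
      case (4 x)
      then show ?case
        by (auto simp: subset_mset.le_diff_conv2 add.commute)
    next
      case (5 x)
      then show ?case
        by (auto simp: mult.assoc subset_mset.add_diff_inverse diff_diff_add_mset)
    qed auto
    also have "\<dots> = (\<Sum>B | B \<subseteq># M. f B * (\<Sum>C | C \<subseteq># M - B. g C * h (M - B - C)))"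
      by (simp add: sum.Sigma finite_msubsets sum_distrib_left)
    finally show "(\<Sum>A | A \<subseteq># M. (\<Sum>B | B \<subseteq># A. f B * g (A - B)) * h (M - A)) =
      (\<Sum>B | B \<subseteq># M. f B * (\<Sum>C | C \<subseteq># M - B. g C * h (M - B - C)))" .
  qed
  have double_diff_mset: "M - (M - A) = A" if "A \<subseteq># M" for A M :: "nat multiset"
    using that by (auto simp: multiset_eq_iff subseteq_mset_def)
  show "f * g = g * f"
  proof (transfer, rule ext)
    fix f g :: "nat multiset \<Rightarrow> 'a" and M
    show "(\<Sum>A | A \<subseteq># M. f A * g (M - A)) = (\<Sum>A | A \<subseteq># M. g A * f (M - A))"
      by (rule sum.reindex_bij_witness[where i = "\<lambda>A. M - A" and j = "\<lambda>A. M - A"])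
         (auto simp: mult.commute double_diff_mset)
  qed
  show "1 * f = f"
  proof (transfer, rule ext)
    fix f :: "nat multiset \<Rightarrow> 'a" and M
    have "(\<Sum>A | A \<subseteq># M. (if A = {#} then 1 else 0) * f (M - A)) =
      (\<Sum>A | A \<subseteq># M. if A = {#} then f M else 0)"
      by (rule sum.cong) auto
    then show "(\<Sum>A | A \<subseteq># M. (if A = {#} then 1 else 0) * f (M - A)) = f M"
      by (simp add: sum.delta finite_msubsets)
  qed
  show "(f + g) * h = f * h + g * h"
    by transfer (simp add: algebra_simps sum.distrib)
  show "(0 :: 'a mps) \<noteq> 1"
    by transfer (metis zero_neq_one)
qed (transfer; simp add: algebra_simps)+

end

lift_definition mps_const :: "'a::zero \<Rightarrow> 'a mps" is
  "\<lambda>c M. if M = {#} then c else 0" .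


section \<open>Quasisymmetric functions and power sums\<close>

lift_definition fund_qsym :: "nat \<Rightarrow> nat set \<Rightarrow> complex mps" is
  "\<lambda>n S M. of_nat (card {xs :: nat list. length xs = n \<and> sorted xs \<and>
     (\<forall>j\<in>S. xs ! (j - 1) < xs ! j) \<and> mset xs = M})" .

lift_definition power_sum :: "nat \<Rightarrow> complex mps" is
  "\<lambda>k M. if \<exists>i. M = replicate_mset k i then 1 else 0" .


section \<open>Class functions on the symmetric group\<close>

text \<open>The symmetric group of degree \<open>n\<close> is the set of all \<open>\<pi> permutes {1..n}\<close>; the subgroup
  fixing \<open>n\<close> is then literally the set of all \<open>\<pi> permutes {1..n - 1}\<close>.\<close>

definition cycle_type :: "nat \<Rightarrow> (nat \<Rightarrow> nat) \<Rightarrow> nat multiset" where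
  "cycle_type n \<pi> = image_mset card (mset_set (orbit \<pi> ` {1..n}))"

definition frobenius_ch :: "nat \<Rightarrow> ((nat \<Rightarrow> nat) \<Rightarrow> complex) \<Rightarrow> complex mps" where
  "frobenius_ch n \<chi> =
     mps_const (1 / fact n) *
     (\<Sum>\<pi> | \<pi> permutes {1..n}. mps_const (\<chi> \<pi>) * (\<Prod>k\<in>#cycle_type n \<pi>. power_sum k))"

text \<open>Induction from the subgroup fixing \<open>n\<close> of a class function is given by
  \<open>(\<chi>\<up>)(g) = 1/|H| \<Sum>x\<in>G. \<chi>\<degree>(x\<inverse> g x)\<close>, where \<open>\<chi>\<degree>\<close> extends \<open>\<chi>\<close> by 0 outside \<open>H\<close>.\<close>

definition induce :: "nat \<Rightarrow> ((nat \<Rightarrow> nat) \<Rightarrow> complex) \<Rightarrow> (nat \<Rightarrow> nat) \<Rightarrow> complex" where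
  "induce n \<chi> \<pi> =
     1 / fact (n - 1) *
     (\<Sum>\<tau> | \<tau> permutes {1..n} \<and> (inv \<tau> \<circ> \<pi> \<circ> \<tau>) permutes {1..n - 1}. \<chi> (inv \<tau> \<circ> \<pi> \<circ> \<tau>))"


section \<open>Specht modules and irreducible characters\<close>

abbreviation (input) fun_scale :: "complex \<Rightarrow> ('a \<Rightarrow> complex) \<Rightarrow> 'a \<Rightarrow> complex" where
  "fun_scale c v \<equiv> (\<lambda>x. c * v x)"

global_interpretation cfun: vector_space "fun_scale :: complex \<Rightarrow> ('a \<Rightarrow> complex) \<Rightarrow> 'a \<Rightarrow> complex"
  defines cfun_span = cfun.span
    and cfun_dependent = cfun.dependent
    and cfun_representation = cfun.representation
  by unfold_locales (auto simp: fun_eq_iff algebra_simps)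

text \<open>The trace of a linear map on a finite-dimensional invariant subspace \<open>V\<close>; by the lemma
  \<open>trace_on_eq\<close> it does not depend on the chosen basis.\<close>

definition trace_on :: "('a \<Rightarrow> complex) set \<Rightarrow> (('a \<Rightarrow> complex) \<Rightarrow> 'a \<Rightarrow> complex) \<Rightarrow> complex" where
  "trace_on V f =
     (let B = SOME B. \<not> cfun_dependent B \<and> cfun_span B = V
      in \<Sum>b\<in>B. cfun_representation B (f b) b)"

lemma trace_on_eq:
  fixes f :: "('a \<Rightarrow> complex) \<Rightarrow> 'a \<Rightarrow> complex"
  assumes lin: "Vector_Spaces.linear fun_scale fun_scale f"
    and inv: "f ` V \<subseteq> V"
    and B: "finite B" "\<not> cfun_dependent B" "cfun_span B = V"
  shows "trace_on V f = (\<Sum>b\<in>B. cfun_representation B (f b) b)"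
proof -
  interpret f: Vector_Spaces.linear fun_scale fun_scale f by (fact lin)
  define C where "C = (SOME B. \<not> cfun_dependent B \<and> cfun_span B = V)"
  have C: "\<not> cfun_dependent C \<and> cfun_span C = V"
    unfolding C_def by (rule someI[of _ B]) (use B in auto)
  have finC: "finite C"
    using cfun.independent_span_bound[OF B(1), of C] C B cfun.span_superset[of C] by auto
  have inV: "b \<in> V" if "b \<in> B \<union> C" for b
    using that B C cfun.span_superset[of C] cfun.span_superset[of B] by auto
  have expand: "cfun_representation Y v c =
      (\<Sum>x\<in>X. cfun_representation X v x * cfun_representation Y x c)"
    if XY: "X = B \<or> X = C" "Y = B \<or> Y = C" and v: "v \<in> V" for X Y v c
  proof -
    have "cfun_representation Y v =
        cfun_representation Y (\<Sum>x\<in>X. fun_scale (cfun_representation X v x) x)"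
      using cfun.sum_representation_eq[of X v X] XY B C v finC by auto
    also have "\<dots> = (\<lambda>c. \<Sum>x\<in>X. cfun_representation Y (fun_scale (cfun_representation X v x) x) c)"
      by (rule cfun.representation_sum) (use XY B C inV in \<open>auto intro: cfun.span_scale\<close>)
    also have "\<dots> = (\<lambda>c. \<Sum>x\<in>X. cfun_representation X v x * cfun_representation Y x c)"
      by (intro ext sum.cong refl, subst cfun.representation_scale) (use XY B C inV in auto)
    finally show ?thesis by (rule fun_cong)
  qed
  have fexpand: "cfun_representation C (f v) c =
      (\<Sum>b\<in>B. cfun_representation B v b * cfun_representation C (f b) c)" if v: "v \<in> V" for v c
  proof -
    have "f v = f (\<Sum>b\<in>B. fun_scale (cfun_representation B v b) b)"
      using cfun.sum_representation_eq[of B v B] B v by auto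
    also have "\<dots> = (\<Sum>b\<in>B. fun_scale (cfun_representation B v b) (f b))"
      by (simp add: f.sum f.scale)
    finally have "cfun_representation C (f v) =
        cfun_representation C (\<Sum>b\<in>B. fun_scale (cfun_representation B v b) (f b))" by simp
    also have "\<dots> = (\<lambda>c. \<Sum>b\<in>B. cfun_representation C (fun_scale (cfun_representation B v b) (f b)) c)"
      by (rule cfun.representation_sum) (use C inV inv in \<open>auto intro!: cfun.span_scale\<close>)
    also have "\<dots> = (\<lambda>c. \<Sum>b\<in>B. cfun_representation B v b * cfun_representation C (f b) c)"
      by (intro ext sum.cong refl, subst cfun.representation_scale) (use C inV inv in auto)
    finally show ?thesis by (rule fun_cong)
  qed
  have "trace_on V f = (\<Sum>c\<in>C. cfun_representation C (f c) c)"
    by (simp add: trace_on_def C_def Let_def)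
  also have "\<dots> = (\<Sum>c\<in>C. \<Sum>b\<in>B. cfun_representation B c b * cfun_representation C (f b) c)"
    by (intro sum.cong refl fexpand) (use inV in auto)
  also have "\<dots> = (\<Sum>b\<in>B. \<Sum>c\<in>C. cfun_representation C (f b) c * cfun_representation B c b)"
    by (subst sum.swap) (simp add: mult.commute)
  also have "\<dots> = (\<Sum>b\<in>B. cfun_representation B (f b) b)"
    by (intro sum.cong refl expand[symmetric]) (use inV inv in auto)
  finally show ?thesis .
qed

text \<open>Partitions are weakly decreasing lists of positive numbers; rows and columns of diagrams
  are counted from 0. A tableau is only relevant on the cells of its shape, and a tabloid is
  the list of the sets of entries of its rows.\<close>

definition cells :: "nat list \<Rightarrow> (nat \<times> nat) set" where
  "cells \<mu> = {(i, j). i < length \<mu> \<and> j < \<mu> ! i}"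

definition tableaux :: "nat list \<Rightarrow> (nat \<times> nat \<Rightarrow> nat) set" where
  "tableaux \<mu> = {t. bij_betw t (cells \<mu>) {1..sum_list \<mu>}}"

definition tabloid :: "nat list \<Rightarrow> (nat \<times> nat \<Rightarrow> nat) \<Rightarrow> nat set list" where
  "tabloid \<mu> t = map (\<lambda>i. t ` {c \<in> cells \<mu>. fst c = i}) [0..<length \<mu>]"

definition column_stabilizer :: "nat list \<Rightarrow> (nat \<times> nat \<Rightarrow> nat) \<Rightarrow> (nat \<Rightarrow> nat) set" where
  "column_stabilizer \<mu> t = {\<sigma>. \<sigma> permutes {1..sum_list \<mu>} \<and>
     (\<forall>j. \<sigma> ` t ` {c \<in> cells \<mu>. snd c = j} = t ` {c \<in> cells \<mu>. snd c = j})}"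

text \<open>The vectors of the permutation module of \<open>\<mu>\<close> are represented by their coordinates
  with respect to the basis of tabloids.\<close>

definition polytabloid :: "nat list \<Rightarrow> (nat \<times> nat \<Rightarrow> nat) \<Rightarrow> nat set list \<Rightarrow> complex" where
  "polytabloid \<mu> t = (\<lambda>X. \<Sum>\<sigma>\<in>column_stabilizer \<mu> t.
     of_int (sign \<sigma>) * (if X = tabloid \<mu> (\<sigma> \<circ> t) then 1 else 0))"

definition specht_module :: "nat list \<Rightarrow> (nat set list \<Rightarrow> complex) set" where
  "specht_module \<mu> = cfun_span (polytabloid \<mu> ` tableaux \<mu>)"

definition tabloid_action ::
    "(nat \<Rightarrow> nat) \<Rightarrow> (nat set list \<Rightarrow> complex) \<Rightarrow> nat set list \<Rightarrow> complex" where
  "tabloid_action \<pi> v = (\<lambda>X. v (map ((`) (inv \<pi>)) X))"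

definition irr_char :: "nat list \<Rightarrow> (nat \<Rightarrow> nat) \<Rightarrow> complex" where
  "irr_char \<mu> \<pi> = trace_on (specht_module \<mu>) (tabloid_action \<pi>)"


section \<open>Signed permutations\<close>

text \<open>The barred letter of \<open>i\<close> is represented by the integer \<open>- i\<close>, and a signed permutation
  by the list of its values, so that \<open>w(i)\<close> is \<open>w ! (i - 1)\<close>.\<close>

definition signed_perms :: "nat \<Rightarrow> int list set" where
  "signed_perms n = {w. length w = n \<and> distinct (map abs w) \<and> abs ` set w = {1..int n}}"

definition letter_residue :: "nat \<Rightarrow> int \<Rightarrow> int" where
  "letter_residue n a = (if a > 0 then a else int n + \<bar>a\<bar>) mod (2 * int n)"

definition cyclic_interval :: "nat \<Rightarrow> int set \<Rightarrow> bool" where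
  "cyclic_interval m A \<longleftrightarrow> (\<exists>a l. A = (\<lambda>j. (a + int j) mod int m) ` {..<l})"

definition B_arc_perms :: "nat \<Rightarrow> int list set" where
  "B_arc_perms n = {w \<in> signed_perms n.
     \<forall>i\<in>{1..n}. cyclic_interval (2 * n) (letter_residue n ` set (drop (i - 1) w))}"

definition less_r :: "int \<Rightarrow> int \<Rightarrow> bool" where
  "less_r a b \<longleftrightarrow> (if a < 0 \<and> b < 0 then \<bar>a\<bar> < \<bar>b\<bar> else a < b)"

definition Des :: "nat \<Rightarrow> int list \<Rightarrow> nat set" where
  "Des n w = {i \<in> {1..n - 1}. less_r (w ! i) (w ! (i - 1))}"

definition hook :: "nat \<Rightarrow> nat \<Rightarrow> nat list" where
  "hook k m = k # replicate m 1"

end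

theory Submission
  imports Defs
begin

text \<open>The sum over \<open>k\<close> of the hook characters of degree \<open>n\<close> is half the character \<open>X\<close> of the exterior
  algebra of the permutation representation, \<open>X(\<pi>) = \<Sum>\<^sub>S sgn(\<pi>|S)\<close> over the \<open>\<pi>\<close>-invariant sets \<open>S\<close>.
  The coefficient of a monomial \<open>M\<close> of degree \<open>n\<close> in the characteristic of \<open>X\<close> is the average of \<open>X\<close> over
  a Young subgroup. Sets \<open>S\<close> with two points in the same block cancel, and the coefficient is \<open>2^d\<close> with
  \<open>d\<close> the number of distinct variables of \<open>M\<close>. As induction multiplies the characteristic by \<open>p\<^sub>1\<close>, the
  coefficient of the right-hand side is \<open>n 2^(d - 1) + \<Sum>\<^sub>i 2^(d\<^sub>i)\<close>, where \<open>i\<close> runs through the variables of \<open>M\<close>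
  and \<open>d\<^sub>i\<close> is the number of distinct variables of \<open>M / x\<^sub>i\<close>. The coefficient of the left-hand side counts the
  arc permutations that increase on the blocks of the composition given by \<open>M\<close>. Such a permutation removes
  the letters of an arc of \<open>n\<close> letters from its two ends, and its number is computed letter by letter,
  separately for the arcs that do and do not cross the cut of the cyclic order.\<close>

section \<open>The Frobenius characteristic of the exterior algebra\<close>

text \<open>The factor one half comes from the splitting of the permutation representation into the
  trivial one and the standard one \<open>W\<close>: its exterior algebra is two copies of that of
  \<open>W\<close>, and the exterior powers of \<open>W\<close> are the hook representations. As
  \<open>irr_char\<close> is a trace on a span of polytabloids, this is redone by hand. Tableaux
  with \<open>n\<close> in the corner give a basis dual to a family of tabloids, so diagonal entries
  can be read off as signed counts, and the doubling follows from a sign-reversing bijection between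
  two classes of these terms. On the other side, the number of compatible words on one arc across
  the cut depends on the start of the arc. Its recursion moves the start, so only the sum over all
  such starts is computed, jointly with the sum of the counts in which the first letter is bounded
  below. Many identities are stated doubled, which keeps \<open>2 ^ (d - 1)\<close> out of the
  natural numbers.\<close>

lemma mps_coeff_sum: "mps_coeff (sum f A) M = (\<Sum>a\<in>A. mps_coeff (f a) M)"
  by (induction A rule: infinite_finite_induct) (auto simp: zero_mps.rep_eq plus_mps.rep_eq)

lemma mps_coeff_const_times: "mps_coeff (mps_const c * f) M = c * mps_coeff f M"
proof -
  have "mps_coeff (mps_const c * f) M = (\<Sum>A | A \<subseteq># M. if A = {#} then c * mps_coeff f M else 0)"
    unfolding times_mps.rep_eq by (intro sum.cong) (auto simp: mps_const.rep_eq)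
  then show ?thesis by (simp add: finite_msubsets)
qed

section \<open>Coefficients of products of power sums\<close>

lemma inj_replicate_mset: "0 < k \<Longrightarrow> inj (replicate_mset k)"
  by (rule injI) (metis in_replicate_mset less_not_refl)

lemma finite_replicate_mset_subseteq:
  assumes "0 < k"
  shows "finite {i. replicate_mset k i \<subseteq># M}"
  by (rule finite_subset[of _ "set_mset M"]) (use assms in \<open>auto dest!: mset_subset_eqD\<close>)

lemma mps_coeff_power_sum_times:
  assumes k: "0 < k"
  shows "mps_coeff (power_sum k * f) M =
    (\<Sum>i | replicate_mset k i \<subseteq># M. mps_coeff f (M - replicate_mset k i))"
proof -
  let ?I = "{i. replicate_mset k i \<subseteq># M}"
  have "mps_coeff (power_sum k * f) M =
      (\<Sum>A | A \<subseteq># M. if \<exists>i. A = replicate_mset k i then mps_coeff f (M - A) else 0)"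
    unfolding times_mps.rep_eq by (intro sum.cong) (auto simp: power_sum.rep_eq)
  also have "\<dots> = (\<Sum>A\<in>replicate_mset k ` ?I. mps_coeff f (M - A))"
    by (rule sum.mono_neutral_cong_right) (auto simp: finite_msubsets)
  also have "\<dots> = (\<Sum>i\<in>?I. mps_coeff f (M - replicate_mset k i))"
    using inj_replicate_mset[OF k] by (subst sum.reindex) (auto simp: inj_on_def)
  finally show ?thesis .
qed

text \<open>Each factor contributes one variable. Finiteness is part of the induction because
  \<open>card\<close> of an infinite set is 0; it relies on \<open>0 < k x\<close>, as a factor with
  exponent 0 would leave its variable undetermined by \<open>M\<close>.\<close>

lemma mps_coeff_prod_power_sum:
  assumes "finite X" "\<And>x. x \<in> X \<Longrightarrow> 0 < k x"
  shows "finite {f \<in> X \<rightarrow>\<^sub>E UNIV. (\<Sum>x\<in>X. replicate_mset (k x) (f x)) = M} \<and>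
    mps_coeff (\<Prod>x\<in>X. power_sum (k x)) M =
      of_nat (card {f \<in> X \<rightarrow>\<^sub>E UNIV. (\<Sum>x\<in>X. replicate_mset (k x) (f x)) = M})"
  using assms
proof (induction X arbitrary: M rule: finite_induct)
  case empty
  have "{f \<in> {} \<rightarrow>\<^sub>E UNIV. {#} = M} = (if M = {#} then {\<lambda>_. undefined} else {})" by auto
  then show ?case by (simp add: one_mps.rep_eq)
next
  case (insert x X)
  let ?G = "\<lambda>M. {f \<in> X \<rightarrow>\<^sub>E UNIV. (\<Sum>x\<in>X. replicate_mset (k x) (f x)) = M}"
  let ?F = "{f \<in> insert x X \<rightarrow>\<^sub>E UNIV. (\<Sum>x\<in>insert x X. replicate_mset (k x) (f x)) = M}"
  let ?I = "{i. replicate_mset (k x) i \<subseteq># M}"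
  let ?S = "Sigma ?I (\<lambda>i. ?G (M - replicate_mset (k x) i))"
  have kx: "0 < k x" using insert by simp
  have IH: "finite (?G M)" "mps_coeff (\<Prod>x\<in>X. power_sum (k x)) M = of_nat (card (?G M))" for M
    using insert by blast+
  have upd: "(\<Sum>y\<in>X. replicate_mset (k y) ((g(x := i)) y)) = (\<Sum>y\<in>X. replicate_mset (k y) (g y))" for g i
    using insert(2) by (intro sum.cong) auto
  have bij: "bij_betw (\<lambda>(i, g). g(x := i)) ?S ?F"
  proof (rule bij_betw_byWitness[where f' = "\<lambda>f. (f x, restrict f X)"])
    show "\<forall>a\<in>?S. (\<lambda>f. (f x, restrict f X)) ((\<lambda>(i, g). g(x := i)) a) = a"
      using insert(2) by (auto simp: restrict_def PiE_def extensional_def fun_eq_iff)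
    show "\<forall>f\<in>?F. (\<lambda>(i, g). g(x := i)) (f x, restrict f X) = f"
      by (auto simp: restrict_def PiE_def extensional_def fun_eq_iff)
    show "(\<lambda>(i, g). g(x := i)) ` ?S \<subseteq> ?F"
    proof
      fix h assume "h \<in> (\<lambda>(i, g). g(x := i)) ` ?S"
      then obtain i g where h: "h = g(x := i)" and *: "replicate_mset (k x) i \<subseteq># M" "g \<in> X \<rightarrow>\<^sub>E UNIV"
        "(\<Sum>x\<in>X. replicate_mset (k x) (g x)) = M - replicate_mset (k x) i"
        by auto
      have "h \<in> insert x X \<rightarrow>\<^sub>E UNIV" unfolding h using *(2) by (auto simp: PiE_def extensional_def)
      moreover have "(\<Sum>y\<in>insert x X. replicate_mset (k y) (h y)) = M"
        unfolding h sum.insert[OF insert(1,2)] upd *(3) using *(1) by simp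
      ultimately show "h \<in> ?F" by blast
    qed
    show "(\<lambda>f. (f x, restrict f X)) ` ?F \<subseteq> ?S"
      using insert(1,2) by auto
  qed
  have finS: "finite ?S"
    using finite_replicate_mset_subseteq[OF kx] IH(1) by blast
  have "mps_coeff (\<Prod>x\<in>insert x X. power_sum (k x)) M = (\<Sum>i\<in>?I. of_nat (card (?G (M - replicate_mset (k x) i))))"
    using insert(1,2) by (simp add: mps_coeff_power_sum_times[OF kx] IH(2))
  also have "\<dots> = of_nat (card ?S)"
    using finite_replicate_mset_subseteq[OF kx] IH(1) by (subst card_SigmaI) auto
  also have "card ?S = card ?F" using bij_betw_same_card[OF bij] .
  finally show ?case using bij_betw_finite[OF bij] finS by blast
qed

section \<open>Colorings and Young subgroups\<close>

definition colorings :: "nat \<Rightarrow> 'c multiset \<Rightarrow> (nat \<Rightarrow> 'c) set" where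
  "colorings n M = {\<phi> \<in> {1..n} \<rightarrow>\<^sub>E UNIV. image_mset \<phi> (mset_set {1..n}) = M}"

definition fixed_colorings :: "nat \<Rightarrow> (nat \<Rightarrow> nat) \<Rightarrow> 'c multiset \<Rightarrow> (nat \<Rightarrow> 'c) set" where
  "fixed_colorings n \<pi> M = {\<phi> \<in> colorings n M. \<forall>x\<in>{1..n}. \<phi> (\<pi> x) = \<phi> x}"

text \<open>A Young subgroup; the colorings with the same content as \<open>\<phi>\<close> form its
  coset space.\<close>

definition coloring_stabilizer :: "nat \<Rightarrow> (nat \<Rightarrow> 'c) \<Rightarrow> (nat \<Rightarrow> nat) set" where
  "coloring_stabilizer n \<phi> = {\<pi>. \<pi> permutes {1..n} \<and> (\<forall>x\<in>{1..n}. \<phi> (\<pi> x) = \<phi> x)}"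

lemma finite_colorings: "finite (colorings n M)"
proof (rule finite_subset)
  show "colorings n M \<subseteq> {1..n} \<rightarrow>\<^sub>E set_mset M"
    by (force simp: colorings_def PiE_def Pi_def)
qed (simp add: finite_PiE)

lemma finite_fixed_colorings: "finite (fixed_colorings n \<pi> M)"
  by (rule finite_subset[OF _ finite_colorings[of n M]]) (auto simp: fixed_colorings_def)

lemma restrict_in_colorings:
  "image_mset f (mset_set {1..n}) = M \<Longrightarrow> restrict f {1..n} \<in> colorings n M"
proof -
  assume M: "image_mset f (mset_set {1..n}) = M"
  have "image_mset (restrict f {1..n}) (mset_set {1..n}) = image_mset f (mset_set {1..n})"
    by (intro image_mset_cong) auto
  moreover have "restrict f {1..n} \<in> {1..n} \<rightarrow>\<^sub>E UNIV" by simp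
  ultimately show ?thesis using M by (simp only: colorings_def mem_Collect_eq)
qed

lemma size_coloring: "\<phi> \<in> colorings n M \<Longrightarrow> size M = n"
  by (auto simp: colorings_def)

lemma sum_singleton_mset: "(\<Sum>x\<in>A. {#f x#}) = image_mset f (mset_set A)"
  by (induction A rule: infinite_finite_induct) auto

text \<open>A coloring fixed by \<open>\<pi>\<close> is constant on orbits, so it chooses one
  variable per cycle, and a cycle of length \<open>k\<close> contributes that variable
  \<open>k\<close> times, as a term of \<open>power_sum k\<close> does.\<close>

lemma coeff_prod_cycle_type:
  assumes \<pi>: "\<pi> permutes {1..n}"
  shows "mps_coeff (\<Prod>k\<in>#cycle_type n \<pi>. power_sum k) M = of_nat (card (fixed_colorings n \<pi> M))"
proof -
  let ?O = "orbit \<pi> ` {1..n}"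
  have perm: "permutation \<pi>" using \<pi> by (auto intro: permutes_imp_permutation)
  have self: "x \<in> orbit \<pi> x" for x using permutation_self_in_orbit[OF perm] .
  have orb_eq: "orbit \<pi> y = orbit \<pi> x" if "y \<in> orbit \<pi> x" for x y
    using that by induction (simp_all add: permutation_orbit_step[OF perm])
  have sub: "orbit \<pi> x \<subseteq> {1..n}" if "x \<in> {1..n}" for x
    using permutes_orbit_subset[OF \<pi> that] .
  have fibre: "{x \<in> {1..n}. orbit \<pi> x = c} = c" if "c \<in> ?O" for c
    using that sub orb_eq self by blast
  have pos: "0 < card c" if "c \<in> ?O" for c
  proof -
    have "finite c" using that sub finite_subset[of c "{1..n}"] by blast
    then show ?thesis using that orbit_nonempty[of \<pi>] by (auto simp: card_gt_0_iff)
  qed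
  have const: "\<phi> y = \<phi> x" if "y \<in> orbit \<pi> x" "x \<in> {1..n}" "\<forall>x\<in>{1..n}. \<phi> (\<pi> x) = \<phi> x"
    for \<phi> :: "nat \<Rightarrow> nat" and x y
    using that(1)
  proof induction
    case (step y)
    then show ?case using that sub[OF that(2)] by auto
  qed (use that in auto)
  have mset: "image_mset (\<lambda>x. f (orbit \<pi> x)) (mset_set {1..n}) = (\<Sum>c\<in>?O. replicate_mset (card c) (f c))"
    for f :: "nat set \<Rightarrow> nat"
  proof -
    have "image_mset (\<lambda>x. f (orbit \<pi> x)) (mset_set {1..n}) = (\<Sum>x\<in>{1..n}. {#f (orbit \<pi> x)#})"
      by (simp add: sum_singleton_mset)
    also have "\<dots> = (\<Sum>c\<in>?O. \<Sum>x | x \<in> {1..n} \<and> orbit \<pi> x = c. {#f (orbit \<pi> x)#})"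
      by (rule sum.group[symmetric]) auto
    also have "\<dots> = (\<Sum>c\<in>?O. \<Sum>x\<in>c. {#f c#})"
    proof (rule sum.cong[OF refl])
      fix c assume c: "c \<in> ?O"
      have "(\<Sum>x | x \<in> {1..n} \<and> orbit \<pi> x = c. {#f (orbit \<pi> x)#}) = (\<Sum>x | x \<in> {1..n} \<and> orbit \<pi> x = c. {#f c#})"
        by (rule sum.cong) auto
      then show "(\<Sum>x | x \<in> {1..n} \<and> orbit \<pi> x = c. {#f (orbit \<pi> x)#}) = (\<Sum>x\<in>c. {#f c#})"
        by (simp only: fibre[OF c])
    qed
    also have "\<dots> = (\<Sum>c\<in>?O. replicate_mset (card c) (f c))"
      by (simp add: sum_singleton_mset image_mset_const_eq)
    finally show ?thesis .
  qed
  let ?F = "{f \<in> ?O \<rightarrow>\<^sub>E UNIV. (\<Sum>c\<in>?O. replicate_mset (card c) (f c)) = M}"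
  have some: "(SOME x. x \<in> orbit \<pi> y) \<in> orbit \<pi> y" for y
    by (rule someI[of _ y]) (rule self)
  have "bij_betw (\<lambda>f. \<lambda>x\<in>{1..n}. f (orbit \<pi> x)) ?F (fixed_colorings n \<pi> M)"
  \<comment> \<open>Any representative of an orbit serves, since the colorings concerned are
    constant on orbits.\<close>
  proof (rule bij_betw_byWitness[where f' = "\<lambda>\<phi>. \<lambda>c\<in>?O. \<phi> (SOME x. x \<in> c)"])
    show "\<forall>f\<in>?F. (\<lambda>c\<in>?O. (\<lambda>x\<in>{1..n}. f (orbit \<pi> x)) (SOME x. x \<in> c)) = f"
    proof (intro ballI ext)
      fix f c assume f: "f \<in> ?F"
      show "(\<lambda>c\<in>?O. (\<lambda>x\<in>{1..n}. f (orbit \<pi> x)) (SOME x. x \<in> c)) c = f c"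
      proof (cases "c \<in> ?O")
        case True
        then obtain y where "y \<in> {1..n}" "c = orbit \<pi> y" by auto
        then show ?thesis using some[of y] sub[of y] orb_eq[OF some[of y]] True by auto
      next
        case False
        then show ?thesis using f by (auto simp: PiE_def extensional_def)
      qed
    qed
    show "\<forall>\<phi>\<in>fixed_colorings n \<pi> M. (\<lambda>x\<in>{1..n}. (\<lambda>c\<in>?O. \<phi> (SOME x. x \<in> c)) (orbit \<pi> x)) = \<phi>"
    proof (intro ballI ext)
      fix \<phi> y assume "\<phi> \<in> fixed_colorings n \<pi> M"
      then show "(\<lambda>x\<in>{1..n}. (\<lambda>c\<in>?O. \<phi> (SOME x. x \<in> c)) (orbit \<pi> x)) y = \<phi> y"
        using const[OF some[of y], of \<phi>]
        by (auto simp: fixed_colorings_def colorings_def PiE_def extensional_def restrict_def)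
    qed
    have inv: "\<pi> x \<in> {1..n}" if "x \<in> {1..n}" for x
      using permutes_in_image[OF \<pi>] that by blast
    show "(\<lambda>f. \<lambda>x\<in>{1..n}. f (orbit \<pi> x)) ` ?F \<subseteq> fixed_colorings n \<pi> M"
    proof safe
      fix f assume f: "f \<in> ?O \<rightarrow>\<^sub>E UNIV" "M = (\<Sum>c\<in>?O. replicate_mset (card c) (f c))"
      have "image_mset (\<lambda>x\<in>{1..n}. f (orbit \<pi> x)) (mset_set {1..n}) = image_mset (\<lambda>x. f (orbit \<pi> x)) (mset_set {1..n})"
        by (intro image_mset_cong) auto
      then show "(\<lambda>x\<in>{1..n}. f (orbit \<pi> x)) \<in> fixed_colorings n \<pi> (\<Sum>c\<in>?O. replicate_mset (card c) (f c))"
        using mset inv permutation_orbit_step[OF perm] by (auto simp: fixed_colorings_def colorings_def)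
    qed
    show "(\<lambda>\<phi>. \<lambda>c\<in>?O. \<phi> (SOME x. x \<in> c)) ` fixed_colorings n \<pi> M \<subseteq> ?F"
    proof safe
      fix \<phi> assume \<phi>: "\<phi> \<in> fixed_colorings n \<pi> M"
      let ?f = "\<lambda>c. \<phi> (SOME x. x \<in> c)"
      have "(\<Sum>c\<in>?O. replicate_mset (card c) ((\<lambda>c\<in>?O. ?f c) c)) = (\<Sum>c\<in>?O. replicate_mset (card c) (?f c))"
        by (intro sum.cong) auto
      also have "\<dots> = image_mset (\<lambda>x. ?f (orbit \<pi> x)) (mset_set {1..n})" by (rule mset[symmetric])
      also have "\<dots> = image_mset \<phi> (mset_set {1..n})"
        using const[OF some] \<phi> by (intro image_mset_cong) (auto simp: fixed_colorings_def)
      also have "\<dots> = M" using \<phi> by (simp add: fixed_colorings_def colorings_def)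
      finally show "(\<Sum>c\<in>?O. replicate_mset (card c) ((\<lambda>c\<in>?O. ?f c) c)) = M" .
    qed auto
  qed
  then have "card ?F = card (fixed_colorings n \<pi> M)" by (rule bij_betw_same_card)
  moreover have "(\<Prod>k\<in>#cycle_type n \<pi>. power_sum k) = (\<Prod>c\<in>?O. power_sum (card c))"
    by (simp add: cycle_type_def prod_unfold_prod_mset multiset.map_comp comp_def)
  ultimately show ?thesis
    using mps_coeff_prod_power_sum[of ?O card M] pos by auto
qed

text \<open>The number of fixed colorings is the permutation character on colorings of content
  \<open>M\<close>; the coefficient is thus the inner product of \<open>\<chi>\<close> with the
  trivial character induced from a Young subgroup.\<close>

lemma mps_coeff_frobenius_ch:
  "mps_coeff (frobenius_ch n \<chi>) M =
    1 / fact n * (\<Sum>\<pi> | \<pi> permutes {1..n}. \<chi> \<pi> * of_nat (card (fixed_colorings n \<pi> M)))"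
  unfolding frobenius_ch_def mps_coeff_const_times mps_coeff_sum
  by (intro arg_cong2[where f = "(*)"] sum.cong refl) (simp add: coeff_prod_cycle_type)

lemma fixed_colorings_empty: "size M \<noteq> n \<Longrightarrow> fixed_colorings n \<pi> M = {}"
  by (auto simp: fixed_colorings_def dest: size_coloring)

text \<open>Orbit-stabilizer for the action on colorings: the fibres of \<open>\<sigma> \<mapsto> \<phi>\<^sub>0 \<circ> \<sigma>\<close> are cosets of stabilizers.\<close>

lemma sum_card_coloring_stabilizer:
  fixes M :: "'c multiset"
  assumes M: "size M = n"
  shows "(\<Sum>\<phi>\<in>colorings n M. card (coloring_stabilizer n \<phi>)) = fact n"
proof -
  obtain xs where xs: "mset xs = M" using ex_mset by blast
  then have len: "length xs = n" using M by auto
  define \<phi>0 where "\<phi>0 = (\<lambda>i\<in>{1..n}. xs ! (i - 1))"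
  have "mset_set {1..n} = image_mset Suc (mset_set {0..<n})"
    by (subst image_mset_mset_set) (auto simp: image_Suc_atLeastLessThan atLeastLessThanSuc_atLeastAtMost)
  then have "image_mset \<phi>0 (mset_set {1..n}) = image_mset (\<lambda>i. xs ! i) (mset_set {0..<n})"
    by (auto simp: multiset.map_comp \<phi>0_def intro!: image_mset_cong)
  also have "\<dots> = mset (map (\<lambda>i. xs ! i) [0..<n])"
    by (simp flip: mset_upt)
  also have "\<dots> = M" using xs len map_nth[of xs] by simp
  finally have \<phi>0M: "image_mset \<phi>0 (mset_set {1..n}) = M" .
  let ?P = "{\<sigma>. \<sigma> permutes {1..n}}"
  let ?g = "\<lambda>\<sigma>. restrict (\<phi>0 \<circ> \<sigma>) {1..n}"
  have img: "?g \<sigma> \<in> colorings n M" if "\<sigma> permutes {1..n}" for \<sigma>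
    by (rule restrict_in_colorings)
      (metis \<phi>0M multiset.map_comp permutes_image_mset[OF that])
  have "fact n = card ?P" by (simp add: card_permutations)
  also have "\<dots> = (\<Sum>\<sigma>\<in>?P. 1)" by simp
  also have "\<dots> = (\<Sum>\<phi>\<in>colorings n M. \<Sum>\<sigma> | \<sigma> \<in> ?P \<and> ?g \<sigma> = \<phi>. 1)"
    by (rule sum.group[symmetric]) (use img in \<open>auto simp: finite_permutations finite_colorings\<close>)
  also have "\<dots> = (\<Sum>\<phi>\<in>colorings n M. card (coloring_stabilizer n \<phi>))"
  proof (rule sum.cong[OF refl])
    fix \<phi> assume \<phi>: "\<phi> \<in> colorings n M"
    have "image_mset \<phi> (mset_set {1..n}) = image_mset \<phi>0 (mset_set {1..n})"
      using \<phi> \<phi>0M by (simp add: colorings_def)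
    \<comment> \<open>Transitivity of the action: colorings with equal content differ by a
      permutation.\<close>
    then obtain \<tau> where \<tau>: "\<tau> permutes {1..n}" "\<forall>x\<in>{1..n}. \<phi> x = \<phi>0 (\<tau> x)"
      using image_mset_eq_implies_permutes[of "{1..n}" \<phi> \<phi>0] by auto
    have \<phi>_ext: "\<phi> = restrict \<phi> {1..n}" using \<phi> by (auto simp: colorings_def intro: PiE_restrict[symmetric])
    have "bij_betw (\<lambda>\<pi>. \<tau> \<circ> \<pi>) (coloring_stabilizer n \<phi>) {\<sigma>. \<sigma> \<in> ?P \<and> ?g \<sigma> = \<phi>}"
    proof (rule bij_betw_byWitness[where f' = "\<lambda>\<sigma>. inv \<tau> \<circ> \<sigma>"])
      show "\<forall>\<pi>\<in>coloring_stabilizer n \<phi>. inv \<tau> \<circ> (\<tau> \<circ> \<pi>) = \<pi>"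
        by (simp add: comp_assoc[symmetric] permutes_inv_o[OF \<tau>(1)])
      show "\<forall>\<sigma>\<in>{\<sigma>. \<sigma> \<in> ?P \<and> ?g \<sigma> = \<phi>}. \<tau> \<circ> (inv \<tau> \<circ> \<sigma>) = \<sigma>"
        by (simp add: comp_assoc[symmetric] permutes_inv_o[OF \<tau>(1)])
      show "(\<lambda>\<pi>. \<tau> \<circ> \<pi>) ` coloring_stabilizer n \<phi> \<subseteq> {\<sigma>. \<sigma> \<in> ?P \<and> ?g \<sigma> = \<phi>}"
      proof safe
        fix \<pi> assume \<pi>: "\<pi> \<in> coloring_stabilizer n \<phi>"
        then have p: "\<pi> permutes {1..n}" by (simp add: coloring_stabilizer_def)
        show "\<tau> \<circ> \<pi> permutes {1..n}" using permutes_compose[OF p \<tau>(1)] .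
        have "\<phi>0 (\<tau> (\<pi> x)) = \<phi> x" if "x \<in> {1..n}" for x
        proof -
          have "\<pi> x \<in> {1..n}" using permutes_in_image[OF p] that by blast
          then have "\<phi>0 (\<tau> (\<pi> x)) = \<phi> (\<pi> x)" using \<tau>(2) by metis
          also have "\<dots> = \<phi> x" using \<pi> that by (simp add: coloring_stabilizer_def)
          finally show ?thesis .
        qed
        then show "?g (\<tau> \<circ> \<pi>) = \<phi>" by (subst \<phi>_ext) (auto simp: restrict_def fun_eq_iff)
      qed
      show "(\<lambda>\<sigma>. inv \<tau> \<circ> \<sigma>) ` {\<sigma>. \<sigma> \<in> ?P \<and> ?g \<sigma> = \<phi>} \<subseteq> coloring_stabilizer n \<phi>"
      proof safe
        fix \<sigma> assume \<sigma>: "\<sigma> permutes {1..n}" and g: "\<phi> = ?g \<sigma>"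
        have p: "inv \<tau> \<circ> \<sigma> permutes {1..n}"
          using permutes_compose[OF \<sigma> permutes_inv[OF \<tau>(1)]] .
        have "\<phi> ((inv \<tau> \<circ> \<sigma>) x) = \<phi> x" if "x \<in> {1..n}" for x
        proof -
          have "\<phi> ((inv \<tau> \<circ> \<sigma>) x) = \<phi>0 (\<tau> ((inv \<tau> \<circ> \<sigma>) x))"
            using \<tau>(2) permutes_in_image[OF p, of x] that by blast
          also have "\<dots> = \<phi>0 (\<sigma> x)" using permutes_inverses(1)[OF \<tau>(1)] by simp
          also have "\<dots> = \<phi> x" using fun_cong[OF g, of x] that by simp
          finally show ?thesis .
        qed
        then show "inv \<tau> \<circ> \<sigma> \<in> coloring_stabilizer n (?g \<sigma>)"
          using p unfolding g[symmetric] coloring_stabilizer_def by blast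
      qed
    qed
    then show "(\<Sum>\<sigma> | \<sigma> \<in> ?P \<and> ?g \<sigma> = \<phi>. 1) = card (coloring_stabilizer n \<phi>)"
      by (simp add: bij_betw_same_card)
  qed
  finally show ?thesis ..
qed


section \<open>The exterior character and marked colorings\<close>

text \<open>A permutation \<open>\<pi>\<close> fixes the basis vector of \<open>\<Lambda> \<complex>\<^sup>V\<close> indexed by \<open>S\<close> up to a scalar iff \<open>\<pi>\<close> preserves \<open>S\<close>,
  and then the scalar is the sign of the restriction \<open>\<sigma>\<close> of \<open>\<pi>\<close> to \<open>S\<close>.\<close>

definition invariant_pairs :: "nat set \<Rightarrow> (nat \<Rightarrow> nat) \<Rightarrow> (nat set \<times> (nat \<Rightarrow> nat)) set" where
  "invariant_pairs V \<pi> = {(S, \<sigma>). S \<subseteq> V \<and> \<sigma> permutes S \<and> (\<forall>s\<in>S. \<sigma> s = \<pi> s)}"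

definition exterior_char :: "nat set \<Rightarrow> (nat \<Rightarrow> nat) \<Rightarrow> complex" where
  "exterior_char V \<pi> = (\<Sum>(S, \<sigma>)\<in>invariant_pairs V \<pi>. of_int (sign \<sigma>))"

lemma finite_invariant_pairs: "finite V \<Longrightarrow> finite (invariant_pairs V \<pi>)"
  by (rule finite_subset[of _ "Pow V \<times> {\<sigma>. \<sigma> permutes V}"])
    (auto simp: invariant_pairs_def finite_permutations intro: permutes_subset)

text \<open>If \<open>\<phi>\<close> is injective on \<open>S\<close>, a color-preserving
  \<open>\<pi>\<close> that preserves \<open>S\<close> fixes \<open>S\<close> pointwise; all signs
  are 1, and the remaining \<open>\<pi>\<close> form the stabilizer of the coloring in which the
  points of \<open>S\<close> are marked. Otherwise composition with the transposition of two points
  of \<open>S\<close> of equal color is a sign-reversing involution of \<open>R\<close>.\<close>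

lemma sum_sign_coloring_stabilizer:
  fixes \<phi> :: "nat \<Rightarrow> nat"
  assumes S: "S \<subseteq> {1..n}"
  defines "R \<equiv> {(\<pi>, \<sigma>). \<pi> \<in> coloring_stabilizer n \<phi> \<and> \<sigma> permutes S \<and> (\<forall>s\<in>S. \<sigma> s = \<pi> s)}"
  shows "(\<Sum>(\<pi>, \<sigma>)\<in>R. of_int (sign \<sigma>)) =
    (if inj_on \<phi> S then of_nat (card (coloring_stabilizer n (\<lambda>x\<in>{1..n}. (\<phi> x, x \<in> S)))) else (0 :: complex))"
proof (cases "inj_on \<phi> S")
  case True
  let ?\<psi> = "\<lambda>x\<in>{1..n}. (\<phi> x, x \<in> S)" and ?j = "\<lambda>\<pi> :: nat \<Rightarrow> nat. (\<pi>, id :: nat \<Rightarrow> nat)"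
  have id: "\<sigma> = id \<and> (\<forall>s\<in>S. \<pi> s = s)" if "(\<pi>, \<sigma>) \<in> R" for \<pi> \<sigma>
  proof -
    have *: "\<sigma> permutes S" "\<forall>s\<in>S. \<sigma> s = \<pi> s" "\<forall>x\<in>{1..n}. \<phi> (\<pi> x) = \<phi> x"
      using that by (auto simp: R_def coloring_stabilizer_def)
    have "\<pi> s = s" if "s \<in> S" for s
    proof (rule inj_onD[OF True _ _ that])
      show "\<pi> s \<in> S" using permutes_in_image[OF *(1), of s] *(2) that by auto
      show "\<phi> (\<pi> s) = \<phi> s" using *(3) that S by auto
    qed
    then show ?thesis using * by (auto simp: fun_eq_iff) (metis permutes_def)
  qed
  have "R = ?j ` coloring_stabilizer n ?\<psi>"
  proof (intro equalityI subsetI)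
    fix p assume p: "p \<in> R"
    obtain \<pi> \<sigma> where p': "p = (\<pi>, \<sigma>)" by (cases p)
    have \<pi>: "\<pi> permutes {1..n}" "\<forall>x\<in>{1..n}. \<phi> (\<pi> x) = \<phi> x"
      using p by (auto simp: p' R_def coloring_stabilizer_def)
    note fixS = id[OF p[unfolded p']]
    have "\<pi> x \<in> S \<longleftrightarrow> x \<in> S" for x
      using fixS permutes_inj[OF \<pi>(1)] by (metis injD)
    then have "\<pi> \<in> coloring_stabilizer n ?\<psi>"
      using \<pi> permutes_in_image[OF \<pi>(1)] unfolding coloring_stabilizer_def by auto
    then show "p \<in> ?j ` coloring_stabilizer n ?\<psi>"
      using fixS by (auto simp: p')
  next
    fix p assume "p \<in> ?j ` coloring_stabilizer n ?\<psi>"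
    then obtain \<pi> where p: "p = (\<pi>, id)" "\<pi> \<in> coloring_stabilizer n ?\<psi>" by auto
    then have \<pi>: "\<pi> permutes {1..n}" "\<forall>x\<in>{1..n}. \<phi> (\<pi> x) = \<phi> x \<and> (\<pi> x \<in> S \<longleftrightarrow> x \<in> S)"
      using permutes_in_image[of \<pi> "{1..n}"] unfolding coloring_stabilizer_def by auto
    have "\<pi> s = s" if "s \<in> S" for s
      by (rule inj_onD[OF True _ _ that]) (use \<pi>(2) that S in auto)
    then show "p \<in> R" using \<pi> by (auto simp: p R_def coloring_stabilizer_def)
  qed
  then have "(\<Sum>(\<pi>, \<sigma>)\<in>R. of_int (sign \<sigma>)) = (\<Sum>\<pi>\<in>coloring_stabilizer n ?\<psi>. (1 :: complex))"
    by (simp add: sum.reindex inj_on_def del: sum_constant)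
  then show ?thesis using True by simp
next
  case False
  then obtain a b where ab: "a \<in> S" "b \<in> S" "a \<noteq> b" "\<phi> a = \<phi> b" by (auto simp: inj_on_def)
  let ?t = "transpose a b"
  let ?h = "\<lambda>(\<pi>, \<sigma>). (\<pi> \<circ> ?t, \<sigma> \<circ> ?t)"
  have finS: "finite S" using S finite_subset by blast
  have tS: "?t permutes S" "?t permutes {1..n}" using ab S by (auto intro: permutes_swap_id)
  have \<phi>t: "\<phi> (?t x) = \<phi> x" for x using ab(4) by (auto simp: transpose_def)
  have hR: "?h p \<in> R" if "p \<in> R" for p
  proof -
    obtain \<pi> \<sigma> where p: "p = (\<pi>, \<sigma>)" by (cases p)
    have *: "\<pi> permutes {1..n}" "\<forall>x\<in>{1..n}. \<phi> (\<pi> x) = \<phi> x" "\<sigma> permutes S" "\<forall>s\<in>S. \<sigma> s = \<pi> s"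
      using that by (auto simp: p R_def coloring_stabilizer_def)
    have "\<phi> (\<pi> (?t x)) = \<phi> x" if "x \<in> {1..n}" for x
      using *(2) permutes_in_image[OF tS(2), of x] \<phi>t that by auto
    moreover have "\<sigma> (?t s) = \<pi> (?t s)" if "s \<in> S" for s
      using *(4) permutes_in_image[OF tS(1), of s] that by auto
    ultimately show ?thesis
      using permutes_compose[OF tS(2) *(1)] permutes_compose[OF tS(1) *(3)]
      unfolding p R_def coloring_stabilizer_def by auto
  qed
  have hh: "?h (?h p) = p" for p by (cases p) (simp add: comp_assoc)
  let ?s = "\<lambda>(\<pi> :: nat \<Rightarrow> nat, \<sigma> :: nat \<Rightarrow> nat). of_int (sign \<sigma>) :: complex"
  have "sum ?s R = (\<Sum>p\<in>R. - ?s p)"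
  proof (rule sum.reindex_bij_witness[where i = ?h and j = ?h])
    fix p assume p: "p \<in> R"
    then have "permutation (snd p)" using finS by (auto simp: R_def intro: permutes_imp_permutation)
    then show "- ?s (?h p) = ?s p"
      using ab(3) permutation_swap_id[of a b] by (cases p) (simp add: sign_compose sign_swap_id)
  qed (use hR hh in auto)
  then have "sum ?s R = 0" by (simp add: sum_negf)
  then show ?thesis using False by simp
qed

lemma count_image_fst_bool: "count (image_mset fst M) c = count M (c, True) + count M (c, False)"
  by (induction M) auto

text \<open>\<open>M'\<close> is the content of a coloring with a marked set on which the coloring
  is injective. At most one copy of each color is marked, so \<open>M'\<close> amounts to the subset
  of colors of \<open>M\<close> that have a marked copy.\<close>

lemma card_marked_multisets:
  fixes M :: "'a multiset"
  shows "card {M' :: ('a \<times> bool) multiset. image_mset fst M' = M \<and> (\<forall>c. count M' (c, True) \<le> 1)} =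
    2 ^ card (set_mset M)"
proof -
  let ?N = "{M' :: ('a \<times> bool) multiset. image_mset fst M' = M \<and> (\<forall>c. count M' (c, True) \<le> 1)}"
  let ?f = "\<lambda>T. image_mset (\<lambda>c. (c, True)) (mset_set T) + image_mset (\<lambda>c. (c, False)) (M - mset_set T)"
  have cT: "count (image_mset (\<lambda>c. (c, b)) A) (c, b') = (if b = b' then count A c else 0)"
    for A :: "'a multiset" and b b' c
    by (induction A) auto
  have fin: "finite T" if "T \<subseteq> set_mset M" for T
    using that finite_subset by blast
  have "bij_betw ?f (Pow (set_mset M)) ?N"
  proof (rule bij_betw_byWitness[where f' = "\<lambda>M'. {c. (c, True) \<in># M'}"])
    show "\<forall>T\<in>Pow (set_mset M). {c. (c, True) \<in># ?f T} = T"
      using fin by auto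
    have count_le: "count (mset_set T) c \<le> count M c" if "T \<subseteq> set_mset M" for T c
      using that fin[OF that] by (cases "c \<in> T") (auto simp: Suc_le_eq)
    show "?f ` Pow (set_mset M) \<subseteq> ?N"
      using count_le fin
      by (auto intro!: multiset_eqI simp: count_image_fst_bool cT count_mset_set')
    show "\<forall>M'\<in>?N. ?f {c. (c, True) \<in># M'} = M'"
    proof (intro ballI multiset_eqI)
      fix M' :: "('a \<times> bool) multiset" and x :: "'a \<times> bool" assume M': "M' \<in> ?N"
      obtain c b where x: "x = (c, b)" by (cases x)
      have sub: "{c. (c, True) \<in># M'} \<subseteq> set_mset M" using M' by force
      have le: "count M' (c, True) \<le> 1" using M' by auto
      have "count M c = count M' (c, True) + count M' (c, False)"
        using M' count_image_fst_bool[of M' c] by auto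
      moreover have "count (mset_set {c. (c, True) \<in># M'}) c = count M' (c, True)"
      proof (cases "(c, True) \<in># M'")
        case True
        then have "count M' (c, True) = 1" using le by (simp add: le_antisym Suc_le_eq)
        then show ?thesis using True fin[OF sub] by simp
      qed (simp add: count_mset_set' not_in_iff)
      ultimately show "count (?f {c. (c, True) \<in># M'}) x = count M' x"
        by (cases b) (simp_all add: x cT)
    qed
    show "(\<lambda>M'. {c. (c, True) \<in># M'}) ` ?N \<subseteq> Pow (set_mset M)"
      by force
  qed
  then show ?thesis using bij_betw_same_card card_Pow[of "set_mset M"] by force
qed

text \<open>After exchanging the sums, signs are summed over a Young subgroup for each coloring and
  subset. What survives is the sum of the stabilizer orders of colorings by marked colors, and each
  content \<open>M'\<close> of these yields \<open>fact n\<close> by orbit counting.\<close>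

lemma sum_exterior_char:
  fixes M :: "nat multiset"
  assumes M: "size M = n"
  shows "(\<Sum>\<pi> | \<pi> permutes {1..n}. exterior_char {1..n} \<pi> * of_nat (card (fixed_colorings n \<pi> M))) =
    fact n * 2 ^ card (set_mset M)"
proof -
  let ?V = "{1..n}" and ?P = "{\<pi>. \<pi> permutes {1..n}}"
  let ?R = "\<lambda>(\<phi>, S). {(\<pi>, \<sigma>). \<pi> \<in> coloring_stabilizer n \<phi> \<and> \<sigma> permutes S \<and> (\<forall>s\<in>S. \<sigma> s = \<pi> s)}"
  let ?C = "colorings n M \<times> Pow ?V"
  let ?\<psi> = "\<lambda>(\<phi>, S). \<lambda>x\<in>?V. (\<phi> x, x \<in> S)"
  let ?N = "{M' :: (nat \<times> bool) multiset. image_mset fst M' = M \<and> (\<forall>c. count M' (c, True) \<le> 1)}"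
  have finR: "finite (?R c)" if "c \<in> ?C" for c
  proof (rule finite_subset)
    show "?R c \<subseteq> ?P \<times> ?P"
      using that by (auto simp: coloring_stabilizer_def intro: permutes_subset)
  qed (simp add: finite_permutations)
  have prod: "(\<Sum>((S, \<sigma>), \<phi>)\<in>A \<times> B. of_int (sign \<sigma>)) = (\<Sum>(S, \<sigma>)\<in>A. of_int (sign \<sigma>)) * (of_nat (card B) :: complex)"
    for A :: "(nat set \<times> (nat \<Rightarrow> nat)) set" and B :: "(nat \<Rightarrow> nat) set"
    by (simp add: case_prod_beta sum.cartesian_product' sum_distrib_left mult.commute)
  have "(\<Sum>\<pi>\<in>?P. exterior_char ?V \<pi> * of_nat (card (fixed_colorings n \<pi> M))) =
      (\<Sum>\<pi>\<in>?P. \<Sum>((S, \<sigma>), \<phi>)\<in>invariant_pairs ?V \<pi> \<times> fixed_colorings n \<pi> M. of_int (sign \<sigma>))"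
    by (simp only: exterior_char_def prod)
  also have "\<dots> = (\<Sum>(\<pi>, ((S, \<sigma>), \<phi>))\<in>(SIGMA \<pi>:?P. invariant_pairs ?V \<pi> \<times> fixed_colorings n \<pi> M). of_int (sign \<sigma>))"
    by (subst sum.Sigma) (auto simp: finite_permutations finite_invariant_pairs finite_fixed_colorings intro!: sum.cong)
  also have "\<dots> = (\<Sum>((\<phi>, S), (\<pi>, \<sigma>))\<in>Sigma ?C ?R. of_int (sign \<sigma>))"
    by (rule sum.reindex_bij_witness[where
          i = "\<lambda>((\<phi>, S), (\<pi>, \<sigma>)). (\<pi>, ((S, \<sigma>), \<phi>))" and j = "\<lambda>(\<pi>, ((S, \<sigma>), \<phi>)). ((\<phi>, S), (\<pi>, \<sigma>))"])
      (auto simp: invariant_pairs_def fixed_colorings_def coloring_stabilizer_def)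
  also have "\<dots> = (\<Sum>c\<in>?C. \<Sum>(\<pi>, \<sigma>)\<in>?R c. of_int (sign \<sigma>))"
    using finR by (subst sum.Sigma) (auto simp: finite_colorings case_prod_beta)
  also have "\<dots> = (\<Sum>c\<in>?C. if inj_on (fst c) (snd c) then of_nat (card (coloring_stabilizer n (?\<psi> c))) else 0)"
    by (intro sum.cong refl) (auto simp: sum_sign_coloring_stabilizer simp del: One_nat_def)
  also have "\<dots> = (\<Sum>c\<in>{c \<in> ?C. inj_on (fst c) (snd c)}. of_nat (card (coloring_stabilizer n (?\<psi> c))))"
    by (rule sum.inter_filter[symmetric]) (simp add: finite_colorings)
  also have "\<dots> = (\<Sum>\<psi>\<in>(\<Union>M'\<in>?N. colorings n M'). of_nat (card (coloring_stabilizer n \<psi>)))"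
  proof (rule sum.reindex_bij_witness[where j = ?\<psi> and
        i = "\<lambda>\<psi>. (restrict (fst \<circ> \<psi>) ?V, {x \<in> ?V. snd (\<psi> x)})"], goal_cases)
    case (1 c)
    then obtain \<phi> S where c: "c = (\<phi>, S)" "\<phi> \<in> colorings n M" "S \<subseteq> ?V" by auto
    then have "\<phi> x = undefined" if "x \<notin> ?V" for x
      using that by (auto simp: colorings_def PiE_def extensional_def)
    then show ?case using c(3) by (auto simp: c(1) fun_eq_iff restrict_def)
  next
    case (2 c)
    then obtain \<phi> S where c: "c = (\<phi>, S)" "\<phi> \<in> colorings n M" "S \<subseteq> ?V" and inj: "inj_on \<phi> S" by auto
    let ?M = "image_mset (?\<psi> c) (mset_set ?V)"
    have "image_mset fst ?M = image_mset \<phi> (mset_set ?V)"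
      by (auto simp: c(1) multiset.map_comp intro!: image_mset_cong)
    then have 1: "image_mset fst ?M = M" using c(2) by (simp add: colorings_def)
    have "count ?M (a, True) \<le> 1" for a
    proof -
      have "{x \<in> ?V. ?\<psi> c x = (a, True)} \<subseteq> {x \<in> S. \<phi> x = a}" by (auto simp: c(1))
      moreover have fin: "finite {x \<in> S. \<phi> x = a}"
        by (rule finite_subset[OF _ finite_atLeastAtMost[of 1 n]]) (use c(3) in auto)
      moreover have "card {x \<in> S. \<phi> x = a} \<le> 1"
        using inj fin by (subst card_le_Suc0_iff_eq[folded One_nat_def]) (auto simp: inj_on_def)
      ultimately have "card {x \<in> ?V. ?\<psi> c x = (a, True)} \<le> 1" by (meson card_mono le_trans)
      moreover have "count ?M (a, True) = card {x \<in> ?V. ?\<psi> c x = (a, True)}"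
        by (simp add: count_image_mset_eq_card_vimage del: One_nat_def)
      ultimately show ?thesis by simp
    qed
    then have "?M \<in> ?N" using 1 by simp
    moreover have "?\<psi> c \<in> colorings n ?M" unfolding colorings_def by (simp add: c(1))
    ultimately show ?case by blast
  next
    case (3 \<psi>)
    then have ext: "\<psi> \<in> ?V \<rightarrow>\<^sub>E UNIV" by (auto simp: colorings_def)
    show ?case
    proof
      fix x
      show "?\<psi> (restrict (fst \<circ> \<psi>) ?V, {x \<in> ?V. snd (\<psi> x)}) x = \<psi> x"
        using ext by (cases "x \<in> ?V") (auto simp: PiE_def extensional_def)
    qed
  next
    case (4 \<psi>)
    let ?M = "image_mset \<psi> (mset_set ?V)" and ?\<phi> = "restrict (fst \<circ> \<psi>) ?V" and ?S = "{x \<in> ?V. snd (\<psi> x)}"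
    have M': "image_mset fst ?M = M" "\<And>c. count ?M (c, True) \<le> 1"
      using 4 by (auto simp: colorings_def)
    have "?\<phi> \<in> colorings n M"
      using M'(1) by (intro restrict_in_colorings) (simp add: multiset.map_comp)
    moreover have "inj_on ?\<phi> ?S"
    proof (rule inj_onI)
      fix x y assume xy: "x \<in> ?S" "y \<in> ?S" "?\<phi> x = ?\<phi> y"
      let ?a = "fst (\<psi> x)"
      have "card {z \<in> ?V. \<psi> z = (?a, True)} \<le> 1"
        using M'(2)[of ?a] by (simp add: count_image_mset_eq_card_vimage del: One_nat_def)
      then have "\<forall>u\<in>{z \<in> ?V. \<psi> z = (?a, True)}. \<forall>v\<in>{z \<in> ?V. \<psi> z = (?a, True)}. u = v"
        by (subst (asm) card_le_Suc0_iff_eq[folded One_nat_def]) auto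
      moreover have "\<psi> x = (?a, True)" "\<psi> y = (?a, True)"
        using xy by (auto simp: prod_eq_iff)
      ultimately show "x = y" using xy by blast
    qed
    ultimately show ?case by auto
  qed auto
  also have "\<dots> = (\<Sum>M'\<in>?N. \<Sum>\<psi>\<in>colorings n M'. of_nat (card (coloring_stabilizer n \<psi>)))"
  proof (rule sum.UNION_disjoint)
    show "finite ?N"
      by (rule card_ge_0_finite) (simp only: card_marked_multisets, simp)
    show "\<forall>M'\<in>?N. finite (colorings n M')" by (simp add: finite_colorings)
    show "\<forall>A\<in>?N. \<forall>B\<in>?N. A \<noteq> B \<longrightarrow> colorings n A \<inter> colorings n B = {}"
      by (auto simp: colorings_def)
  qed
  also have "\<dots> = (\<Sum>M'\<in>?N. fact n)"
  proof (rule sum.cong[OF refl])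
    fix M' assume "M' \<in> ?N"
    then have "size M' = n" using M by auto
    then show "(\<Sum>\<psi>\<in>colorings n M'. of_nat (card (coloring_stabilizer n \<psi>))) = (fact n :: complex)"
      using arg_cong[OF sum_card_coloring_stabilizer[of M' n], of "of_nat :: nat \<Rightarrow> complex"] by simp
  qed
  also have "\<dots> = fact n * 2 ^ card (set_mset M)"
    using card_marked_multisets[of M] by simp
  finally show ?thesis .
qed

text \<open>In terms of symmetric functions this is the sum of \<open>e_k h_(n - k)\<close> over
  \<open>k\<close>, where \<open>e_k h_(n - k)\<close> belongs to the \<open>k\<close>-th exterior
  power: \<open>e_k\<close> takes a set of \<open>k\<close> variables and \<open>h_(n - k)\<close>
  the rest of \<open>M\<close>.\<close>

lemma mps_coeff_frobenius_ch_exterior: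
  "mps_coeff (frobenius_ch n (exterior_char {1..n})) M = (if size M = n then 2 ^ card (set_mset M) else 0)"
  by (simp add: mps_coeff_frobenius_ch sum_exterior_char fixed_colorings_empty del: One_nat_def)

section \<open>Induction from the subgroup fixing the last point\<close>

lemma card_fixed_colorings_conj:
  assumes \<tau>: "\<tau> permutes {1..n}" and \<rho>: "\<rho> permutes {1..n}"
  shows "card (fixed_colorings n (\<tau> \<circ> \<rho> \<circ> inv \<tau>) M) = card (fixed_colorings n \<rho> M)"
proof (rule bij_betw_same_card)
  let ?V = "{1..n}"
  have col: "restrict (\<phi> \<circ> \<upsilon>) ?V \<in> colorings n M" if "\<phi> \<in> colorings n M" "\<upsilon> permutes ?V" for \<phi> \<upsilon>
  proof (rule restrict_in_colorings)
    have "image_mset \<phi> (mset_set ?V) = M" using that(1) by (simp add: colorings_def)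
    then show "image_mset (\<phi> \<circ> \<upsilon>) (mset_set ?V) = M"
      by (metis multiset.map_comp permutes_image_mset[OF that(2)])
  qed
  have \<tau>': "inv \<tau> permutes ?V" using \<tau> by (rule permutes_inv)
  have in_V: "\<upsilon> x \<in> ?V \<longleftrightarrow> x \<in> ?V" if "\<upsilon> permutes ?V" for \<upsilon> x
    using that by (rule permutes_in_image)
  have ext: "restrict (restrict (\<phi> \<circ> \<upsilon>) ?V \<circ> \<upsilon>') ?V = \<phi>"
    if "\<phi> \<in> colorings n M" "\<upsilon>' permutes ?V" "\<And>x. \<upsilon> (\<upsilon>' x) = x" for \<phi> \<upsilon> \<upsilon>'
  proof
    fix x show "restrict (restrict (\<phi> \<circ> \<upsilon>) ?V \<circ> \<upsilon>') ?V x = \<phi> x"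
      using that in_V[OF that(2), of x] by (cases "x \<in> ?V") (auto simp: colorings_def PiE_def extensional_def)
  qed
  note inv = permutes_inverses[OF \<tau>]
  show "bij_betw (\<lambda>\<phi>. restrict (\<phi> \<circ> \<tau>) ?V) (fixed_colorings n (\<tau> \<circ> \<rho> \<circ> inv \<tau>) M) (fixed_colorings n \<rho> M)"
  proof (rule bij_betw_byWitness[where f' = "\<lambda>\<phi>. restrict (\<phi> \<circ> inv \<tau>) ?V"])
    show "\<forall>\<phi>\<in>fixed_colorings n (\<tau> \<circ> \<rho> \<circ> inv \<tau>) M. restrict (restrict (\<phi> \<circ> \<tau>) ?V \<circ> inv \<tau>) ?V = \<phi>"
      using ext[OF _ \<tau>'] inv by (auto simp: fixed_colorings_def)
    show "\<forall>\<phi>\<in>fixed_colorings n \<rho> M. restrict (restrict (\<phi> \<circ> inv \<tau>) ?V \<circ> \<tau>) ?V = \<phi>"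
      using ext[OF _ \<tau>] inv by (auto simp: fixed_colorings_def)
    show "(\<lambda>\<phi>. restrict (\<phi> \<circ> \<tau>) ?V) ` fixed_colorings n (\<tau> \<circ> \<rho> \<circ> inv \<tau>) M \<subseteq> fixed_colorings n \<rho> M"
    proof safe
      fix \<phi> assume \<phi>: "\<phi> \<in> fixed_colorings n (\<tau> \<circ> \<rho> \<circ> inv \<tau>) M"
      have "restrict (\<phi> \<circ> \<tau>) ?V (\<rho> x) = restrict (\<phi> \<circ> \<tau>) ?V x" if x: "x \<in> ?V" for x
      proof -
        have "\<tau> x \<in> ?V" using in_V[OF \<tau>] x by simp
        then have "\<phi> ((\<tau> \<circ> \<rho> \<circ> inv \<tau>) (\<tau> x)) = \<phi> (\<tau> x)"
          using \<phi> unfolding fixed_colorings_def by blast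
        then show ?thesis using in_V[OF \<rho>, of x] x inv by simp
      qed
      then show "restrict (\<phi> \<circ> \<tau>) ?V \<in> fixed_colorings n \<rho> M"
        using col[OF _ \<tau>, of \<phi>] \<phi> unfolding fixed_colorings_def by blast
    qed
    show "(\<lambda>\<phi>. restrict (\<phi> \<circ> inv \<tau>) ?V) ` fixed_colorings n \<rho> M \<subseteq> fixed_colorings n (\<tau> \<circ> \<rho> \<circ> inv \<tau>) M"
    proof safe
      fix \<phi> assume \<phi>: "\<phi> \<in> fixed_colorings n \<rho> M"
      have "restrict (\<phi> \<circ> inv \<tau>) ?V ((\<tau> \<circ> \<rho> \<circ> inv \<tau>) x) = restrict (\<phi> \<circ> inv \<tau>) ?V x" if x: "x \<in> ?V" for x
      proof -
        have *: "inv \<tau> x \<in> ?V" using in_V[OF \<tau>'] x by simp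
        then have "\<phi> (\<rho> (inv \<tau> x)) = \<phi> (inv \<tau> x)"
          using \<phi> unfolding fixed_colorings_def by blast
        moreover have "\<tau> (\<rho> (inv \<tau> x)) \<in> ?V"
          using * in_V[OF \<tau>] in_V[OF \<rho>] by simp
        ultimately show ?thesis using x inv by simp
      qed
      then show "restrict (\<phi> \<circ> inv \<tau>) ?V \<in> fixed_colorings n (\<tau> \<circ> \<rho> \<circ> inv \<tau>) M"
        using col[OF _ \<tau>', of \<phi>] \<phi> unfolding fixed_colorings_def by blast
    qed
  qed
qed

text \<open>The fixed point \<open>Suc n\<close> of \<open>\<rho>\<close> may have any color
  \<open>i\<close> of \<open>M\<close>, and the other points then have content
  \<open>M - {#i#}\<close>. This is the factor \<open>power_sum 1\<close> of a 1-cycle.\<close>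

lemma card_fixed_colorings_Suc:
  assumes \<rho>: "\<rho> permutes {1..n}"
  shows "card (fixed_colorings (Suc n) \<rho> M) = (\<Sum>i\<in>set_mset M. card (fixed_colorings n \<rho> (M - {#i#})))"
proof -
  let ?S = "SIGMA i:set_mset M. fixed_colorings n \<rho> (M - {#i#})"
  have V: "{1..Suc n} = insert (Suc n) {1..n}" by auto
  have \<rho>_Suc: "\<rho> (Suc n) = Suc n" using \<rho> by (simp add: permutes_def)
  have in_V: "\<rho> x \<in> {1..n} \<longleftrightarrow> x \<in> {1..n}" for x by (rule permutes_in_image[OF \<rho>])
  have "bij_betw (\<lambda>(i, \<phi>). \<phi>(Suc n := i)) ?S (fixed_colorings (Suc n) \<rho> M)"
  proof (rule bij_betw_byWitness[where f' = "\<lambda>\<phi>. (\<phi> (Suc n), restrict \<phi> {1..n})"])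
    show "\<forall>p\<in>?S. (\<lambda>\<phi>. (\<phi> (Suc n), restrict \<phi> {1..n})) ((\<lambda>(i, \<phi>). \<phi>(Suc n := i)) p) = p"
      by (auto simp: fixed_colorings_def colorings_def PiE_def extensional_def restrict_def fun_eq_iff)
    show "\<forall>\<phi>\<in>fixed_colorings (Suc n) \<rho> M. (\<lambda>(i, \<phi>). \<phi>(Suc n := i)) (\<phi> (Suc n), restrict \<phi> {1..n}) = \<phi>"
      by (auto simp: fixed_colorings_def colorings_def PiE_def extensional_def restrict_def fun_eq_iff)
    show "(\<lambda>(i, \<phi>). \<phi>(Suc n := i)) ` ?S \<subseteq> fixed_colorings (Suc n) \<rho> M"
    proof safe
      fix i \<phi> assume i: "i \<in># M" and \<phi>: "\<phi> \<in> fixed_colorings n \<rho> (M - {#i#})"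
      have "image_mset (\<phi>(Suc n := i)) (mset_set {1..n}) = image_mset \<phi> (mset_set {1..n})"
        by (intro image_mset_cong) auto
      then have "image_mset (\<phi>(Suc n := i)) (mset_set {1..Suc n}) = M"
        using i \<phi> unfolding V by (simp add: fixed_colorings_def colorings_def)
      moreover have "\<phi>(Suc n := i) \<in> {1..Suc n} \<rightarrow>\<^sub>E UNIV"
        using \<phi> unfolding V by (auto simp: fixed_colorings_def colorings_def PiE_def extensional_def)
      moreover have "(\<phi>(Suc n := i)) (\<rho> x) = (\<phi>(Suc n := i)) x" if "x \<in> {1..Suc n}" for x
      proof (cases "x = Suc n")
        case False
        then have "x \<in> {1..n}" using that by auto
        then show ?thesis using \<phi> in_V[of x] by (auto simp: fixed_colorings_def)
      qed (simp add: \<rho>_Suc)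
      ultimately show "\<phi>(Suc n := i) \<in> fixed_colorings (Suc n) \<rho> M"
        unfolding fixed_colorings_def colorings_def by blast
    qed
    show "(\<lambda>\<phi>. (\<phi> (Suc n), restrict \<phi> {1..n})) ` fixed_colorings (Suc n) \<rho> M \<subseteq> ?S"
    proof safe
      fix \<phi> assume \<phi>: "\<phi> \<in> fixed_colorings (Suc n) \<rho> M"
      have M: "M = add_mset (\<phi> (Suc n)) (image_mset \<phi> (mset_set {1..n}))"
        using \<phi> unfolding fixed_colorings_def colorings_def V by auto
      then have "restrict \<phi> {1..n} \<in> colorings n (M - {#\<phi> (Suc n)#})"
        by (intro restrict_in_colorings) simp
      moreover have "restrict \<phi> {1..n} (\<rho> x) = restrict \<phi> {1..n} x" if "x \<in> {1..n}" for x
        using \<phi> that in_V[of x] by (auto simp: fixed_colorings_def)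
      ultimately show "restrict \<phi> {1..n} \<in> fixed_colorings n \<rho> (M - {#\<phi> (Suc n)#})"
        unfolding fixed_colorings_def by blast
      show "\<phi> (Suc n) \<in># M" using M by simp
    qed
  qed
  then have "card (fixed_colorings (Suc n) \<rho> M) = card ?S" by (rule bij_betw_same_card[symmetric])
  then show ?thesis by (simp add: finite_fixed_colorings)
qed

text \<open>In the sum over \<open>\<pi>\<close> and \<open>\<tau>\<close> substitute
  \<open>\<rho> = inv \<tau> \<circ> \<pi> \<circ> \<tau>\<close>. The number of fixed colorings is
  a class function, so \<open>\<tau>\<close> becomes free and its \<open>fact (Suc n)\<close>
  choices cancel the prefactor. What is left is a sum over the subgroup, whose elements have the
  additional 1-cycle \<open>Suc n\<close>.\<close>

lemma frobenius_ch_induce: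
  "frobenius_ch (Suc n) (induce (Suc n) \<chi>) = power_sum 1 * frobenius_ch n \<chi>"
proof (rule mps_eqI)
  fix M :: "nat multiset"
  let ?c = "\<lambda>\<pi>. of_nat (card (fixed_colorings (Suc n) \<pi> M)) :: complex"
  let ?G = "{\<pi>. \<pi> permutes {1..Suc n}}" and ?H = "{\<rho>. \<rho> permutes {1..n}}"
  let ?T = "\<lambda>\<pi>. {\<tau>. \<tau> permutes {1..Suc n} \<and> (inv \<tau> \<circ> \<pi> \<circ> \<tau>) permutes {1..n}}"
  have HG: "\<rho> \<in> ?G" if "\<rho> \<in> ?H" for \<rho> using that by (auto intro: permutes_subset)
  have finT: "finite (?T \<pi>)" for \<pi>
    by (rule finite_subset[OF _ finite_permutations[of "{1..Suc n}"]]) auto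
  have conj: "inv \<tau> \<circ> (\<tau> \<circ> \<rho> \<circ> inv \<tau>) \<circ> \<tau> = \<rho>" "\<tau> \<circ> (inv \<tau> \<circ> \<rho> \<circ> \<tau>) \<circ> inv \<tau> = \<rho>" if "\<tau> \<in> ?G" for \<tau> \<rho>
    using that permutes_inverses[of \<tau> "{1..Suc n}"] by (auto simp: fun_eq_iff)
  have "(\<Sum>\<pi>\<in>?G. induce (Suc n) \<chi> \<pi> * ?c \<pi>) = 
      1 / fact n * (\<Sum>\<pi>\<in>?G. \<Sum>\<tau>\<in>?T \<pi>. \<chi> (inv \<tau> \<circ> \<pi> \<circ> \<tau>) * ?c \<pi>)"
    by (simp add: induce_def sum_distrib_left sum_distrib_right mult.assoc)
  also have "(\<Sum>\<pi>\<in>?G. \<Sum>\<tau>\<in>?T \<pi>. \<chi> (inv \<tau> \<circ> \<pi> \<circ> \<tau>) * ?c \<pi>) =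
      (\<Sum>(\<pi>, \<tau>)\<in>Sigma ?G ?T. \<chi> (inv \<tau> \<circ> \<pi> \<circ> \<tau>) * ?c \<pi>)"
    by (rule sum.Sigma) (use finT in \<open>auto simp: finite_permutations\<close>)
  also have "\<dots> = (\<Sum>(\<tau>, \<rho>)\<in>?G \<times> ?H. \<chi> \<rho> * ?c \<rho>)"
  proof (rule sum.reindex_bij_witness[where
        i = "\<lambda>(\<tau>, \<rho>). (\<tau> \<circ> \<rho> \<circ> inv \<tau>, \<tau>)" and j = "\<lambda>(\<pi>, \<tau>). (\<tau>, inv \<tau> \<circ> \<pi> \<circ> \<tau>)"], goal_cases)
    case (1 a)
    then show ?case using conj by auto
  next
    case (2 a)
    then show ?case by auto
  next
    case (3 b)
    then show ?case using conj by auto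
  next
    case (4 b)
    then obtain \<tau> \<rho> where b: "b = (\<tau>, \<rho>)" "\<tau> \<in> ?G" "\<rho> \<in> ?H" by auto
    have "\<tau> \<circ> \<rho> \<circ> inv \<tau> \<in> ?G"
      using b HG[OF b(3)] by (auto intro: permutes_compose permutes_inv)
    then show ?case using b conj[OF b(2)] by auto
  next
    case (5 a)
    then obtain \<pi> \<tau> where a: "a = (\<pi>, \<tau>)" "\<pi> \<in> ?G" "\<tau> \<in> ?G" "inv \<tau> \<circ> \<pi> \<circ> \<tau> \<in> ?H" by auto
    have "?c (inv \<tau> \<circ> \<pi> \<circ> \<tau>) = ?c \<pi>"
      using card_fixed_colorings_conj[of \<tau> "Suc n" "inv \<tau> \<circ> \<pi> \<circ> \<tau>" M] a(3) HG[OF a(4)] conj(2)[OF a(3)] by simp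
    then show ?case by (simp add: a(1))
  qed
  also have "\<dots> = of_nat (card ?G) * (\<Sum>\<rho>\<in>?H. \<chi> \<rho> * ?c \<rho>)"
    by (simp add: sum.cartesian_product[symmetric])
  also have "card ?G = fact (Suc n)"
    by (rule card_permutations) auto
  finally have "mps_coeff (frobenius_ch (Suc n) (induce (Suc n) \<chi>)) M = 1 / fact n * (\<Sum>\<rho>\<in>?H. \<chi> \<rho> * ?c \<rho>)"
    by (simp add: mps_coeff_frobenius_ch del: fact_Suc)
  also have "(\<Sum>\<rho>\<in>?H. \<chi> \<rho> * ?c \<rho>) =
      (\<Sum>i\<in>set_mset M. \<Sum>\<rho>\<in>?H. \<chi> \<rho> * of_nat (card (fixed_colorings n \<rho> (M - {#i#}))))"
    by (subst sum.swap) (simp add: card_fixed_colorings_Suc sum_distrib_left)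
  also have "1 / fact n * \<dots> = (\<Sum>i\<in>set_mset M. mps_coeff (frobenius_ch n \<chi>) (M - {#i#}))"
    by (simp add: mps_coeff_frobenius_ch sum_distrib_left)
  also have "\<dots> = mps_coeff (power_sum 1 * frobenius_ch n \<chi>) M"
    by (simp add: mps_coeff_power_sum_times)
  finally show "mps_coeff (frobenius_ch (Suc n) (induce (Suc n) \<chi>)) M = mps_coeff (power_sum 1 * frobenius_ch n \<chi>) M" .
qed

section \<open>Characters of hook shape\<close>

text \<open>These index the terms of the sum of all hook characters, see
  \<open>irr_char_hook\<close>: \<open>A\<close> is the part of a first column below the corner
  \<open>n\<close>. In contrast to \<open>invariant_pairs\<close>, \<open>\<sigma>\<close> need not
  agree with \<open>\<rho>\<close> at \<open>n\<close>.\<close>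

definition extension_pairs :: "nat \<Rightarrow> (nat \<Rightarrow> nat) \<Rightarrow> (nat set \<times> (nat \<Rightarrow> nat)) set" where
  "extension_pairs n \<rho> = {(A, \<sigma>). A \<subseteq> {1..<n} \<and> \<sigma> permutes insert n A \<and> (\<forall>a\<in>A. \<sigma> a = \<rho> a)}"

lemma finite_extension_pairs: "finite (extension_pairs n \<rho>)"
  by (rule finite_subset[of _ "Pow {1..<n} \<times> {\<sigma>. \<sigma> permutes insert n {1..<n}}"])
    (auto simp: extension_pairs_def finite_permutations intro: permutes_subset)

lemma permutes_insert_fixed: "\<sigma> permutes insert a S \<Longrightarrow> \<sigma> a = a \<Longrightarrow> \<sigma> permutes S"
  by (rule permutes_superset) auto

text \<open>With \<open>c = \<rho>\<inverse>(\<sigma>(n))\<close>, the map \<open>(B, \<sigma>) \<mapsto> (B \<union> {c}, \<sigma> \<circ> (n c))\<close> is a sign-reversing bijection from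
  the pairs with \<open>\<sigma>(n) \<noteq> \<rho>(n)\<close> to those with \<open>\<sigma>(n) \<noteq> n\<close>.\<close>

lemma sum_extension_pairs_cancel:
  assumes n: "0 < n" and \<rho>: "\<rho> permutes {1..n}"
  shows "(\<Sum>(A, \<sigma>)\<in>{(A, \<sigma>) \<in> extension_pairs n \<rho>. \<sigma> n \<noteq> \<rho> n}. of_int (sign \<sigma>)) =
    - (\<Sum>(A, \<sigma>)\<in>{(A, \<sigma>) \<in> extension_pairs n \<rho>. \<sigma> n \<noteq> n}. of_int (sign \<sigma>) :: complex)"
  unfolding sum_negf[symmetric]
proof (rule sum.reindex_bij_witness[where
      j = "\<lambda>(B, \<sigma>). (insert (inv \<rho> (\<sigma> n)) B, \<sigma> \<circ> transpose n (inv \<rho> (\<sigma> n)))" and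
      i = "\<lambda>(A, \<sigma>). (A - {\<sigma> n}, \<sigma> \<circ> transpose n (\<sigma> n))"], goal_cases)
  have fwd: "c \<notin> B \<and> c \<noteq> n \<and> c \<in> {1..<n} \<and> \<rho> c = \<sigma> n \<and> \<sigma> c = c \<and>
      \<sigma> \<circ> transpose n c permutes insert n (insert c B)"
    if "(B, \<sigma>) \<in> extension_pairs n \<rho>" "\<sigma> n \<noteq> \<rho> n" and c: "c = inv \<rho> (\<sigma> n)" for B \<sigma> c
  proof -
    have *: "B \<subseteq> {1..<n}" "\<sigma> permutes insert n B" "\<forall>a\<in>B. \<sigma> a = \<rho> a"
      using that by (auto simp: extension_pairs_def)
    have \<rho>c: "\<rho> c = \<sigma> n" using permutes_inverses[OF \<rho>] c by simp
    have cn: "c \<noteq> n" using \<rho>c that(2) by auto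
    have cB: "c \<notin> B"
    proof
      assume "c \<in> B"
      then have "\<sigma> c = \<sigma> n" using * \<rho>c by simp
      then show False using permutes_inj[OF *(2)] cn by (metis injD)
    qed
    have "\<sigma> n \<in> insert n B" using permutes_in_image[OF *(2), of n] by simp
    then have "\<sigma> n \<in> {1..n}" using * n by auto
    then have "c \<in> {1..n}" using permutes_in_image[OF permutes_inv[OF \<rho>]] c by blast
    moreover have "\<sigma> c = c" using *(2) cn cB by (simp add: permutes_def)
    moreover have "\<sigma> \<circ> transpose n c permutes insert n (insert c B)"
    proof (rule permutes_compose)
      show "transpose n c permutes insert n (insert c B)" by (rule permutes_swap_id) auto
      show "\<sigma> permutes insert n (insert c B)" using *(2) by (rule permutes_subset) auto
    qed
    ultimately show ?thesis using cn cB \<rho>c by auto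
  qed
  \<comment> \<open>The point \<open>c\<close> is recovered as the image of \<open>n\<close>:
    \<open>\<sigma>\<close> fixes \<open>c\<close>, hence
    \<open>\<sigma> \<circ> transpose n c\<close> sends \<open>n\<close> to
    \<open>c\<close>.\<close>
  have bwd: "\<sigma> n \<in> A \<and> \<sigma> \<circ> transpose n (\<sigma> n) permutes insert n (A - {\<sigma> n})"
    if "(A, \<sigma>) \<in> extension_pairs n \<rho>" "\<sigma> n \<noteq> n" for A \<sigma>
  proof -
    have *: "A \<subseteq> {1..<n}" "\<sigma> permutes insert n A" using that by (auto simp: extension_pairs_def)
    have e: "\<sigma> n \<in> A" using permutes_in_image[OF *(2), of n] that by simp
    have "\<sigma> \<circ> transpose n (\<sigma> n) permutes insert n A"
      using *(2) e by (intro permutes_compose permutes_swap_id) auto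
    also have "insert n A = insert (\<sigma> n) (insert n (A - {\<sigma> n}))" using e by auto
    finally have "\<sigma> \<circ> transpose n (\<sigma> n) permutes insert n (A - {\<sigma> n})"
      by (rule permutes_insert_fixed) simp
    then show ?thesis using e by simp
  qed
  {
    case (1 a)
    then obtain B \<sigma> where a: "a = (B, \<sigma>)" "(B, \<sigma>) \<in> extension_pairs n \<rho>" "\<sigma> n \<noteq> \<rho> n" by auto
    show ?case using fwd[OF a(2,3) refl] by (simp add: a(1) comp_assoc)
  next
    case (2 a)
    then obtain B \<sigma> where a: "a = (B, \<sigma>)" "(B, \<sigma>) \<in> extension_pairs n \<rho>" "\<sigma> n \<noteq> \<rho> n" by auto
    define c where "c = inv \<rho> (\<sigma> n)"
    have B: "B \<subseteq> {1..<n}" "\<forall>b\<in>B. \<sigma> b = \<rho> b" using a(2) by (auto simp: extension_pairs_def)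
    note f = fwd[OF a(2,3) c_def]
    have "\<sigma> (transpose n c b) = \<rho> b" if "b \<in> insert c B" for b
    proof (cases "b = c")
      case False
      then have "b \<noteq> n" "b \<in> B" using that B by auto
      then show ?thesis using False B by (simp add: transpose_def)
    qed (use f in simp)
    then show ?case using f B unfolding a(1) c_def[symmetric] prod.case
      by (auto simp: extension_pairs_def c_def[symmetric])
  next
    case (3 b)
    then obtain A \<sigma> where b: "b = (A, \<sigma>)" "(A, \<sigma>) \<in> extension_pairs n \<rho>" "\<sigma> n \<noteq> n" by auto
    note g = bwd[OF b(2,3)]
    have "\<sigma> (\<sigma> n) = \<rho> (\<sigma> n)" using g b(2) by (auto simp: extension_pairs_def)
    then show ?case using g permutes_inverses[OF \<rho>] by (auto simp: b(1) comp_assoc)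
  next
    case (4 b)
    then obtain A \<sigma> where b: "b = (A, \<sigma>)" "(A, \<sigma>) \<in> extension_pairs n \<rho>" "\<sigma> n \<noteq> n" by auto
    have A: "A \<subseteq> {1..<n}" "\<forall>b\<in>A. \<sigma> b = \<rho> b" using b(2) by (auto simp: extension_pairs_def)
    note g = bwd[OF b(2,3)]
    have "\<sigma> (\<sigma> n) = \<rho> (\<sigma> n)" using g A by auto
    moreover have "\<rho> (\<sigma> n) \<noteq> \<rho> n" using b(3) permutes_inj[OF \<rho>] by (metis injD)
    moreover have "\<sigma> (transpose n (\<sigma> n) x) = \<rho> x" if "x \<in> A - {\<sigma> n}" for x
    proof -
      have "x \<noteq> n" using that A by auto
      then show ?thesis using that A by (simp add: transpose_def)
    qed
    ultimately show ?case using g A by (auto simp: b(1) extension_pairs_def)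
  next
    case (5 a)
    then obtain B \<sigma> where a: "a = (B, \<sigma>)" "(B, \<sigma>) \<in> extension_pairs n \<rho>" "\<sigma> n \<noteq> \<rho> n" by auto
    have "\<sigma> permutes insert n B" "finite B"
      using a(2) finite_subset[of B "{1..<n}"] by (auto simp: extension_pairs_def)
    then have "permutation \<sigma>" using permutes_imp_permutation[of "insert n B" \<sigma>] by simp
    then show ?case using fwd[OF a(2,3) refl]
      by (auto simp: a(1) sign_compose permutation_swap_id sign_swap_id)
  }
qed

text \<open>Pairs with \<open>\<sigma> n = n\<close> correspond to the invariant sets without
  \<open>n\<close>, pairs with \<open>\<sigma> n = \<rho> n\<close> to those with \<open>n\<close>.
  Each class is the full set of pairs minus a complement, and the sums over the two complements
  cancel; this leaves twice the full sum.\<close>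

lemma exterior_char_eq_extension_pairs:
  assumes n: "0 < n" and \<rho>: "\<rho> permutes {1..n}"
  shows "exterior_char {1..n} \<rho> = 2 * (\<Sum>(A, \<sigma>)\<in>extension_pairs n \<rho>. of_int (sign \<sigma>))"
proof -
  let ?E = "extension_pairs n \<rho>" and ?Q = "invariant_pairs {1..n} \<rho>"
  let ?s = "\<lambda>(A :: nat set, \<sigma> :: nat \<Rightarrow> nat). of_int (sign \<sigma>) :: complex"
  have split: "sum ?s X = sum ?s {(A, \<sigma>) \<in> X. P A \<sigma>} + sum ?s {(A, \<sigma>) \<in> X. \<not> P A \<sigma>}" if "finite X" for X P
  proof -
    have "X \<inter> {(A, \<sigma>). P A \<sigma>} = {(A, \<sigma>) \<in> X. P A \<sigma>}" "X - {(A, \<sigma>). P A \<sigma>} = {(A, \<sigma>) \<in> X. \<not> P A \<sigma>}"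
      by auto
    then show ?thesis using sum.Int_Diff[OF that, of ?s "{(A, \<sigma>). P A \<sigma>}"] by simp
  qed
  have less: "x < n" if "S \<subseteq> {1..n}" "x \<in> S" "x \<noteq> n" for S x
    using that by (metis atLeastAtMost_iff le_neq_implies_less subsetD)
  have "{(A, \<sigma>) \<in> ?E. \<sigma> n = n} = {(S, \<sigma>) \<in> ?Q. n \<notin> S}"
  proof (intro equalityI subsetI)
    fix p assume "p \<in> {(A, \<sigma>) \<in> ?E. \<sigma> n = n}"
    then show "p \<in> {(S, \<sigma>) \<in> ?Q. n \<notin> S}"
      by (auto simp: extension_pairs_def invariant_pairs_def intro: permutes_insert_fixed)
  next
    fix p assume "p \<in> {(S, \<sigma>) \<in> ?Q. n \<notin> S}"
    then obtain S \<sigma> where p: "p = (S, \<sigma>)" "S \<subseteq> {1..n}" "\<sigma> permutes S" "\<forall>s\<in>S. \<sigma> s = \<rho> s" "n \<notin> S"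
      by (auto simp: invariant_pairs_def)
    have "S \<subseteq> {1..<n}" using less[OF p(2)] p(2,5) by force
    moreover have "\<sigma> permutes insert n S" using p(3) by (rule permutes_subset) auto
    ultimately show "p \<in> {(A, \<sigma>) \<in> ?E. \<sigma> n = n}"
      using p by (simp add: extension_pairs_def permutes_not_in)
  qed
  moreover have "sum ?s {(A, \<sigma>) \<in> ?E. \<sigma> n = \<rho> n} = sum ?s {(S, \<sigma>) \<in> ?Q. n \<in> S}"
  proof (rule sum.reindex_bij_witness[where j = "\<lambda>(A, \<sigma>). (insert n A, \<sigma>)" and i = "\<lambda>(S, \<sigma>). (S - {n}, \<sigma>)"])
    fix p assume "p \<in> {(S, \<sigma>) \<in> ?Q. n \<in> S}"
    then obtain S \<sigma> where p: "p = (S, \<sigma>)" "S \<subseteq> {1..n}" "\<sigma> permutes S" "\<forall>s\<in>S. \<sigma> s = \<rho> s" "n \<in> S"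
      by (auto simp: invariant_pairs_def)
    have "S - {n} \<subseteq> {1..<n}" using less[OF p(2)] p(2) by force
    then show "(\<lambda>(S, \<sigma>). (S - {n}, \<sigma>)) p \<in> {(A, \<sigma>) \<in> ?E. \<sigma> n = \<rho> n}"
      using p by (simp add: extension_pairs_def insert_absorb)
  qed (use n in \<open>auto simp: extension_pairs_def invariant_pairs_def\<close>)
  ultimately have "exterior_char {1..n} \<rho> =
      sum ?s {(A, \<sigma>) \<in> ?E. \<sigma> n = \<rho> n} + sum ?s {(A, \<sigma>) \<in> ?E. \<sigma> n = n}"
    unfolding exterior_char_def using split[of ?Q "\<lambda>S \<sigma>. n \<in> S"] by (simp add: finite_invariant_pairs)
  then show ?thesis
    using split[OF finite_extension_pairs, of n \<rho> "\<lambda>A \<sigma>. \<sigma> n = n"]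
      split[OF finite_extension_pairs, of n \<rho> "\<lambda>A \<sigma>. \<sigma> n = \<rho> n"]
      sum_extension_pairs_cancel[OF n \<rho>] by simp
qed

text \<open>Needed because \<open>tabloid_action\<close> moves tabloids by the inverse, so that the
  trace formula is in terms of \<open>inv \<pi>\<close>. Inverting \<open>\<sigma>\<close> keeps the
  invariant sets and the signs.\<close>

lemma exterior_char_inv:
  assumes V: "finite V" and \<pi>: "\<pi> permutes V"
  shows "exterior_char V (inv \<pi>) = exterior_char V \<pi>"
proof -
  have inv: "(S, inv \<sigma>) \<in> invariant_pairs V (inv \<pi>)"
    if "(S, \<sigma>) \<in> invariant_pairs V \<pi>" "\<pi> permutes V" for S \<sigma> \<pi>
  proof -
    have *: "S \<subseteq> V" "\<sigma> permutes S" "\<forall>s\<in>S. \<sigma> s = \<pi> s"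
      using that by (auto simp: invariant_pairs_def)
    have "inv \<sigma> s = inv \<pi> s" if "s \<in> S" for s
    proof -
      have "inv \<sigma> s \<in> S" using permutes_in_image[OF permutes_inv[OF *(2)]] that by simp
      then have "\<pi> (inv \<sigma> s) = s" using * permutes_inverses[OF *(2)] by metis
      then show ?thesis by (metis permutes_inverses(2)[OF \<open>\<pi> permutes V\<close>])
    qed
    then show ?thesis using * by (auto simp: invariant_pairs_def intro: permutes_inv)
  qed
  show ?thesis
    unfolding exterior_char_def
  proof (rule sum.reindex_bij_witness[where i = "\<lambda>(S, \<sigma>). (S, inv \<sigma>)" and j = "\<lambda>(S, \<sigma>). (S, inv \<sigma>)"], goal_cases)
    case (1 a) then show ?case by (auto simp: invariant_pairs_def permutes_inv_inv)
  next
    case (2 a) then show ?case using inv[of _ _ "inv \<pi>"] permutes_inv[OF \<pi>] permutes_inv_inv[OF \<pi>] by (cases a) auto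
  next
    case (3 a) then show ?case by (auto simp: invariant_pairs_def permutes_inv_inv)
  next
    case (4 a) then show ?case using inv \<pi> by (cases a) auto
  next
    case (5 a)
    then have "snd a permutes fst a" "finite (fst a)"
      using V finite_subset[of "fst a" V] by (auto simp: invariant_pairs_def)
    then have "permutation (snd a)" using permutes_imp_permutation by blast
    then show ?case by (cases a) (simp add: sign_inverse)
  qed
qed

section \<open>Traces and polytabloids of hook shape\<close>

lemma sum_fun_apply: "(\<Sum>a\<in>A. f a) x = (\<Sum>a\<in>A. (f a x :: complex))"
  by (induction A rule: infinite_finite_induct) auto

text \<open>Evaluations at the points \<open>p i\<close> are coordinate functionals for the
  \<open>e i\<close>. This gives their independence, and the diagonal entries of \<open>f\<close>
  are values at these points.\<close>

lemma trace_on_dual_basis: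
  fixes e :: "'i \<Rightarrow> 'a \<Rightarrow> complex"
  assumes I: "finite I" and dual: "\<And>i j. i \<in> I \<Longrightarrow> j \<in> I \<Longrightarrow> e i (p j) = (if i = j then 1 else 0)"
    and lin: "Vector_Spaces.linear fun_scale fun_scale f"
    and inv: "f ` cfun_span (e ` I) \<subseteq> cfun_span (e ` I)"
  shows "trace_on (cfun_span (e ` I)) f = (\<Sum>i\<in>I. f (e i) (p i))"
proof -
  have inj: "inj_on e I"
    by (rule inj_onI) (metis dual zero_neq_one)
  have eval: "(\<Sum>b\<in>e ` I. fun_scale (u b) b) (p i) = u (e i)" if "i \<in> I" for u i
  proof -
    have "(\<Sum>b\<in>e ` I. fun_scale (u b) b) (p i) = (\<Sum>j\<in>I. u (e j) * e j (p i))"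
      by (simp add: sum_fun_apply sum.reindex[OF inj])
    also have "\<dots> = (\<Sum>j\<in>I. if j = i then u (e i) else 0)"
      using that by (intro sum.cong) (auto simp: dual)
    finally show ?thesis using I that by simp
  qed
  have indep: "\<not> cfun_dependent (e ` I)"
    unfolding cfun.dependent_finite[OF finite_imageI[OF I]]
  proof safe
    fix u i assume i: "i \<in> I" "u (e i) \<noteq> 0" and "(\<Sum>b\<in>e ` I. fun_scale (u b) b) = 0"
    then show False using eval[of i u] by simp
  qed
  have "trace_on (cfun_span (e ` I)) f = (\<Sum>b\<in>e ` I. cfun_representation (e ` I) (f b) b)"
    using I indep by (intro trace_on_eq[OF lin inv]) auto
  also have "\<dots> = (\<Sum>i\<in>I. cfun_representation (e ` I) (f (e i)) (e i))"
    by (simp add: sum.reindex[OF inj])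
  also have "\<dots> = (\<Sum>i\<in>I. f (e i) (p i))"
  proof (rule sum.cong[OF refl])
    fix i assume i: "i \<in> I"
    then have "f (e i) \<in> cfun_span (e ` I)"
      using inv cfun.span_superset[of "e ` I"] by auto
    then have "(\<Sum>b\<in>e ` I. fun_scale (cfun_representation (e ` I) (f (e i)) b) b) = f (e i)"
      using indep I by (intro cfun.sum_representation_eq) auto
    then show "cfun_representation (e ` I) (f (e i)) (e i) = f (e i) (p i)"
      using eval[OF i, of "cfun_representation (e ` I) (f (e i))"] by simp
  qed
  finally show ?thesis .
qed

lemma linear_tabloid_action: "Vector_Spaces.linear fun_scale fun_scale (tabloid_action \<pi>)"
  unfolding Vector_Spaces.linear_iff
  by (auto simp: tabloid_action_def fun_eq_iff cfun.vector_space_axioms)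

text \<open>Below the first row every row of a hook has one cell, so a tabloid is determined by the
  list \<open>xs\<close> of the entries there, from top to bottom.\<close>

definition hook_tabloid :: "nat \<Rightarrow> nat list \<Rightarrow> nat set list" where
  "hook_tabloid n xs = ({1..n} - set xs) # map (\<lambda>x. {x}) xs"

text \<open>The polytabloid of a tableau of hook shape depends only on the list \<open>c\<close> of the entries of
  its first column.\<close>

definition hook_polytabloid :: "nat \<Rightarrow> nat list \<Rightarrow> nat set list \<Rightarrow> complex" where
  "hook_polytabloid n c = (\<lambda>X. \<Sum>\<sigma> | \<sigma> permutes set c.
     of_int (sign \<sigma>) * (if X = hook_tabloid n (map \<sigma> (tl c)) then 1 else 0))"

definition columns :: "nat \<Rightarrow> nat \<Rightarrow> nat list set" where
  "columns n m = {c. distinct c \<and> length c = Suc m \<and> set c \<subseteq> {1..n}}"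

lemma hook_tabloid_inject: "hook_tabloid n xs = hook_tabloid n ys \<longleftrightarrow> xs = ys"
proof -
  have "inj (\<lambda>x :: nat. {x})" by (simp add: inj_def)
  then show ?thesis by (auto simp: hook_tabloid_def inj_map_eq_map)
qed

lemma map_image_hook_tabloid:
  assumes "\<pi> permutes {1..n}"
  shows "map ((`) \<pi>) (hook_tabloid n xs) = hook_tabloid n (map \<pi> xs)"
  using permutes_image[OF assms] permutes_inj[OF assms]
  by (simp add: hook_tabloid_def image_set_diff comp_def)

lemma permutes_conj:
  assumes "bij \<beta>" "q permutes C"
  shows "\<beta> \<circ> q \<circ> inv \<beta> permutes \<beta> ` C"
proof (rule bij_imp_permutes)
  have "inv \<beta> ` \<beta> ` C = C" using assms(1) by (simp add: bij_is_inj)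
  then have "bij_betw (inv \<beta>) (\<beta> ` C) C"
    using bij_betw_imageI[of "inv \<beta>" "\<beta> ` C" C] assms(1) bij_imp_bij_inv[OF assms(1)]
    by (meson bij_is_inj inj_on_subset subset_UNIV)
  moreover have "bij_betw q C C" using assms(2) by (rule permutes_imp_bij)
  moreover have "bij_betw \<beta> C (\<beta> ` C)"
    using assms(1) by (meson bij_betw_subset subset_UNIV)
  ultimately show "bij_betw (\<beta> \<circ> q \<circ> inv \<beta>) (\<beta> ` C) (\<beta> ` C)"
    by (metis bij_betw_trans comp_assoc)
  fix x assume "x \<notin> \<beta> ` C"
  then have "inv \<beta> x \<notin> C" using assms(1) by (metis bij_inv_eq_iff imageI)
  then have "q (inv \<beta> x) = inv \<beta> x" using assms(2) by (simp add: permutes_not_in)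
  then show "(\<beta> \<circ> q \<circ> inv \<beta>) x = x"
    using assms(1) by (simp add: bij_is_surj surj_f_inv_f)
qed

text \<open>Substitute \<open>\<sigma> = \<beta> \<circ> q \<circ> inv \<beta>\<close>, which keeps
  the sign. The sum then runs over permutations of the old column \<open>c\<close>, also when
  \<open>\<beta>\<close> does not preserve it, so polytabloids of different columns can be compared
  term by term.\<close>

lemma hook_polytabloid_map:
  assumes \<beta>: "permutation \<beta>"
  shows "hook_polytabloid n (map \<beta> c) X = (\<Sum>q | q permutes set c.
    of_int (sign q) * (if X = hook_tabloid n (map (\<beta> \<circ> q) (tl c)) then 1 else 0))"
proof -
  have bij: "bij \<beta>" using \<beta> by (rule permutation_bijective)
  note inv = bij_is_inj[OF bij, THEN inv_f_f] bij_is_surj[OF bij, THEN surj_f_inv_f]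
  have inv_image: "inv \<beta> ` \<beta> ` set c = set c" by (simp add: image_image inv)
  show ?thesis
    unfolding hook_polytabloid_def set_map
  proof (rule sum.reindex_bij_witness[where i = "\<lambda>q. \<beta> \<circ> q \<circ> inv \<beta>" and j = "\<lambda>\<sigma>. inv \<beta> \<circ> \<sigma> \<circ> \<beta>"], goal_cases)
    case (1 a) then show ?case by (simp add: fun_eq_iff inv)
  next
    case (2 a)
    then have "inv \<beta> \<circ> a \<circ> inv (inv \<beta>) permutes inv \<beta> ` \<beta> ` set c"
      using bij by (intro permutes_conj) (auto simp: bij_imp_bij_inv)
    then show ?case using bij by (simp add: inv_image inv_inv_eq)
  next
    case (3 b) then show ?case by (simp add: fun_eq_iff inv)
  next
    case (4 b) then show ?case using permutes_conj[OF bij, of b] by simp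
  next
    case (5 a)
    then have "permutation a" using permutes_imp_permutation[of "\<beta> ` set c" a] by simp
    then have "sign (inv \<beta> \<circ> a \<circ> \<beta>) = sign a"
      using \<beta> by (simp add: sign_compose permutation_inverse permutation_compose sign_inverse)
    moreover have "map (\<beta> \<circ> (inv \<beta> \<circ> a \<circ> \<beta>)) (tl c) = map a (tl (map \<beta> c))"
      by (simp add: map_tl[symmetric] inv comp_def)
    ultimately show ?case by simp
  qed
qed

lemma tabloid_action_hook_polytabloid:
  assumes \<pi>: "\<pi> permutes {1..n}"
  shows "tabloid_action \<pi> (hook_polytabloid n c) = hook_polytabloid n (map \<pi> c)"
proof
  fix X
  have perm: "permutation \<pi>" using \<pi> by (rule permutes_imp_permutation[rotated]) simp
  have "map ((`) (inv \<pi>)) X = hook_tabloid n ys \<longleftrightarrow> X = hook_tabloid n (map \<pi> ys)" for ys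
  proof -
    have "X = map ((`) \<pi>) (map ((`) (inv \<pi>)) X)" 
      by (simp add: comp_def image_image permutes_inverses[OF \<pi>])
    moreover have "map ((`) (inv \<pi>)) (map ((`) \<pi>) (hook_tabloid n ys)) = hook_tabloid n ys"
      by (simp add: comp_def image_image permutes_inverses[OF \<pi>])
    ultimately show ?thesis by (metis map_image_hook_tabloid[OF \<pi>])
  qed
  then show "tabloid_action \<pi> (hook_polytabloid n c) X = hook_polytabloid n (map \<pi> c) X"
    unfolding hook_polytabloid_map[OF perm] by (simp add: tabloid_action_def hook_polytabloid_def)
qed

lemma hook_polytabloid_permuted:
  assumes \<gamma>: "\<gamma> permutes set c"
  shows "hook_polytabloid n (map \<gamma> c) = (\<lambda>X. of_int (sign \<gamma>) * hook_polytabloid n c X)"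
proof
  fix X
  have perm: "permutation p" if "p permutes set c" for p
    using that by (rule permutes_imp_permutation[rotated]) simp
  have "of_int (sign \<gamma>) * hook_polytabloid n c X = of_int (sign \<gamma>) *
      (\<Sum>q | q permutes set c. of_int (sign (\<gamma> \<circ> q)) * (if X = hook_tabloid n (map (\<gamma> \<circ> q) (tl c)) then 1 else 0))"
    unfolding hook_polytabloid_def
  proof (intro arg_cong2[where f = "(*)"] refl)
    show "(\<Sum>\<sigma> | \<sigma> permutes set c. of_int (sign \<sigma>) * (if X = hook_tabloid n (map \<sigma> (tl c)) then 1 else 0)) =
        (\<Sum>q | q permutes set c. of_int (sign (\<gamma> \<circ> q)) * (if X = hook_tabloid n (map (\<gamma> \<circ> q) (tl c)) then 1 else 0) :: complex)"
      by (rule sum.reindex_bij_witness[where i = "\<lambda>q. \<gamma> \<circ> q" and j = "\<lambda>\<sigma>. inv \<gamma> \<circ> \<sigma>"])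
        (use permutes_inv[OF \<gamma>] \<gamma> in \<open>auto simp: comp_assoc[symmetric] permutes_inv_o[OF \<gamma>] intro: permutes_compose\<close>)
  qed
  also have "\<dots> = (\<Sum>q | q permutes set c.
      of_int (sign \<gamma> * sign \<gamma>) * (of_int (sign q) * (if X = hook_tabloid n (map (\<gamma> \<circ> q) (tl c)) then 1 else 0)))"
    unfolding sum_distrib_left
    by (intro sum.cong refl) (simp add: sign_compose perm \<gamma> del: sign_idempotent)
  also have "\<dots> = hook_polytabloid n (map \<gamma> c) X"
    unfolding hook_polytabloid_map[OF perm[OF \<gamma>]] by simp
  finally show "hook_polytabloid n (map \<gamma> c) X = of_int (sign \<gamma>) * hook_polytabloid n c X" ..
qed

text \<open>The Garnir relation: both \<open>a\<close> and the corner \<open>hd c\<close> lie in the first row, so antisymmetrizing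
  over \<open>insert a (set c)\<close> annihilates the tabloid.\<close>

lemma hook_polytabloid_garnir:
  assumes c: "distinct c" "c \<noteq> []" and a: "a \<notin> set c"
  shows "hook_polytabloid n c = (\<Sum>b\<in>set c. hook_polytabloid n (map (transpose a b) c))"
proof
  fix X
  let ?f = "\<lambda>\<sigma>. of_int (sign \<sigma>) * (if X = hook_tabloid n (map \<sigma> (tl c)) then 1 else 0) :: complex"
  let ?S = "insert a (set c)" and ?t = "transpose a (hd c)"
  have perm: "permutation p" if "p permutes set c" for p
    using that by (rule permutes_imp_permutation[rotated]) simp
  have permS: "permutation p" if "p permutes ?S" for p
    using that by (rule permutes_imp_permutation[rotated]) simp
  have hd: "hd c \<in> set c" "hd c \<notin> set (tl c)" using c by (cases c; simp)+
  have tl: "set (tl c) \<subseteq> set c" using c by (cases c) auto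
  have tlt: "map (\<sigma> \<circ> ?t) (tl c) = map \<sigma> (tl c)" for \<sigma> :: "nat \<Rightarrow> nat"
  proof (rule map_cong[OF refl])
    fix x assume "x \<in> set (tl c)"
    then have "x \<noteq> a" "x \<noteq> hd c" using a hd tl by auto
    then show "(\<sigma> \<circ> ?t) x = \<sigma> x" by simp
  qed
  have "a \<noteq> hd c" using a hd by auto
  then have flip: "?f (\<sigma> \<circ> ?t) = - ?f \<sigma>" if "\<sigma> permutes ?S" for \<sigma>
    unfolding tlt using permS[OF that] by (simp add: sign_compose permutation_swap_id sign_swap_id)
  have "sum ?f {\<sigma>. \<sigma> permutes ?S} = (\<Sum>\<sigma> | \<sigma> permutes ?S. ?f (\<sigma> \<circ> ?t))"
    using hd by (intro sum_permutations_compose_right permutes_swap_id) auto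
  also have "\<dots> = - sum ?f {\<sigma>. \<sigma> permutes ?S}"
    using flip by (simp add: sum_negf)
  finally have "0 = sum ?f {\<sigma>. \<sigma> permutes ?S}" by simp
  \<comment> \<open>The antisymmetrizer splits over the cosets of the column group. The coset
    \<open>b = a\<close> contributes the polytabloid of \<open>c\<close>, any other \<open>b\<close>
    minus that of the column with \<open>b\<close> replaced by \<open>a\<close>.\<close>
  also have "\<dots> = (\<Sum>b\<in>?S. \<Sum>q | q permutes set c. ?f (transpose a b \<circ> q))"
    using a by (intro sum_over_permutations_insert) auto
  also have "\<dots> = (\<Sum>q | q permutes set c. ?f q) + (\<Sum>b\<in>set c. \<Sum>q | q permutes set c. ?f (transpose a b \<circ> q))"
    using a by simp
  also have "(\<Sum>b\<in>set c. \<Sum>q | q permutes set c. ?f (transpose a b \<circ> q)) =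
      (\<Sum>b\<in>set c. - hook_polytabloid n (map (transpose a b) c) X)"
  proof (rule sum.cong[OF refl])
    fix b assume "b \<in> set c"
    then have "sign (transpose a b \<circ> q) = - sign q" if "q permutes set c" for q
      using a perm[OF that] by (auto simp: sign_compose permutation_swap_id sign_swap_id)
    then show "(\<Sum>q | q permutes set c. ?f (transpose a b \<circ> q)) = - hook_polytabloid n (map (transpose a b) c) X"
      unfolding hook_polytabloid_map[OF permutation_swap_id] sum_negf[symmetric]
      by (intro sum.cong) auto
  qed
  finally show "hook_polytabloid n c X = (\<Sum>b\<in>set c. hook_polytabloid n (map (transpose a b) c)) X"
    by (simp add: sum_fun_apply hook_polytabloid_def[of n c] sum_negf)
qed

lemma hook_polytabloid_eval:
  "hook_polytabloid n c (hook_tabloid n xs) = (\<Sum>\<sigma> | \<sigma> permutes set c \<and> map \<sigma> (tl c) = xs. of_int (sign \<sigma>))"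
proof -
  have "hook_polytabloid n c (hook_tabloid n xs) =
      (\<Sum>\<sigma> | \<sigma> permutes set c. if map \<sigma> (tl c) = xs then of_int (sign \<sigma>) else 0)"
    unfolding hook_polytabloid_def hook_tabloid_inject by (intro sum.cong) auto
  also have "\<dots> = (\<Sum>\<sigma> | \<sigma> permutes set c \<and> map \<sigma> (tl c) = xs. of_int (sign \<sigma>))"
    by (simp add: sum.If_cases finite_permutations Int_def)
  finally show ?thesis .
qed

lemma permutation_between_lists:
  assumes "distinct xs" "distinct ys" "set xs = set ys"
  obtains \<gamma> where "\<gamma> permutes set xs" "map \<gamma> xs = ys"
proof
  have len: "length xs = length ys" using assms by (metis distinct_card)
  let ?z = "zip xs ys"
  show "permutation_of_list ?z permutes set xs"
    by (rule permutation_of_list_permutes) (use assms len in \<open>simp del: set_map set_zip\<close>)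
  show "map (permutation_of_list ?z) xs = ys"
  proof (rule nth_equalityI)
    fix i assume i: "i < length (map (permutation_of_list ?z) xs)"
    then have "(xs ! i, ys ! i) \<in> set ?z" using len by (auto simp: set_zip)
    then show "map (permutation_of_list ?z) xs ! i = ys ! i"
      using i assms(1) len permutation_of_list_unique'[of ?z] by simp
  qed (simp add: len)
qed

text \<open>The polytabloids of standard tableaux for the order in which \<open>n\<close> precedes
  all other entries: \<open>n\<close> is in the corner and the sorted set \<open>A\<close> below
  it.\<close>

definition hook_basis :: "nat \<Rightarrow> nat set \<Rightarrow> nat set list \<Rightarrow> complex" where
  "hook_basis n A = hook_polytabloid n (n # sorted_list_of_set A)"

text \<open>A contributing \<open>\<sigma>\<close> maps \<open>A\<close> onto \<open>B\<close>
  inside \<open>insert n A\<close>. As \<open>n\<close> is not in \<open>B\<close> and the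
  cardinalities agree, \<open>B = A\<close>; the lists being sorted, \<open>\<sigma>\<close> fixes
  \<open>A\<close> pointwise and is \<open>id\<close>.\<close>

lemma hook_basis_dual:
  assumes A: "A \<subseteq> {1..<n}" "card A = m" and B: "B \<subseteq> {1..<n}" "card B = m"
  shows "hook_basis n A (hook_tabloid n (sorted_list_of_set B)) = (if A = B then 1 else 0)"
proof -
  have fin: "finite A" "finite B" using A B finite_subset by auto
  have nA: "n \<notin> A" "n \<notin> B" using A B by auto
  let ?P = "{\<sigma>. \<sigma> permutes insert n A \<and> map \<sigma> (sorted_list_of_set A) = sorted_list_of_set B}"
  have "?P = (if A = B then {id} else {})"
  proof -
    have "A = B \<and> \<sigma> = id" if "\<sigma> \<in> ?P" for \<sigma>
    proof -
      have \<sigma>: "\<sigma> permutes insert n A" and map: "map \<sigma> (sorted_list_of_set A) = sorted_list_of_set B"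
        using that by auto
      have "\<sigma> ` A = B" using arg_cong[OF map, of set] fin by simp
      moreover have "\<sigma> ` A \<subseteq> insert n A" using permutes_image[OF \<sigma>] by blast
      ultimately have "B \<subseteq> A" using nA by auto
      then have AB: "B = A" using fin A B by (simp add: card_subset_eq)
      then have "map \<sigma> (sorted_list_of_set A) = map id (sorted_list_of_set A)" using map by simp
      then have fixA: "\<sigma> x = x" if "x \<in> A" for x using that fin
        by (metis id_apply map_eq_conv set_sorted_list_of_set)
      have "\<sigma> n \<in> insert n A" using permutes_in_image[OF \<sigma>, of n] by simp
      then have "\<sigma> n = n"
      proof
        assume "\<sigma> n \<in> A"
        then have "\<sigma> (\<sigma> n) = \<sigma> n" by (rule fixA)
        then show ?thesis by (metis injD permutes_inj[OF \<sigma>])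
      qed
      then have "\<sigma> x = x" for x using fixA \<sigma> by (cases "x \<in> insert n A") (auto simp: permutes_not_in)
      then show ?thesis using AB by auto
    qed
    moreover have "id \<in> ?P" if "A = B" using that by simp
    ultimately show ?thesis by auto
  qed
  then show ?thesis
    unfolding hook_basis_def hook_polytabloid_eval using fin by simp
qed

text \<open>A column that contains \<open>n\<close> is reordered to a basis column at the cost of a
  sign. For a column without \<open>n\<close> a single Garnir relation with \<open>a = n\<close>
  suffices, since \<open>n\<close> occurs in every column on its right-hand side.\<close>

lemma span_hook_polytabloid:
  assumes n: "0 < n"
  shows "cfun_span (hook_polytabloid n ` columns n m) = cfun_span (hook_basis n ` {A. A \<subseteq> {1..<n} \<and> card A = m})"
    (is "_ = cfun_span ?B")
proof (rule cfun.span_eq[THEN iffD2], intro conjI subsetI)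
  fix v assume "v \<in> ?B"
  then obtain A where A: "A \<subseteq> {1..<n}" "card A = m" "v = hook_basis n A" by auto
  have "finite A" using A finite_subset by auto
  moreover have "n \<notin> A" using A by auto
  ultimately have "n # sorted_list_of_set A \<in> columns n m"
    using A n by (auto simp: columns_def)
  then show "v \<in> cfun_span (hook_polytabloid n ` columns n m)"
    unfolding A(3) hook_basis_def by (intro cfun.span_base) auto
next
  fix v assume "v \<in> hook_polytabloid n ` columns n m"
  then obtain c where c: "c \<in> columns n m" "v = hook_polytabloid n c" by auto
  have span: "hook_polytabloid n c \<in> cfun_span ?B" if c: "c \<in> columns n m" "n \<in> set c" for c
  proof -
    let ?A = "set c - {n}"
    have *: "distinct c" "length c = Suc m" "set c \<subseteq> {1..n}" using c by (auto simp: columns_def)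
    have A: "?A \<subseteq> {1..<n}"
    proof
      fix x assume "x \<in> ?A"
      then have "x \<in> {1..n}" "x \<noteq> n" using *(3) by auto
      then show "x \<in> {1..<n}" by auto
    qed
    have cardA: "card ?A = m" using * c(2) by (simp add: distinct_card)
    obtain \<gamma> where \<gamma>: "\<gamma> permutes set c" "map \<gamma> c = n # sorted_list_of_set ?A"
      by (rule permutation_between_lists[of c "n # sorted_list_of_set ?A"]) (use * c(2) in auto)
    have eq: "hook_basis n ?A = (\<lambda>X. of_int (sign \<gamma>) * hook_polytabloid n c X)"
      unfolding hook_basis_def \<gamma>(2)[symmetric] by (rule hook_polytabloid_permuted[OF \<gamma>(1)])
    have "of_int (sign \<gamma>) * of_int (sign \<gamma>) = (1 :: complex)"
      by (metis of_int_1 of_int_mult sign_idempotent)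
    then have "hook_polytabloid n c = fun_scale (of_int (sign \<gamma>)) (hook_basis n ?A)"
      unfolding eq by (simp add: mult.assoc[symmetric])
    moreover have "hook_basis n ?A \<in> cfun_span ?B"
      using A cardA by (intro cfun.span_base) auto
    ultimately show ?thesis using cfun.span_scale by metis
  qed
  show "v \<in> cfun_span ?B"
  proof (cases "n \<in> set c")
    case True
    then show ?thesis using span c by simp
  next
    case False
    have *: "distinct c" "length c = Suc m" "set c \<subseteq> {1..n}" using c by (auto simp: columns_def)
    have "v = (\<Sum>b\<in>set c. hook_polytabloid n (map (transpose n b) c))"
      unfolding c(2) by (rule hook_polytabloid_garnir) (use * False in auto)
    also have "\<dots> \<in> cfun_span ?B"
    proof (rule cfun.span_sum)
      fix b assume b: "b \<in> set c"
      show "hook_polytabloid n (map (transpose n b) c) \<in> cfun_span ?B"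
      proof (rule span)
        have "transpose n b ` set c \<subseteq> {1..n}"
          using b * n by (auto simp: transpose_def)
        moreover have "inj_on (transpose n b) (set c)" by (rule inj_on_subset[OF inj_transpose]) simp
        ultimately show "map (transpose n b) c \<in> columns n m"
          using * by (auto simp: columns_def distinct_map)
        show "n \<in> set (map (transpose n b) c)" using b by force
      qed
    qed
    finally show ?thesis .
  qed
qed

section \<open>Specht modules of hook shape and their characters\<close>

lemma hook_nth: "i \<le> m \<Longrightarrow> hook k m ! i = (if i = 0 then k else 1)"
  by (cases i) (auto simp: hook_def)

lemma length_hook: "length (hook k m) = Suc m"
  by (simp add: hook_def)

lemma cells_hook: "0 < k \<Longrightarrow> cells (hook k m) = {(i, j). j = 0 \<and> i \<le> m \<or> i = 0 \<and> j < k}"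
  by (auto simp: cells_def length_hook less_Suc_eq_le hook_nth split: if_splits)

lemma sum_list_hook: "sum_list (hook k m) = k + m"
  by (simp add: hook_def sum_list_replicate)

text \<open>All columns but the first have a single cell, whose entry the column stabilizer must
  fix; the stabilizer is therefore the full symmetric group on the entries of the first
  column.\<close>

lemma polytabloid_hook:
  assumes k: "0 < k" and t: "t \<in> tableaux (hook k m)"
  defines "c \<equiv> map (\<lambda>i. t (i, 0)) [0..<Suc m]"
  shows "c \<in> columns (k + m) m" and "polytabloid (hook k m) t = hook_polytabloid (k + m) c"
proof -
  let ?n = "k + m" and ?cells = "cells (hook k m)"
  have bij: "bij_betw t ?cells {1..?n}" using t by (simp add: tableaux_def sum_list_hook)
  have inj: "inj_on t ?cells" and img: "t ` ?cells = {1..?n}"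
    using bij by (auto simp: bij_betw_def)
  have col0: "{c \<in> ?cells. snd c = 0} = (\<lambda>i. (i, 0)) ` {0..<Suc m}"
    using k by (auto simp: cells_hook)
  have colj: "{c \<in> ?cells. snd c = j} = (if j < k then {(0, j)} else {})" if "j \<noteq> 0" for j
    using that k by (auto simp: cells_hook)
  have setc: "set c = t ` {c \<in> ?cells. snd c = 0}"
    unfolding col0 c_def by (simp add: image_image del: upt_Suc)
  have inj_col: "inj_on (\<lambda>i. t (i, 0)) {0..<Suc m}"
  proof (rule inj_onI)
    fix i j assume "i \<in> {0..<Suc m}" "j \<in> {0..<Suc m}" "t (i, 0) = t (j, 0)"
    then have "(i, 0 :: nat) = (j, 0)" using k by (intro inj_onD[OF inj]) (auto simp: cells_hook)
    then show "i = j" by simp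
  qed
  show "c \<in> columns ?n m"
    using img inj_col unfolding columns_def mem_Collect_eq setc
    by (auto simp: c_def distinct_map simp del: upt_Suc)
  have rest: "\<exists>j. j \<noteq> 0 \<and> j < k \<and> x = t (0, j)" if x: "x \<in> {1..?n} - set c" for x
  proof -
    have "x \<in> t ` ?cells" unfolding img using x by blast
    then obtain p where p: "p \<in> ?cells" "x = t p" by blast
    then have "snd p \<noteq> 0" using x unfolding setc by auto
    then show ?thesis using p k by (auto simp: cells_hook)
  qed
  have stab: "column_stabilizer (hook k m) t = {\<sigma>. \<sigma> permutes set c}"
  proof (intro equalityI subsetI CollectI)
    fix \<sigma> assume "\<sigma> \<in> column_stabilizer (hook k m) t"
    then have \<sigma>: "\<sigma> permutes {1..?n}" "\<And>j. \<sigma> ` t ` {c \<in> ?cells. snd c = j} = t ` {c \<in> ?cells. snd c = j}"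
      by (auto simp: column_stabilizer_def sum_list_hook)
    show "\<sigma> permutes set c"
    proof (rule permutes_superset[OF \<sigma>(1)])
      fix x assume "x \<in> {1..?n} - set c"
      then obtain j where "j \<noteq> 0" "j < k" "x = t (0, j)" using rest by blast
      then show "\<sigma> x = x" using \<sigma>(2)[of j] colj[of j] by simp
    qed
  next
    fix \<sigma> assume "\<sigma> \<in> {\<sigma>. \<sigma> permutes set c}"
    then have \<sigma>: "\<sigma> permutes set c" by simp
    have "set c \<subseteq> {1..?n}" using \<open>c \<in> columns ?n m\<close> by (simp add: columns_def)
    then have "\<sigma> permutes {1..?n}" by (rule permutes_subset[OF \<sigma>])
    moreover have "\<sigma> ` t ` {c \<in> ?cells. snd c = j} = t ` {c \<in> ?cells. snd c = j}" for j
    proof (cases "j = 0")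
      case True
      then show ?thesis using permutes_image[OF \<sigma>] setc by simp
    next
      case False
      have "\<sigma> (t (0, j)) = t (0, j)" if "j < k"
      proof -
        have "t (0, j) \<noteq> t (i, 0)" if "i < Suc m" for i
          using inj_onD[OF inj, of "(0, j)" "(i, 0)"] \<open>j < k\<close> False that k by (auto simp: cells_hook)
        then have "t (0, j) \<notin> set c" unfolding setc col0 image_image by fastforce
        then show ?thesis using \<sigma> by (simp add: permutes_not_in)
      qed
      then show ?thesis using colj[OF False] by simp
    qed
    ultimately show "\<sigma> \<in> column_stabilizer (hook k m) t"
      by (simp add: column_stabilizer_def sum_list_hook)
  qed
  have "tabloid (hook k m) (\<sigma> \<circ> t) = hook_tabloid ?n (map \<sigma> (tl c))" if \<sigma>: "\<sigma> permutes set c" for \<sigma>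
  proof -
    have "set c \<subseteq> {1..?n}" using \<open>c \<in> columns ?n m\<close> by (simp add: columns_def)
    then have \<sigma>n: "\<sigma> permutes {1..?n}" by (rule permutes_subset[OF \<sigma>])
    let ?s = "\<sigma> \<circ> t"
    have s: "inj_on ?s ?cells"
      using inj by (rule comp_inj_on) (rule inj_on_subset[OF permutes_inj[OF \<sigma>n]], simp)
    have s': "?s ` ?cells = {1..?n}"
      by (metis image_comp img permutes_image[OF \<sigma>n])
    have tlc: "tl c = map (\<lambda>i. t (i, 0)) [Suc 0..<Suc m]"
      unfolding c_def by (simp add: map_tl upt_conv_Cons del: upt_Suc)
    have rows: "{c \<in> ?cells. fst c = i} = {(i, 0)}" if "i \<in> {Suc 0..<Suc m}" for i
      using that k by (auto simp: cells_hook)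
    have "?s ` {c \<in> ?cells. fst c = 0} = ?s ` (?cells - (\<lambda>i. (i, 0)) ` {Suc 0..<Suc m})"
      using k by (intro arg_cong[where f = "image ?s"]) (auto simp: cells_hook)
    also have "\<dots> = {1..?n} - ?s ` (\<lambda>i. (i, 0)) ` {Suc 0..<Suc m}"
      unfolding s'[symmetric] using k by (intro inj_on_image_set_diff[OF s]) (auto simp: cells_hook)
    also have "?s ` (\<lambda>i. (i, 0)) ` {Suc 0..<Suc m} = set (map \<sigma> (tl c))"
      unfolding tlc by (simp add: image_image del: upt_Suc)
    finally have row0: "?s ` {c \<in> ?cells. fst c = 0} = {1..?n} - set (map \<sigma> (tl c))" .
    have "tabloid (hook k m) ?s = map (\<lambda>i. ?s ` {c \<in> ?cells. fst c = i}) (0 # [Suc 0..<Suc m])"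
      unfolding tabloid_def by (simp add: hook_def upt_conv_Cons del: upt_Suc)
    also have "\<dots> = ({1..?n} - set (map \<sigma> (tl c))) # map (\<lambda>i. {?s (i, 0)}) [Suc 0..<Suc m]"
      unfolding list.map row0 by (intro arg_cong2[where f = Cons] refl map_cong) (simp only: set_upt rows image_insert image_empty)
    also have "\<dots> = hook_tabloid ?n (map \<sigma> (tl c))"
      unfolding hook_tabloid_def tlc by (simp add: comp_def del: upt_Suc)
    finally show ?thesis .
  qed
  then show "polytabloid (hook k m) t = hook_polytabloid ?n c"
    unfolding polytabloid_def hook_polytabloid_def stab by (intro ext sum.cong) auto
qed

lemma tableau_of_column:
  assumes k: "0 < k" and c: "c \<in> columns (k + m) m"
  obtains t where "t \<in> tableaux (hook k m)" "map (\<lambda>i. t (i, 0)) [0..<Suc m] = c"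
proof
  let ?n = "k + m"
  have *: "distinct c" "length c = Suc m" "set c \<subseteq> {1..?n}" using c by (auto simp: columns_def)
  define zs where "zs = c @ sorted_list_of_set ({1..?n} - set c)"
  have zs: "distinct zs" "set zs = {1..?n}" using * by (auto simp: zs_def)
  then have len: "length zs = ?n" using distinct_card[of zs] by simp
  \<comment> \<open>\<open>?q\<close> numbers the cells, first those of the column from 0 to
    \<open>m\<close>, then the rest of the first row from \<open>m + 1\<close> on, in accordance
    with the order of \<open>zs\<close>.\<close>
  let ?q = "\<lambda>(i, j). if j = 0 then i else m + j" and ?t = "\<lambda>(i, j). zs ! (if j = 0 then i else m + j)"
  have "bij_betw ?q (cells (hook k m)) {..<?n}"
    using k by (intro bij_betw_byWitness[where f' = "\<lambda>x. if x \<le> m then (x, 0) else (0, x - m)"])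
      (auto simp: cells_hook)
  then have "bij_betw (nth zs \<circ> ?q) (cells (hook k m)) {1..?n}"
    by (rule bij_betw_trans) (rule bij_betw_nth[OF zs(1)], simp_all add: len zs)
  moreover have "nth zs \<circ> ?q = ?t" by auto
  ultimately show "?t \<in> tableaux (hook k m)" by (simp add: tableaux_def sum_list_hook)
  show "map (\<lambda>i. ?t (i, 0)) [0..<Suc m] = c"
    using * by (intro nth_equalityI) (auto simp: zs_def nth_append simp del: upt_Suc)
qed

lemma specht_module_hook:
  assumes "0 < k"
  shows "specht_module (hook k m) = cfun_span (hook_polytabloid (k + m) ` columns (k + m) m)"
proof -
  have "polytabloid (hook k m) ` tableaux (hook k m) = hook_polytabloid (k + m) ` columns (k + m) m"
  proof (intro equalityI subsetI)
    fix v assume "v \<in> polytabloid (hook k m) ` tableaux (hook k m)"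
    then show "v \<in> hook_polytabloid (k + m) ` columns (k + m) m"
      using polytabloid_hook[OF assms] by auto
  next
    fix v assume "v \<in> hook_polytabloid (k + m) ` columns (k + m) m"
    then obtain c where c: "c \<in> columns (k + m) m" "v = hook_polytabloid (k + m) c" by auto
    from tableau_of_column[OF assms c(1)] obtain t
      where t: "t \<in> tableaux (hook k m)" "map (\<lambda>i. t (i, 0)) [0..<Suc m] = c" .
    have "v = polytabloid (hook k m) t"
      using polytabloid_hook(2)[OF assms t(1)] c(2) t(2) by simp
    then show "v \<in> polytabloid (hook k m) ` tableaux (hook k m)"
      using t(1) by blast
  qed
  then show ?thesis by (simp add: specht_module_def)
qed

text \<open>The diagonal entry at \<open>A\<close> is the value of the basis vector at its dual
  tabloid moved by \<open>inv \<pi>\<close>. A term \<open>\<sigma>\<close> of the polytabloid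
  contributes iff it agrees with \<open>inv \<pi>\<close> on all entries below the corner; nothing
  is asked at the corner itself.\<close>

lemma irr_char_hook:
  assumes k: "0 < k" and \<pi>: "\<pi> permutes {1..k + m}"
  shows "irr_char (hook k m) \<pi> = (\<Sum>A | A \<subseteq> {1..<k + m} \<and> card A = m.
    \<Sum>\<sigma> | \<sigma> permutes insert (k + m) A \<and> (\<forall>a\<in>A. \<sigma> a = inv \<pi> a). of_int (sign \<sigma>))"
proof -
  let ?n = "k + m" and ?I = "{A. A \<subseteq> {1..<k + m} \<and> card A = m}"
  let ?V = "cfun_span (hook_basis ?n ` ?I)"
  have n: "0 < ?n" using k by simp
  have V: "specht_module (hook k m) = ?V"
    unfolding specht_module_hook[OF k] span_hook_polytabloid[OF n] ..
  interpret f: Vector_Spaces.linear fun_scale fun_scale "tabloid_action \<pi>"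
    by (rule linear_tabloid_action)
  have inv: "tabloid_action \<pi> ` ?V \<subseteq> ?V"
    unfolding span_hook_polytabloid[OF n, symmetric]
  proof (rule image_subsetI)
    have gen: "tabloid_action \<pi> (hook_polytabloid ?n c) \<in> hook_polytabloid ?n ` columns ?n m"
      if c: "c \<in> columns ?n m" for c
    proof -
      have "map \<pi> c \<in> columns ?n m"
        using c permutes_image[OF \<pi>] inj_on_subset[OF permutes_inj[OF \<pi>], of "set c"]
        by (auto simp: columns_def distinct_map)
      then show ?thesis
        unfolding tabloid_action_hook_polytabloid[OF \<pi>] by auto
    qed
    fix v assume "v \<in> cfun_span (hook_polytabloid ?n ` columns ?n m)"
    then show "tabloid_action \<pi> v \<in> cfun_span (hook_polytabloid ?n ` columns ?n m)"
    proof (induction rule: cfun.span_induct_alt)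
      case base
      show ?case unfolding f.zero by (rule cfun.span_zero)
    next
      case (step a x y)
      then have "tabloid_action \<pi> x \<in> cfun_span (hook_polytabloid ?n ` columns ?n m)"
        using gen by (auto intro: cfun.span_base)
      then show ?case
        unfolding f.add f.scale using step(2) by (intro cfun.span_add cfun.span_scale)
    qed
  qed
  have "irr_char (hook k m) \<pi> = (\<Sum>A\<in>?I. tabloid_action \<pi> (hook_basis ?n A) (hook_tabloid ?n (sorted_list_of_set A)))"
    unfolding irr_char_def V
    by (rule trace_on_dual_basis[where p = "\<lambda>A. hook_tabloid ?n (sorted_list_of_set A)"])
      (use hook_basis_dual inv linear_tabloid_action in auto)
  also have "\<dots> = (\<Sum>A\<in>?I. \<Sum>\<sigma> | \<sigma> permutes insert ?n A \<and> (\<forall>a\<in>A. \<sigma> a = inv \<pi> a). of_int (sign \<sigma>))"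
  proof (rule sum.cong[OF refl])
    fix A assume "A \<in> ?I"
    then have "finite A" using finite_subset[of A "{1..<?n}"] by auto
    then show "tabloid_action \<pi> (hook_basis ?n A) (hook_tabloid ?n (sorted_list_of_set A)) =
        (\<Sum>\<sigma> | \<sigma> permutes insert ?n A \<and> (\<forall>a\<in>A. \<sigma> a = inv \<pi> a). of_int (sign \<sigma>))"
      unfolding tabloid_action_def map_image_hook_tabloid[OF permutes_inv[OF \<pi>]] hook_basis_def hook_polytabloid_eval
      by simp
  qed
  finally show ?thesis .
qed

text \<open>Summation over \<open>k\<close> lifts the condition on \<open>card A\<close>, so the
  terms are exactly the extension pairs of \<open>inv \<pi>\<close>.\<close>

lemma sum_irr_char_hook:
  assumes n: "0 < n" and \<pi>: "\<pi> permutes {1..n}"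
  shows "2 * (\<Sum>k = 1..n. irr_char (hook k (n - k)) \<pi>) = exterior_char {1..n} \<pi>"
proof -
  let ?S = "\<lambda>A. {\<sigma>. \<sigma> permutes insert n A \<and> (\<forall>a\<in>A. \<sigma> a = inv \<pi> a)}"
  let ?g = "\<lambda>A. \<Sum>\<sigma>\<in>?S A. of_int (sign \<sigma>) :: complex"
  have "(\<Sum>k = 1..n. irr_char (hook k (n - k)) \<pi>) = (\<Sum>k = 1..n. \<Sum>A | A \<subseteq> {1..<n} \<and> card A = n - k. ?g A)"
  proof (rule sum.cong[OF refl])
    fix k assume "k \<in> {1..n}"
    then show "irr_char (hook k (n - k)) \<pi> = (\<Sum>A | A \<subseteq> {1..<n} \<and> card A = n - k. ?g A)"
      using irr_char_hook[of k \<pi> "n - k"] \<pi> by simp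
  qed
  also have "\<dots> = (\<Sum>m\<in>{..<n}. \<Sum>A | A \<in> Pow {1..<n} \<and> card A = m. ?g A)"
    by (rule sum.reindex_bij_witness[where i = "\<lambda>m. n - m" and j = "\<lambda>k. n - k"]) (use n in auto)
  also have "\<dots> = sum ?g (Pow {1..<n})"
  proof (rule sum.group)
    show "card ` Pow {1..<n} \<subseteq> {..<n}"
    proof safe
      fix A assume "A \<subseteq> {1..<n}"
      then show "card A < n" using card_mono[of "{1..<n}" A] n by simp
    qed
  qed auto
  also have "\<dots> = (\<Sum>(A, \<sigma>)\<in>Sigma (Pow {1..<n}) ?S. of_int (sign \<sigma>))"
  proof (rule sum.Sigma)
    show "\<forall>A\<in>Pow {1..<n}. finite (?S A)"
    proof
      fix A assume "A \<in> Pow {1..<n}"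
      then have "finite (insert n A)" using finite_subset[of A "{1..<n}"] by auto
      then show "finite (?S A)"
        using finite_subset[OF _ finite_permutations[of "insert n A"], of "?S A"] by blast
    qed
  qed simp
  also have "Sigma (Pow {1..<n}) ?S = extension_pairs n (inv \<pi>)"
    by (auto simp: extension_pairs_def)
  finally show ?thesis
    using exterior_char_eq_extension_pairs[OF n permutes_inv[OF \<pi>]] exterior_char_inv[OF _ \<pi>] by simp
qed

section \<open>Counting arc permutations\<close>

text \<open>The words that remove the letters of the arc \<open>a, \<dots>, a + l - 1\<close> modulo \<open>N\<close> one by one from its ends.\<close>

fun arc_words :: "int \<Rightarrow> int \<Rightarrow> nat \<Rightarrow> int list set" where
  "arc_words N a 0 = {[]}"
| "arc_words N a (Suc l) =
     (#) (a mod N) ` arc_words N (a + 1) l \<union> (#) ((a + int l) mod N) ` arc_words N a l"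

fun compatible :: "int list \<Rightarrow> nat list \<Rightarrow> bool" where
  "compatible (a # b # u) (x # y # xs) \<longleftrightarrow> (x = y \<longrightarrow> a < b) \<and> compatible (b # u) (y # xs)"
| "compatible _ _ \<longleftrightarrow> True"

text \<open>The bound \<open>z\<close> is the letter removed just before, if it belongs to the same
  block. The value \<open>- 1\<close> stands for no bound, as letters are residues and hence
  nonnegative.\<close>

definition arc_count :: "int \<Rightarrow> int \<Rightarrow> int \<Rightarrow> nat list \<Rightarrow> nat" where
  "arc_count N z a xs = card {u \<in> arc_words N a (length xs). compatible u xs \<and> z < hd u}"

lemma finite_arc_words: "finite (arc_words N a l)"
  by (induction l arbitrary: a) auto

lemma length_arc_words: "u \<in> arc_words N a l \<Longrightarrow> length u = l"
  by (induction l arbitrary: a u) auto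

lemma arc_count_single: "arc_count N z a [x] = (if z < a mod N then 1 else 0)"
proof -
  have "{u \<in> arc_words N a (length [x]). compatible u [x] \<and> z < hd u} =
      (if z < a mod N then {[a mod N]} else {})"
    by auto
  then show ?thesis by (simp add: arc_count_def)
qed

text \<open>The summands are the removals of the first and of the last letter of the arc. The
  recursion starts at two letters, since a single letter is both ends of its arc and would be
  counted twice.\<close>

lemma arc_count_Cons_Cons:
  assumes "int (length ys) + 1 < N"
  shows "arc_count N z a (x # y # ys) =
    (if z < a mod N then arc_count N (if x = y then a mod N else - 1) (a + 1) (y # ys) else 0) +
    (if z < (a + int (length ys) + 1) mod N
     then arc_count N (if x = y then (a + int (length ys) + 1) mod N else - 1) a (y # ys) else 0)"
proof -
  define l where "l = length (y # ys)"
  define c where "c = (a + int l) mod N"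
  have nonneg: "- 1 < hd v" if "v \<in> arc_words N b l" for v b
  proof -
    have "N > 0" using assms by simp
    with that show ?thesis unfolding l_def
      by (auto simp: less_le_trans[of "- 1" 0] pos_mod_sign)
  qed
  let ?S = "\<lambda>e b. {v \<in> arc_words N b l. compatible v (y # ys) \<and> (if x = y then e else - 1) < hd v}"
  let ?C = "\<lambda>e b. if z < e then (#) e ` ?S e b else {}"
  have compat: "compatible (e # v) (x # y # ys) \<longleftrightarrow> compatible v (y # ys) \<and> (x = y \<longrightarrow> e < hd v)"
    if "v \<in> arc_words N b l" for e v b x
    using length_arc_words[OF that] unfolding l_def by (cases v) auto
  \<comment> \<open>Since \<open>0 < l < N\<close>, the ends are different residues and the two
    cases are disjoint.\<close>
  have ne: "a mod N \<noteq> c"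
  proof
    assume "a mod N = c"
    then have "N dvd int l" unfolding c_def by (metis add_diff_cancel_left' mod_eq_dvd_iff)
    then show False using assms zdvd_not_zless[of "int l" N] unfolding l_def by auto
  qed
  have "{u \<in> arc_words N a (length (x # y # ys)). compatible u (x # y # ys) \<and> z < hd u} =
      {u \<in> arc_words N a (Suc l). compatible u (x # y # ys) \<and> z < hd u}"
    by (simp add: l_def)
  also have "\<dots> = ?C (a mod N) (a + 1) \<union> ?C c a"
    unfolding arc_words.simps(2) c_def[symmetric] using nonneg
    by (auto simp: compat simp del: compatible.simps split: if_splits)
  finally have eq: "{u \<in> arc_words N a (length (x # y # ys)). compatible u (x # y # ys) \<and> z < hd u} =
    ?C (a mod N) (a + 1) \<union> ?C c a" .
  have "card (?C (a mod N) (a + 1) \<union> ?C c a) = card (?C (a mod N) (a + 1)) + card (?C c a)"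
    by (rule card_Un_disjoint) (use ne in \<open>auto simp: finite_arc_words\<close>)
  moreover have "card (?C e b) = (if z < e then card (?S e b) else 0)" for e b
    by (auto intro!: card_image)
  moreover have "(a + int (length ys) + 1) mod N = c"
    by (simp add: c_def l_def ac_simps)
  ultimately show ?thesis
    unfolding arc_count_def l_def[symmetric] eq by simp
qed

lemma arc_count_shift: "arc_count N z (a + N) xs = arc_count N z a xs"
proof -
  have "arc_words N (a + N) l = arc_words N a l" for a l
  proof (induction l arbitrary: a)
    case (Suc l)
    have "(a + N + int l) mod N = (a + int l) mod N"
      by (metis add.assoc add.commute mod_add_self2)
    then show ?case using Suc[of "a + 1"] Suc[of a] by (simp add: ac_simps)
  qed simp
  then show ?thesis by (simp add: arc_count_def)
qed

text \<open>Inside a block the largest letter must not be removed before the last step of the block,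
  as no remaining letter exceeds it; this is the second claim. At the last step of every block
  except the final one both ends are allowed, which gives \<open>2 ^ (d - 1)\<close> words for
  \<open>d\<close> blocks.\<close>

lemma arc_count_unwrapped:
  assumes "xs \<noteq> []" "0 \<le> a" "a + int (length xs) \<le> N" "sorted xs" "int (length xs) < N"
  shows "z < a \<Longrightarrow> 2 * arc_count N z a xs = 2 ^ card (set xs)"
    and "a + int (length xs) - 1 \<le> z \<Longrightarrow> arc_count N z a xs = 0"
  using assms
proof (atomize(full), induction xs arbitrary: a z rule: induct_list012)
  case (2 x)
  then show ?case by (simp add: arc_count_single)
next
  case (3 x y ys)
  let ?b = "a + int (length ys) + 1"
  have m: "a mod N = a" "?b mod N = ?b" using 3(4,5,7) by auto
  have IH: "z < a \<Longrightarrow> 2 * arc_count N z a (y # ys) = 2 ^ card (set (y # ys))"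
     "a + int (length ys) \<le> z \<Longrightarrow> arc_count N z a (y # ys) = 0"
    if "0 \<le> a" "a + int (length (y # ys)) \<le> N" for a z
    using 3(2)[of a z] 3(6,7) that by auto
  have set: "card (set (x # y # ys)) = (if x = y then card (set (y # ys)) else Suc (card (set (y # ys))))"
  proof (cases "x = y")
    case False
    then have "x \<notin> set (y # ys)" using 3(6) by auto
    then show ?thesis using False by simp
  qed simp
  have N: "int (length ys) + 1 < N" using 3(7) by simp
  show ?case
    unfolding arc_count_Cons_Cons[OF N] m set
    using IH(1)[of "a + 1"] IH(1)[of a] IH(2)[of a] 3(4,5) by auto
qed auto


section \<open>Arcs that cross the cut\<close>

text \<open>An interval that crosses the cut consists of the \<open>p\<close> largest letters, starting with
  \<open>N - p\<close>, followed by the \<open>q\<close> smallest letters. If the first letter has to exceed the letter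
  removed just before, which is \<open>N - p - 1\<close> or \<open>q\<close>, then it does not matter which of the two
  it was.\<close>

definition free_count :: "int \<Rightarrow> nat \<Rightarrow> nat list \<Rightarrow> nat" where
  "free_count N p xs = arc_count N (- 1) (N - int p) xs"

definition bound_count :: "int \<Rightarrow> nat \<Rightarrow> nat list \<Rightarrow> nat" where
  "bound_count N p xs = arc_count N (int (length xs) - int p) (N - int p) xs"

text \<open>A bound in the gap between the small and the large letters excludes the small end, so
  the word has to begin with \<open>N - p\<close>.\<close>

lemma arc_count_wrapped:
  assumes "1 \<le> p" "p \<le> Suc (length ys)" "int (length ys) + 2 < N" "int (length ys) + 2 - int p \<le> z" "z < N - int p"
  shows "arc_count N z (N - int p) (x # y # ys) =
    arc_count N (if x = y then N - int p else - 1) (N - int p + 1) (y # ys)"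
proof -
  have "N - int p + int (length ys) + 1 = N + (int (length ys) + 1 - int p)"
    by simp
  then have "(N - int p + int (length ys) + 1) mod N = (int (length ys) + 1 - int p) mod N"
    by (simp only: mod_add_self1)
  then have "(N - int p + int (length ys) + 1) mod N = int (length ys) + 1 - int p"
    using assms by simp
  moreover have "(N - int p) mod N = N - int p"
    using assms by (intro mod_pos_pos_trivial) auto
  ultimately show ?thesis
    using assms by (subst arc_count_Cons_Cons) auto
qed

text \<open>For \<open>p = 0\<close> the arc starts at \<open>N\<close>, that is at 0, and none of
  its letters exceeds \<open>z\<close>; for \<open>p = length xs\<close> all of them do; otherwise
  the right-hand side of \<open>arc_count_wrapped\<close> is free of \<open>z\<close>.\<close>

lemma bound_count_eqI:
  assumes "xs \<noteq> []" "sorted xs" "p \<le> length xs" "int (length xs) < N"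
    "int (length xs) - int p \<le> z" "z < N - int p"
  shows "arc_count N z (N - int p) xs = bound_count N p xs"
proof -
  consider "p = 0" | "p = length xs" | "0 < p" "p < length xs"
    using assms(3) by linarith
  then show ?thesis
  proof cases
    case 1
    have *: "arc_count N z N xs = 0" if "int (length xs) \<le> z" for z
      using arc_count_unwrapped(2)[of xs 0 N z] arc_count_shift[of N z 0 xs] assms that by simp
    show ?thesis using 1 * assms by (simp add: bound_count_def)
  next
    case 2
    have "2 * arc_count N z (N - int p) xs = 2 * bound_count N p xs"
      unfolding bound_count_def using 2 assms by (simp add: arc_count_unwrapped(1))
    then show ?thesis by simp
  next
    case 3
    then obtain x y ys where "xs = x # y # ys"
      by (cases xs rule: remdups_adj.cases) auto
    then show ?thesis
      using 3 assms by (simp add: bound_count_def arc_count_wrapped)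
  qed
qed

lemma bound_count_0: "xs \<noteq> [] \<Longrightarrow> sorted xs \<Longrightarrow> int (length xs) < N \<Longrightarrow> bound_count N 0 xs = 0"
  using arc_count_unwrapped(2)[of xs 0 N "int (length xs)"] arc_count_shift[of N "int (length xs)" 0 xs]
  by (simp add: bound_count_def)

lemma bound_count_length:
  "xs \<noteq> [] \<Longrightarrow> sorted xs \<Longrightarrow> int (length xs) < N \<Longrightarrow>
    2 * bound_count N (length xs) xs = 2 ^ card (set xs)"
  unfolding bound_count_def by (rule arc_count_unwrapped(1)) auto

lemma free_count_length:
  "xs \<noteq> [] \<Longrightarrow> sorted xs \<Longrightarrow> int (length xs) < N \<Longrightarrow>
    2 * free_count N (length xs) xs = 2 ^ card (set xs)"
  unfolding free_count_def by (rule arc_count_unwrapped(1)) auto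

lemma free_count_0:
  "xs \<noteq> [] \<Longrightarrow> sorted xs \<Longrightarrow> int (length xs) < N \<Longrightarrow> 2 * free_count N 0 xs = 2 ^ card (set xs)"
  using arc_count_unwrapped(1)[of xs 0 N "- 1"] arc_count_shift[of N "- 1" 0 xs]
  by (simp add: free_count_def)

lemma bound_count_Cons:
  assumes "1 \<le> p" "p \<le> Suc (length ys)" "int (length ys) + 2 < N" "sorted (y # ys)"
  shows "bound_count N p (x # y # ys) =
    (if x = y then bound_count N (p - 1) (y # ys) else free_count N (p - 1) (y # ys))"
proof -
  have "bound_count N p (x # y # ys) =
      arc_count N (if x = y then N - int p else - 1) (N - int (p - 1)) (y # ys)"
    using assms by (simp add: bound_count_def arc_count_wrapped of_nat_diff algebra_simps)
  also have "\<dots> = (if x = y then bound_count N (p - 1) (y # ys) else free_count N (p - 1) (y # ys))"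
    using assms bound_count_eqI[of "y # ys" "p - 1" N "N - int p"] by (auto simp: free_count_def)
  finally show ?thesis .
qed

text \<open>The removed letter, from either end, lies in the gap of the remaining arc, so by
  \<open>bound_count_eqI\<close> both branches inside a block are bound counts. Only the removal of
  the letter \<open>N - p\<close> lowers \<open>p\<close>.\<close>

lemma free_count_Cons:
  assumes "1 \<le> p" "p \<le> Suc (length ys)" "int (length ys) + 2 < N" "sorted (y # ys)"
  shows "free_count N p (x # y # ys) =
    (if x = y then bound_count N (p - 1) (y # ys) + bound_count N p (y # ys)
     else free_count N (p - 1) (y # ys) + free_count N p (y # ys))"
proof -
  have "N - int p + int (length ys) + 1 = N + (int (length ys) + 1 - int p)"
    by simp
  then have "(N - int p + int (length ys) + 1) mod N = (int (length ys) + 1 - int p) mod N"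
    by (simp only: mod_add_self1)
  then have 1: "(N - int p + int (length ys) + 1) mod N = int (length ys) + 1 - int p"
    using assms by simp
  have 2: "(N - int p) mod N = N - int p"
    using assms by (intro mod_pos_pos_trivial) auto
  have 3: "int (length ys) + 1 < N" using assms by simp
  have 4: "N - int p + 1 = N - int (p - 1)" using assms by simp
  show ?thesis
    unfolding free_count_def[of N p "x # y # ys"] arc_count_Cons_Cons[OF 3] 1 2 4
    using assms bound_count_eqI[of "y # ys" "p - 1" N "N - int p"]
      bound_count_eqI[of "y # ys" p N "int (length ys) + 1 - int p"]
    by (auto simp: free_count_def)
qed

text \<open>The term \<open>2 ^ d\<close> for the monomial divided by one variable
  \<open>i\<close>.\<close>

definition set_weight :: "nat list \<Rightarrow> nat \<Rightarrow> nat" where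
  "set_weight xs i = 2 ^ card (set (remove1 i xs))"

text \<open>Let \<open>T\<close> and \<open>H\<close> be the sums of free and bound counts for the
  tail. Up to boundary terms, a repeated letter in front replaces \<open>T\<close> by
  \<open>2 * H\<close> and keeps \<open>H\<close>; a new letter replaces \<open>T\<close> by
  \<open>2 * T\<close> and \<open>H\<close> by \<open>T\<close>. The weights follow suit: a new
  letter doubles all old weights, and a repeated one affects at most the weight of the head, which
  is why the second claim leaves the head out.\<close>

lemma sum_free_count:
  assumes "xs \<noteq> []" "sorted xs" "int (length xs) < N"
  shows "2 ^ card (set xs) + 2 * (\<Sum>p = 1..<length xs. free_count N p xs) = 2 * sum (set_weight xs) (set xs)"
    and "2 * (\<Sum>p = 1..<length xs. bound_count N p xs) = sum (set_weight xs) (set xs - {hd xs})"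
  using assms
proof (atomize(full), induction xs rule: induct_list012)
  case (2 x)
  then show ?case by (simp add: set_weight_def)
next
  case (3 x y ys)
  let ?zs = "y # ys" and ?s = "length (y # ys)"
  let ?T = "\<Sum>p = 1..<?s. free_count N p ?zs" and ?H = "\<Sum>p = 1..<?s. bound_count N p ?zs"
  have s: "sorted ?zs" and N: "int ?s < N" "int (length ys) + 2 < N"
    using 3(4,5) by auto
  have IH: "2 ^ card (set ?zs) + 2 * ?T = 2 * sum (set_weight ?zs) (set ?zs)"
      "2 * ?H = sum (set_weight ?zs) (set ?zs - {y})"
    using 3(2) s N(1) by auto
  \<comment> \<open>Prepending a letter leads to indices \<open>p - 1\<close> and \<open>p\<close>.
    Over the longer range they add the end value at 0 or at \<open>?s\<close>, where the arc does
    not cross the cut.\<close>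
  have low: "(\<Sum>p = 1..<Suc ?s. f (p - 1)) = f 0 + (\<Sum>p = 1..<?s. f p)" for f :: "nat \<Rightarrow> nat"
    using sum.shift_bounds_Suc_ivl[of "\<lambda>p. f (p - 1)" 0 ?s] by (simp add: sum.atLeast_Suc_lessThan)
  have high: "(\<Sum>p = 1..<Suc ?s. f p) = f ?s + (\<Sum>p = 1..<?s. f p)" for f :: "nat \<Rightarrow> nat"
    by simp
  have bnd: "2 * free_count N 0 ?zs = 2 ^ card (set ?zs)" "2 * free_count N ?s ?zs = 2 ^ card (set ?zs)"
      "2 * bound_count N ?s ?zs = 2 ^ card (set ?zs)" "bound_count N 0 ?zs = 0"
    using s N(1) by (intro free_count_0 free_count_length bound_count_length bound_count_0; simp)+
  have sum_if_const: "(\<Sum>p\<in>A. if b then f p + g p else h p + k p) =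
      (if b then sum f A + sum g A else sum h A + sum k A)" for b f g h k and A :: "nat set"
    by (simp add: sum.distrib)
  have len: "length (x # ?zs) = Suc ?s" by simp
  have T: "(\<Sum>p = 1..<Suc ?s. free_count N p (x # ?zs)) =
      (if x = y then 2 * ?H + bound_count N ?s ?zs else 2 * ?T + free_count N 0 ?zs + free_count N ?s ?zs)"
  proof -
    have "(\<Sum>p = 1..<Suc ?s. free_count N p (x # ?zs)) = (\<Sum>p = 1..<Suc ?s. 
        (if x = y then bound_count N (p - 1) ?zs + bound_count N p ?zs
         else free_count N (p - 1) ?zs + free_count N p ?zs))"
      by (intro sum.cong refl free_count_Cons) (use s N in auto)
    also have "\<dots> = (if x = y
        then (\<Sum>p = 1..<Suc ?s. bound_count N (p - 1) ?zs) + (\<Sum>p = 1..<Suc ?s. bound_count N p ?zs)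
        else (\<Sum>p = 1..<Suc ?s. free_count N (p - 1) ?zs) + (\<Sum>p = 1..<Suc ?s. free_count N p ?zs))"
      by (rule sum_if_const)
    finally show ?thesis
      unfolding low[of "\<lambda>p. bound_count N p ?zs"] low[of "\<lambda>p. free_count N p ?zs"]
        high[of "\<lambda>p. bound_count N p ?zs"] high[of "\<lambda>p. free_count N p ?zs"] bnd(4)
      by (simp only: mult_2 ac_simps add_0)
  qed
  have H: "(\<Sum>p = 1..<Suc ?s. bound_count N p (x # ?zs)) = (if x = y then ?H else ?T + free_count N 0 ?zs)"
  proof -
    have "(\<Sum>p = 1..<Suc ?s. bound_count N p (x # ?zs)) = (\<Sum>p = 1..<Suc ?s. 
        (if x = y then bound_count N (p - 1) ?zs else free_count N (p - 1) ?zs))"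
      by (intro sum.cong refl bound_count_Cons) (use s N in auto)
    also have "\<dots> = (if x = y then (\<Sum>p = 1..<Suc ?s. bound_count N (p - 1) ?zs)
        else (\<Sum>p = 1..<Suc ?s. free_count N (p - 1) ?zs))"
      using sum_if_const[of "x = y" "\<lambda>p. bound_count N (p - 1) ?zs" "\<lambda>_. 0"
          "\<lambda>p. free_count N (p - 1) ?zs" "\<lambda>_. 0" "{1..<Suc ?s}"]
      unfolding sum.neutral_const add_0_right .
    finally show ?thesis
      unfolding low[of "\<lambda>p. bound_count N p ?zs"] low[of "\<lambda>p. free_count N p ?zs"] bnd(4)
      by (simp only: ac_simps add_0)
  qed
  show ?case
  proof (cases "x = y")
    case True
    have w: "sum (set_weight (x # ?zs)) (set ?zs - {y}) = sum (set_weight ?zs) (set ?zs - {y})"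
    proof (rule sum.cong[OF refl])
      fix i assume "i \<in> set ?zs - {y}"
      then show "set_weight (x # ?zs) i = set_weight ?zs i"
        using True by (simp add: set_weight_def insert_absorb)
    qed
    have "sum (set_weight (x # ?zs)) (set ?zs) = set_weight (x # ?zs) y + sum (set_weight (x # ?zs)) (set ?zs - {y})"
      by (rule sum.remove) auto
    also have "set_weight (x # ?zs) y = 2 ^ card (set ?zs)"
      using True by (simp add: set_weight_def)
    finally show ?thesis
      unfolding len T H using True IH bnd w by (simp add: insert_absorb)
  next
    case False
    then have x: "x \<notin> set ?zs" using 3(4) by auto
    have w: "sum (set_weight (x # ?zs)) (set ?zs) = 2 * sum (set_weight ?zs) (set ?zs)"
      unfolding sum_distrib_left
    proof (rule sum.cong[OF refl])
      fix i assume i: "i \<in> set ?zs"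
      then have "x \<noteq> i" using x by auto
      moreover have "x \<notin> set (remove1 i ?zs)" by (rule notin_set_remove1[OF x])
      ultimately show "set_weight (x # ?zs) i = 2 * set_weight ?zs i"
        by (simp add: set_weight_def del: remove1.simps(2)) (simp add: remove1.simps(2))
    qed
    have "sum (set_weight (x # ?zs)) (set (x # ?zs)) = 2 ^ card (set ?zs) + 2 * sum (set_weight ?zs) (set ?zs)"
      using x w by (simp add: set_weight_def)
    moreover have "set (x # ?zs) - {x} = set ?zs" using x by auto
    moreover have "card (set (x # ?zs)) = Suc (card (set ?zs))" using x by simp
    ultimately show ?thesis
      unfolding len T H list.sel(1) using False IH(1) bnd w by simp
  qed
qed auto

text \<open>The starts from 0 to \<open>n\<close> give \<open>n + 1\<close> arcs that do not cross
  the cut, each with half of \<open>2 ^ card (set xs)\<close> words; the starts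
  \<open>2 * n - p\<close> with \<open>0 < p < n\<close> give the others. One of the
  \<open>n + 1\<close> arcs supplies the extra power of 2 in \<open>sum_free_count\<close>.\<close>

lemma arc_count_total:
  assumes "xs \<noteq> []" "sorted xs" "length xs = n"
  shows "2 * (\<Sum>a = 0..<2 * n. arc_count (2 * int n) (- 1) (int a) xs) =
    n * 2 ^ card (set xs) + 2 * sum (set_weight xs) (set xs)"
proof -
  let ?N = "2 * int n" and ?c = "\<lambda>a. arc_count (2 * int n) (- 1) (int a) xs"
  have n: "n > 0" using assms by auto
  have "2 * sum ?c {0..<Suc n} = (\<Sum>a = 0..<Suc n. 2 ^ card (set xs))"
    unfolding sum_distrib_left
    by (intro sum.cong refl arc_count_unwrapped(1)) (use assms n in auto)
  moreover have "sum ?c {Suc n..<2 * n} = (\<Sum>p = 1..<n. free_count ?N p xs)"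
    by (rule sum.reindex_bij_witness[where i = "\<lambda>p. 2 * n - p" and j = "\<lambda>p. 2 * n - p"])
      (use n in \<open>auto simp: free_count_def of_nat_diff\<close>)
  moreover have "sum ?c {0..<2 * n} = sum ?c {0..<Suc n} + sum ?c {Suc n..<2 * n}"
    using n by (intro sum.atLeastLessThan_concat[symmetric]) auto
  ultimately show ?thesis
    using sum_free_count(1)[of xs ?N] assms n by simp
qed

section \<open>Arcs and the removal of their ends\<close>

definition arc :: "int \<Rightarrow> int \<Rightarrow> nat \<Rightarrow> int set" where
  "arc N a l = (\<lambda>j. (a + int j) mod N) ` {..<l}"

lemma cyclic_interval_iff_arc: "cyclic_interval m A \<longleftrightarrow> (\<exists>a l. A = arc (int m) a l)"
  by (simp add: cyclic_interval_def arc_def)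

lemma arc_Suc: "arc N a (Suc l) = insert ((a + int l) mod N) (arc N a l)"
  by (simp add: arc_def lessThan_Suc)

lemma arc_Suc': "arc N a (Suc l) = insert (a mod N) (arc N (a + 1) l)"
  by (auto simp: arc_def lessThan_Suc_eq_insert_0 image_image ac_simps)

lemma arc_mod: "a mod N = b mod N \<Longrightarrow> arc N a l = arc N b l"
  unfolding arc_def by (metis mod_add_left_eq)

lemma arc_shift: "(\<lambda>v. (v + c) mod N) ` arc N a l = arc N (a + c) l"
  by (simp add: arc_def image_image mod_simps ac_simps)

lemma inj_on_arc: "int l \<le> N \<Longrightarrow> inj_on (\<lambda>j. (a + int j) mod N) {..<l}"
proof (rule inj_onI)
  fix i j assume l: "int l \<le> N" "i \<in> {..<l}" "j \<in> {..<l}" and eq: "(a + int i) mod N = (a + int j) mod N"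
  from eq have "(a + int i - a) mod N = (a + int j - a) mod N"
    by (metis mod_diff_left_eq)
  then show "i = j" using l by simp
qed

lemma card_arc: "int l \<le> N \<Longrightarrow> card (arc N a l) = l"
  by (simp add: arc_def card_image inj_on_arc)

lemma finite_arc: "finite (arc N a l)"
  by (simp add: arc_def)

lemma arc_pred_notin:
  assumes "int l < N"
  shows "(a - 1) mod N \<notin> arc N a l"
proof
  assume "(a - 1) mod N \<in> arc N a l"
  then obtain j where j: "j < l" "(a + int j) mod N = (a - 1) mod N"
    by (auto simp: arc_def)
  then have "N dvd (a + int j) - (a - 1)" by (simp add: mod_eq_dvd_iff)
  then have "N dvd int j + 1" by simp
  then show False using j(1) assms zdvd_imp_le[of N "int j + 1"] by linarith
qed

text \<open>An element at an offset \<open>j > 0\<close> has its predecessor at offset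
  \<open>j - 1\<close>. The start of an arc can thus be recovered from the set.\<close>

lemma arc_startI:
  assumes "y \<in> arc N a l" "(y - 1) mod N \<notin> arc N a l"
  shows "y = a mod N"
proof -
  obtain j where j: "j < l" "y = (a + int j) mod N" using assms(1) by (auto simp: arc_def)
  show ?thesis
  proof (cases j)
    case (Suc i)
    then have "(y - 1) mod N = (a + int i) mod N" using j by (simp add: mod_simps)
    then show ?thesis using assms(2) j(1) Suc by (auto simp: arc_def)
  qed (use j in simp)
qed

lemma arc_eqD: "arc N a l = arc N b l \<Longrightarrow> 0 < l \<Longrightarrow> int l < N \<Longrightarrow> a mod N = b mod N"
proof (rule arc_startI[of _ N b l])
  assume *: "arc N a l = arc N b l" "0 < l" "int l < N"
  then show "(a mod N - 1) mod N \<notin> arc N b l"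
    using arc_pred_notin[of l N a] by (simp add: mod_simps)
  show "a mod N \<in> arc N b l"
    unfolding *(1)[symmetric] using *(2) by (force simp: arc_def)
qed

text \<open>The predecessor of \<open>a\<close> is missing from the larger arc. If \<open>x\<close>
  is not the start \<open>a\<close>, then \<open>a\<close> is also the start of what remains;
  otherwise \<open>a + 1\<close> is. The bound on \<open>l\<close> excludes the full circle, from
  which any point can be removed.\<close>

lemma arc_remove:
  assumes J: "insert x (arc N b l) = arc N a (Suc l)" and x: "x \<notin> arc N b l"
    and l: "0 < l" "int (Suc l) < N"
  shows "arc N b l = arc N a l \<or> arc N b l = arc N (a + 1) l"
proof -
  have a: "a mod N \<in> insert x (arc N b l)" "(a + 1) mod N \<in> insert x (arc N b l)"
    unfolding J using l(1) by (force simp: arc_def)+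
  have pred: "(a - 1) mod N \<notin> insert x (arc N b l)"
    unfolding J using arc_pred_notin[OF l(2)] .
  show ?thesis
  proof (cases "a mod N = x")
    case True
    have "(a + 1) mod N \<noteq> a mod N"
    proof
      assume "(a + 1) mod N = a mod N"
      then have "N dvd 1" by (metis add_diff_cancel_left' mod_eq_dvd_iff)
      then show False using l by simp
    qed
    then have "(a + 1) mod N = b mod N"
      using True a x by (intro arc_startI[of _ N b l]) (auto simp: mod_simps)
    then show ?thesis using arc_mod by metis
  next
    case False
    then have "a mod N = b mod N"
      using a pred by (intro arc_startI[of _ N b l]) (auto simp: mod_simps)
    then show ?thesis using arc_mod by metis
  qed
qed

text \<open>In \<open>cyclic_interval\<close> the length may exceed \<open>m\<close>, the set then
  being the whole circle; a cardinality below \<open>m\<close> rules this out and fixes the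
  length.\<close>

lemma cyclic_interval_card:
  assumes "cyclic_interval m A" "card A = l" "l < m"
  shows "\<exists>a. A = arc (int m) a l"
proof -
  obtain a k where A: "A = arc (int m) a k" using assms(1) by (auto simp: cyclic_interval_iff_arc)
  have "k \<le> m"
  proof (rule ccontr)
    assume "\<not> k \<le> m"
    then have "arc (int m) a m \<subseteq> A" unfolding A arc_def by auto
    then have "m \<le> card A" using card_mono[of A "arc (int m) a m"] card_arc[of m "int m" a] A by (simp add: finite_arc)
    then show False using assms by simp
  qed
  then show ?thesis using A assms(2) card_arc[of k "int m" a] by auto
qed

lemma set_arc_words: "u \<in> arc_words N a l \<Longrightarrow> set u = arc N a l"
proof (induction l arbitrary: a u)
  case (Suc l)
  then obtain v where "u = a mod N # v \<and> v \<in> arc_words N (a + 1) l \<or>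
      u = (a + int l) mod N # v \<and> v \<in> arc_words N a l" by auto
  then show ?case
    using Suc.IH[of v "a + 1"] Suc.IH[of v a] arc_Suc[of N a l] arc_Suc'[of N a l] by auto
qed (simp add: arc_def)

lemma drop_arc_words: "u \<in> arc_words N a l \<Longrightarrow> i \<le> l \<Longrightarrow> \<exists>b. drop i u \<in> arc_words N b (l - i)"
proof (induction l arbitrary: a u i)
  case (Suc l)
  show ?case
  proof (cases i)
    case 0
    then show ?thesis using Suc.prems by auto
  next
    case (Suc j)
    then show ?thesis using Suc.prems Suc.IH[of _ _ j] by auto
  qed
qed auto

text \<open>Consecutive suffixes are arcs that differ by one letter, and by
  \<open>arc_remove\<close> this letter is an end of the larger one.\<close>

lemma arc_wordsI:
  assumes "length u = l" "distinct u" "int l < N" "set u = arc N a l"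
    "\<And>i. i < l \<Longrightarrow> \<exists>b. set (drop i u) = arc N b (l - i)"
  shows "u \<in> arc_words N a l"
  using assms
proof (induction l arbitrary: a u)
  case (Suc l)
  then obtain x v where u: "u = x # v" by (cases u) auto
  have suff: "\<exists>b. set (drop i v) = arc N b (l - i)" if "i < l" for i
    using Suc.prems(5)[of "Suc i"] that by (simp add: u)
  have IH: "v \<in> arc_words N b l" if "set v = arc N b l" for b
    using Suc.IH[of v b] Suc.prems that suff by (simp add: u)
  have J: "insert x (set v) = arc N a (Suc l)" and x: "x \<notin> set v"
    using Suc.prems u by auto
  show ?case
  proof (cases "l = 0")
    case True
    then show ?thesis using Suc.prems by (auto simp: u arc_def)
  next
    case False
    then obtain b where b: "set v = arc N b l" using suff[of 0] by auto
    \<comment> \<open>Each end is missing from the arc that its removal leaves, so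
      \<open>set v\<close> determines which end \<open>x\<close> is.\<close>
    have "(a + int l) mod N \<notin> arc N a l"
      using inj_on_arc[of "Suc l" N a] Suc.prems(3) by (auto simp: arc_def lessThan_Suc inj_on_def)
    moreover have "a mod N \<notin> arc N (a + 1) l"
      using arc_pred_notin[of l N "a + 1"] Suc.prems(3) by simp
    moreover have "set v = arc N a l \<or> set v = arc N (a + 1) l"
      using arc_remove[of x N b l a] J x False Suc.prems(3) unfolding b by auto
    ultimately consider "x = (a + int l) mod N" "set v = arc N a l"
      | "x = a mod N" "set v = arc N (a + 1) l"
      using J x unfolding arc_Suc by (metis arc_Suc arc_Suc' insertE insertI1)
    then show ?thesis
      using IH unfolding u by cases auto
  qed
qed simp

section \<open>Signed letters as positions in the linear order\<close>

definition letter_pos :: "nat \<Rightarrow> int \<Rightarrow> int" where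
  "letter_pos n a = (if a < 0 then - a - 1 else int n + a - 1)"

definition pos_letter :: "nat \<Rightarrow> int \<Rightarrow> int" where
  "pos_letter n v = (if v < int n then - v - 1 else v - int n + 1)"

lemma letter_pos_pos_letter: "0 \<le> v \<Longrightarrow> letter_pos n (pos_letter n v) = v"
  by (simp add: letter_pos_def pos_letter_def)

lemma pos_letter_letter_pos: "a \<noteq> 0 \<Longrightarrow> \<bar>a\<bar> \<le> int n \<Longrightarrow> pos_letter n (letter_pos n a) = a"
  by (auto simp: letter_pos_def pos_letter_def)

lemma less_r_iff_letter_pos:
  "a \<noteq> 0 \<Longrightarrow> \<bar>a\<bar> \<le> int n \<Longrightarrow> b \<noteq> 0 \<Longrightarrow> \<bar>b\<bar> \<le> int n \<Longrightarrow>
    less_r a b \<longleftrightarrow> letter_pos n a < letter_pos n b"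
  by (auto simp: less_r_def letter_pos_def)

text \<open>The rank in \<open>less_r\<close> is a rotation of the residue, so one coordinate serves
  both for cyclic intervals and for descents: the linear order is the cyclic order cut at one
  place.\<close>

lemma letter_pos_residue:
  assumes "a \<noteq> 0" "\<bar>a\<bar> \<le> int n"
  shows "letter_pos n a = (letter_residue n a + (int n - 1)) mod (2 * int n)"
proof -
  have "(letter_residue n a + (int n - 1)) mod (2 * int n) =
      ((if a > 0 then a else int n + \<bar>a\<bar>) + (int n - 1)) mod (2 * int n)"
    by (simp add: letter_residue_def mod_simps)
  also have "\<dots> = (if a > 0 then a + int n - 1 else (2 * int n + (- a - 1)) mod (2 * int n))"
    using assms by (auto simp: algebra_simps)
  also have "\<dots> = letter_pos n a"
    unfolding mod_add_self1 using assms by (auto simp: letter_pos_def)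
  finally show ?thesis ..
qed

text \<open>Modulo \<open>2 * n\<close> the shift \<open>n + 1\<close> is the inverse of the shift
  \<open>n - 1\<close> in \<open>letter_pos_residue\<close>.\<close>

lemma letter_residue_pos_letter:
  assumes "0 \<le> v" "v < 2 * int n"
  shows "letter_residue n (pos_letter n v) = (v + (int n + 1)) mod (2 * int n)"
proof (cases "v < int n")
  case True
  then show ?thesis using assms by (simp add: letter_residue_def pos_letter_def algebra_simps)
next
  case False
  then have "v + (int n + 1) = 2 * int n + (v - int n + 1)" by simp
  then have "(v + (int n + 1)) mod (2 * int n) = (v - int n + 1) mod (2 * int n)"
    by (simp only: mod_add_self1)
  then show ?thesis using False by (simp add: letter_residue_def pos_letter_def)
qed

lemma signed_perms_letter:
  assumes "w \<in> signed_perms n" "a \<in> set w"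
  shows "a \<noteq> 0" "\<bar>a\<bar> \<le> int n"
proof -
  have "\<bar>a\<bar> \<in> {1..int n}" using assms by (auto simp: signed_perms_def)
  then show "a \<noteq> 0" "\<bar>a\<bar> \<le> int n" by auto
qed

lemma bij_betw_B_arc_perms:
  assumes n: "0 < n"
  shows "bij_betw (map (letter_pos n)) (B_arc_perms n)
    (\<Union>a\<in>{0..<2 * n}. arc_words (2 * int n) (int a) n)"
proof (rule bij_betw_byWitness[where f' = "map (pos_letter n)"])
  let ?N = "2 * int n"
  show "\<forall>w\<in>B_arc_perms n. map (pos_letter n) (map (letter_pos n) w) = w"
    using signed_perms_letter[of _ n]
    by (auto simp: B_arc_perms_def pos_letter_letter_pos intro!: map_idI)
  have arc_nonneg: "v \<ge> 0" "v < ?N" if "v \<in> arc ?N a l" for v a l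
    using that n by (auto simp: arc_def)
  show "\<forall>u\<in>\<Union>a\<in>{0..<2 * n}. arc_words ?N (int a) n. map (letter_pos n) (map (pos_letter n) u) = u"
    using arc_nonneg by (auto simp: letter_pos_pos_letter set_arc_words intro!: map_idI)
  show "map (letter_pos n) ` B_arc_perms n \<subseteq> (\<Union>a\<in>{0..<2 * n}. arc_words ?N (int a) n)"
  proof safe
    fix w assume w: "w \<in> B_arc_perms n"
    then have sp: "w \<in> signed_perms n" by (simp add: B_arc_perms_def)
    then have len: "length w = n" and dist: "distinct w"
      by (auto simp: signed_perms_def distinct_map)
    note letter = signed_perms_letter[OF sp]
    have inj: "inj_on (letter_pos n) (set w)"
      by (metis inj_onI letter pos_letter_letter_pos)
    let ?u = "map (letter_pos n) w"
    have suff: "\<exists>b. set (drop i ?u) = arc ?N b (n - i)" if i: "i < n" for i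
    proof -
      have "set (drop i ?u) = letter_pos n ` set (drop i w)" by (simp add: drop_map)
      also have "\<dots> = (\<lambda>a. (letter_residue n a + (int n - 1)) mod ?N) ` set (drop i w)"
        by (intro image_cong refl letter_pos_residue letter) (auto dest: in_set_dropD)
      also have "\<dots> = (\<lambda>r. (r + (int n - 1)) mod ?N) ` letter_residue n ` set (drop i w)"
        by (simp add: image_image)
      finally have eq: "set (drop i ?u) = (\<lambda>r. (r + (int n - 1)) mod ?N) ` letter_residue n ` set (drop i w)" .
      have "cyclic_interval (2 * n) (letter_residue n ` set (drop i w))"
        using w i unfolding B_arc_perms_def by (auto dest!: bspec[of _ _ "Suc i"])
      then obtain a l where "letter_residue n ` set (drop i w) = arc ?N a l"
        by (auto simp: cyclic_interval_iff_arc)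
      then have "set (drop i ?u) = arc ?N (a + (int n - 1)) l"
        using eq arc_shift[of "int n - 1" ?N a l] by simp
      then have "cyclic_interval (2 * n) (set (drop i ?u))"
        by (auto simp: cyclic_interval_iff_arc)
      moreover have "card (set (drop i ?u)) = n - i"
      proof -
        have "distinct (drop i ?u)" using dist inj by (simp add: distinct_map del: drop_map)
        then show ?thesis using len distinct_card[of "drop i ?u"] by simp
      qed
      ultimately show ?thesis
        using cyclic_interval_card[of "2 * n" _ "n - i"] n by simp
    qed
    then obtain b where b: "set ?u = arc ?N b n" using n by (metis drop0 diff_zero)
    define a where "a = nat (b mod ?N)"
    have a: "int a = b mod ?N" "a < 2 * n"
      using n by (auto simp: a_def nat_less_iff)
    then have "set ?u = arc ?N (int a) n" using b arc_mod[of b ?N "int a" n] by simp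
    then have "?u \<in> arc_words ?N (int a) n"
      by (intro arc_wordsI) (use len dist inj n suff in \<open>auto simp: distinct_map\<close>)
    then show "?u \<in> (\<Union>a\<in>{0..<2 * n}. arc_words ?N (int a) n)"
      using a(2) by (intro UN_I[of a]) auto
  qed
  show "map (pos_letter n) ` (\<Union>a\<in>{0..<2 * n}. arc_words ?N (int a) n) \<subseteq> B_arc_perms n"
  proof safe
    fix u a assume u: "u \<in> arc_words ?N (int a) n"
    let ?w = "map (pos_letter n) u"
    have len: "length ?w = n" using u by (simp add: length_arc_words)
    \<comment> \<open>A letter and its barred version are \<open>n\<close> positions apart, so
      \<open>n\<close> consecutive positions carry every absolute value exactly once.\<close>
    have "abs (pos_letter n ((int a + int j) mod ?N)) = (int a + int j) mod int n + 1" for j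
    proof -
      define v where "v = (int a + int j) mod ?N"
      have v: "0 \<le> v" "v < ?N" using n by (auto simp: v_def)
      have "(int a + int j) mod int n = v mod int n"
        unfolding v_def by (simp add: mod_mod_cancel)
      also have "\<dots> = (if v < int n then v else v - int n)"
      proof (cases "v < int n")
        case False
        have "v mod int n = (v - int n) mod int n" by (simp add: mod_simps)
        also have "\<dots> = v - int n" using False v by (intro mod_pos_pos_trivial) auto
        finally show ?thesis using False by simp
      qed (use v in simp)
      finally show ?thesis using v unfolding v_def[symmetric] by (simp add: pos_letter_def)
    qed
    then have "abs ` set ?w = (\<lambda>v. v + 1) ` arc (int n) (int a) n"
      using set_arc_words[OF u] by (simp add: arc_def image_image)
    also have "arc (int n) (int a) n = {0..<int n}"
    proof (rule card_subset_eq)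
      show "arc (int n) (int a) n \<subseteq> {0..<int n}" using n by (auto simp: arc_def)
    qed (simp_all add: card_arc)
    also have "(\<lambda>v. v + 1) ` {0..<int n} = {1..int n}"
      using image_add_int_atLeastLessThan[of 1 "int n + 1"] by auto
    finally have abs: "abs ` set ?w = {1..int n}" .
    have "distinct (map abs ?w)"
      by (rule card_distinct) (use abs len in \<open>simp add: image_image\<close>)
    then have sp: "?w \<in> signed_perms n"
      using abs len by (simp add: signed_perms_def)
    have "cyclic_interval (2 * n) (letter_residue n ` set (drop (i - 1) ?w))" if i: "i \<in> {1..n}" for i
    proof -
      have "i - 1 \<le> n" using i by auto
      from drop_arc_words[OF u this] obtain b where b: "set (drop (i - 1) u) = arc ?N b (n - (i - 1))"
        using set_arc_words by metis
      have "letter_residue n ` set (drop (i - 1) ?w) =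
          (\<lambda>v. letter_residue n (pos_letter n v)) ` arc ?N b (n - (i - 1))"
        unfolding b[symmetric] by (simp add: drop_map image_image)
      also have "\<dots> = (\<lambda>v. (v + (int n + 1)) mod ?N) ` arc ?N b (n - (i - 1))"
        using arc_nonneg by (intro image_cong refl letter_residue_pos_letter)
      finally show ?thesis
        by (auto simp: arc_shift cyclic_interval_iff_arc)
    qed
    then show "?w \<in> B_arc_perms n" using sp by (simp add: B_arc_perms_def)
  qed
qed

section \<open>Descents and the coefficients of the left-hand side\<close>

lemma compatible_iff_nth:
  "length u = length xs \<Longrightarrow>
    compatible u xs \<longleftrightarrow> (\<forall>i. Suc i < length xs \<longrightarrow> xs ! i = xs ! Suc i \<longrightarrow> u ! i < u ! Suc i)"
proof (induction u xs rule: compatible.induct)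
  case (1 a b u x y xs)
  have all_nat: "(\<forall>i. P i) \<longleftrightarrow> P 0 \<and> (\<forall>i. P (Suc i))" for P :: "nat \<Rightarrow> bool"
    by (metis not0_implies_Suc)
  have "(\<forall>i. Suc i < length (x # y # xs) \<longrightarrow> (x # y # xs) ! i = (x # y # xs) ! Suc i \<longrightarrow>
        (a # b # u) ! i < (a # b # u) ! Suc i) \<longleftrightarrow>
      (x = y \<longrightarrow> a < b) \<and> (\<forall>i. Suc i < length (y # xs) \<longrightarrow> (y # xs) ! i = (y # xs) ! Suc i \<longrightarrow>
        (b # u) ! i < (b # u) ! Suc i)"
    by (subst all_nat) auto
  then show ?case using 1 by simp
qed auto

text \<open>Only one sorted list has content \<open>M\<close>, so a coefficient is 0 or 1.\<close>

lemma mps_coeff_fund_qsym: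
  "mps_coeff (fund_qsym n S) M =
    (if size M = n \<and> (\<forall>j\<in>S. sorted_list_of_multiset M ! (j - 1) < sorted_list_of_multiset M ! j)
     then 1 else 0)"
proof -
  let ?s = "sorted_list_of_multiset M"
  have *: "xs = ?s" if "sorted xs" "mset xs = M" for xs
    using that sorted_list_of_multiset_mset[of xs] by (simp add: sorted_sort_id)
  have "{xs. length xs = n \<and> sorted xs \<and> (\<forall>j\<in>S. xs ! (j - 1) < xs ! j) \<and> mset xs = M} =
      (if size M = n \<and> (\<forall>j\<in>S. ?s ! (j - 1) < ?s ! j) then {?s} else {})"
    using * by (auto simp flip: size_mset)
  then show ?thesis by (simp add: fund_qsym.rep_eq)
qed

text \<open>As \<open>xs\<close> is sorted, \<open>xs ! (j - 1) < xs ! j\<close> fails only inside a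
  block; the condition says that no descent falls inside a block. The letters are distinct, so a
  non-descent is a strict increase of positions.\<close>

lemma Des_compatible_iff:
  assumes w: "w \<in> signed_perms n" and xs: "length xs = n" "sorted xs"
  shows "(\<forall>j\<in>Des n w. xs ! (j - 1) < xs ! j) \<longleftrightarrow> compatible (map (letter_pos n) w) xs"
proof -
  have len: "length w = n" and dist: "distinct w"
    using w by (auto simp: signed_perms_def distinct_map)
  have lt: "less_r (w ! Suc i) (w ! i) \<longleftrightarrow> \<not> letter_pos n (w ! i) < letter_pos n (w ! Suc i)"
    if "Suc i < n" for i
  proof -
    have *: "w ! i \<in> set w" "w ! Suc i \<in> set w" using that len by auto
    have "w ! i \<noteq> w ! Suc i" using dist that len by (simp add: nth_eq_iff_index_eq)
    then have "letter_pos n (w ! i) \<noteq> letter_pos n (w ! Suc i)"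
      by (metis * pos_letter_letter_pos signed_perms_letter[OF w])
    then show ?thesis
      using less_r_iff_letter_pos[of "w ! Suc i" n "w ! i"] signed_perms_letter[OF w] * by auto
  qed
  have "(\<forall>j\<in>Des n w. xs ! (j - 1) < xs ! j) \<longleftrightarrow>
      (\<forall>i. Suc i < n \<longrightarrow> less_r (w ! Suc i) (w ! i) \<longrightarrow> xs ! i < xs ! Suc i)"
    (is "?l = ?r")
  proof
    assume ?l
    show ?r
    proof (intro allI impI)
      fix i assume "Suc i < n" "less_r (w ! Suc i) (w ! i)"
      then have "Suc i \<in> Des n w" by (auto simp: Des_def)
      then show "xs ! i < xs ! Suc i" using \<open>?l\<close> by fastforce
    qed
  next
    assume ?r show ?l
    proof
      fix j assume j: "j \<in> Des n w"
      then obtain i where "j = Suc i" "Suc i < n" by (cases j) (auto simp: Des_def)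
      then show "xs ! (j - 1) < xs ! j" using \<open>?r\<close> j by (auto simp: Des_def)
    qed
  qed
  also have "\<dots> \<longleftrightarrow> (\<forall>i. Suc i < n \<longrightarrow> xs ! i = xs ! Suc i \<longrightarrow> letter_pos n (w ! i) < letter_pos n (w ! Suc i))"
    using lt xs by (metis order.order_iff_strict less_irrefl sorted_wrt_nth_less lessI)
  also have "\<dots> \<longleftrightarrow> compatible (map (letter_pos n) w) xs"
    using xs len by (simp add: compatible_iff_nth)
  finally show ?thesis .
qed

lemma coeff_sum_fund_qsym:
  assumes n: "0 < n" and M: "size M = n"
  shows "2 * mps_coeff (\<Sum>w\<in>B_arc_perms n. fund_qsym n (Des n w)) M =
    of_nat (n * 2 ^ card (set_mset M) + 2 * (\<Sum>i\<in>set_mset M. 2 ^ card (set_mset (M - {#i#}))))"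
proof -
  let ?N = "2 * int n"
  define xs where "xs = sorted_list_of_multiset M"
  have xs: "mset xs = M" "sorted xs" "length xs = n"
    using M by (auto simp: xs_def simp flip: size_mset)
  have ne: "xs \<noteq> []" using xs(3) n by auto
  have "mps_coeff (\<Sum>w\<in>B_arc_perms n. fund_qsym n (Des n w)) M =
      (\<Sum>w\<in>B_arc_perms n. if compatible (map (letter_pos n) w) xs then 1 else 0)"
    unfolding mps_coeff_sum mps_coeff_fund_qsym xs_def[symmetric]
    by (intro sum.cong refl) (use xs M Des_compatible_iff in \<open>auto simp: B_arc_perms_def\<close>)
  also have "\<dots> = (\<Sum>u\<in>(\<Union>a\<in>{0..<2 * n}. arc_words ?N (int a) n). if compatible u xs then 1 else 0)"
    by (rule sum.reindex_bij_betw[OF bij_betw_B_arc_perms[OF n]])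
  also have "\<dots> = (\<Sum>a = 0..<2 * n. \<Sum>u\<in>arc_words ?N (int a) n. if compatible u xs then 1 else 0)"
  \<comment> \<open>A word determines its set of letters, and an arc of \<open>n < 2 * n\<close>
    letters determines its start.\<close>
  proof (rule sum.UNION_disjoint)
    show "\<forall>a\<in>{0..<2 * n}. \<forall>b\<in>{0..<2 * n}. a \<noteq> b \<longrightarrow>
        arc_words ?N (int a) n \<inter> arc_words ?N (int b) n = {}"
    proof (intro ballI impI, rule ccontr)
      fix a b assume ab: "a \<in> {0..<2 * n}" "b \<in> {0..<2 * n}" "a \<noteq> b"
        and "arc_words ?N (int a) n \<inter> arc_words ?N (int b) n \<noteq> {}"
      then have "arc ?N (int a) n = arc ?N (int b) n" by (auto dest!: set_arc_words)
      then have "int a mod ?N = int b mod ?N" by (rule arc_eqD) (use n in auto)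
      then show False using ab by simp
    qed
  qed (auto simp: finite_arc_words)
  also have "\<dots> = (\<Sum>a = 0..<2 * n. of_nat (arc_count ?N (- 1) (int a) xs))"
  proof (rule sum.cong[OF refl])
    fix a
    have "-1 < hd u" if "u \<in> arc_words ?N (int a) n" for u
    proof -
      have "hd u \<in> arc ?N (int a) n"
        using that set_arc_words[OF that] length_arc_words[OF that] n hd_in_set[of u] by auto
      then have "0 \<le> hd u" using n by (auto simp: arc_def)
      then show ?thesis by simp
    qed
    then have "{u \<in> arc_words ?N (int a) n. compatible u xs} =
        {u \<in> arc_words ?N (int a) n. compatible u xs \<and> -1 < hd u}" by blast
    then show "(\<Sum>u\<in>arc_words ?N (int a) n. if compatible u xs then 1 else 0) =
        (of_nat (arc_count ?N (- 1) (int a) xs) :: complex)"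
      by (simp add: arc_count_def xs(3) finite_arc_words flip: sum.inter_filter)
  qed
  also have "\<dots> = of_nat (\<Sum>a = 0..<2 * n. arc_count ?N (- 1) (int a) xs)"
    by simp
  finally have "2 * mps_coeff (\<Sum>w\<in>B_arc_perms n. fund_qsym n (Des n w)) M =
      of_nat (2 * (\<Sum>a = 0..<2 * n. arc_count ?N (- 1) (int a) xs))" by simp
  also have "2 * (\<Sum>a = 0..<2 * n. arc_count ?N (- 1) (int a) xs) =
      n * 2 ^ card (set xs) + 2 * sum (set_weight xs) (set xs)"
    by (rule arc_count_total[OF ne xs(2,3)])
  also have "set xs = set_mset M" using xs(1) by auto
  also have "sum (set_weight xs) (set_mset M) = (\<Sum>i\<in>set_mset M. 2 ^ card (set_mset (M - {#i#})))"
    using xs(1) by (intro sum.cong refl) (metis set_weight_def mset_remove1 set_mset_mset)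
  finally show ?thesis .
qed

section \<open>Comparison of coefficients\<close>

lemma frobenius_ch_hook_sum:
  assumes "0 < n"
  shows "2 * mps_coeff (frobenius_ch n (\<lambda>\<pi>. \<Sum>k = 1..n. irr_char (hook k (n - k)) \<pi>)) M =
    (if size M = n then 2 ^ card (set_mset M) else 0)"
proof -
  have "2 * mps_coeff (frobenius_ch n (\<lambda>\<pi>. \<Sum>k = 1..n. irr_char (hook k (n - k)) \<pi>)) M =
      mps_coeff (frobenius_ch n (exterior_char {1..n})) M"
    unfolding mps_coeff_frobenius_ch sum_distrib_left mult.left_commute[of 2]
    by (intro sum.cong refl) (simp add: sum_irr_char_hook[OF assms, symmetric] mult.assoc del: One_nat_def)
  then show ?thesis by (simp only: mps_coeff_frobenius_ch_exterior)
qed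

lemma induce_sum: "(\<Sum>k\<in>K. induce n (\<chi> k) \<pi>) = induce n (\<lambda>\<rho>. \<Sum>k\<in>K. \<chi> k \<rho>) \<pi>"
  unfolding induce_def sum_distrib_left by (rule sum.swap)

theorem theorem8p2:
  fixes n :: nat
  assumes "n \<ge> 2"
  shows "(\<Sum>w\<in>B_arc_perms n. fund_qsym n (Des n w)) =
    frobenius_ch n (\<lambda>\<pi>.
      2 * (\<Sum>k = 1..n - 1. induce n (irr_char (hook k (n - k - 1))) \<pi>) +
      of_nat n * (\<Sum>k = 1..n. irr_char (hook k (n - k)) \<pi>))"
proof (rule mps_eqI)
  fix M :: "nat multiset"
  obtain r where n: "n = Suc r" "0 < r" using assms by (cases n) auto
  let ?\<chi> = "\<lambda>m \<pi>. \<Sum>k = 1..m. irr_char (hook k (m - k)) \<pi>"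
  let ?w = "\<lambda>M :: nat multiset. 2 ^ card (set_mset M) :: complex"
  have "mps_coeff (frobenius_ch n (\<lambda>\<pi>.
        2 * (\<Sum>k = 1..n - 1. induce n (irr_char (hook k (n - k - 1))) \<pi>) + of_nat n * ?\<chi> n \<pi>)) M =
      2 * mps_coeff (frobenius_ch n (induce n (?\<chi> r))) M + of_nat n * mps_coeff (frobenius_ch n (?\<chi> n)) M"
    unfolding mps_coeff_frobenius_ch induce_sum
    by (simp add: n(1) sum.distrib sum_distrib_left algebra_simps del: fact_Suc sum.cl_ivl_Suc)
  \<comment> \<open>Multiplication by \<open>power_sum 1\<close> takes one variable out of
    \<open>M\<close>.\<close>
  also have "mps_coeff (frobenius_ch n (induce n (?\<chi> r))) M =
      (\<Sum>i\<in>set_mset M. mps_coeff (frobenius_ch r (?\<chi> r)) (M - {#i#}))"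
    unfolding n(1) frobenius_ch_induce by (simp add: mps_coeff_power_sum_times)
  \<comment> \<open>The coefficients are compared after doubling, since those of the hook sums are
    known as doubles; the factor 2 is cancelled at the end.\<close>
  finally have rhs: "2 * mps_coeff (frobenius_ch n (\<lambda>\<pi>.
        2 * (\<Sum>k = 1..n - 1. induce n (irr_char (hook k (n - k - 1))) \<pi>) + of_nat n * ?\<chi> n \<pi>)) M =
      2 * (\<Sum>i\<in>set_mset M. if size (M - {#i#}) = r then ?w (M - {#i#}) else 0) +
      of_nat n * (if size M = n then ?w M else 0)"
    using frobenius_ch_hook_sum[of n M] n(2) frobenius_ch_hook_sum[OF n(2)]
    by (simp add: n(1) sum_distrib_left algebra_simps)
  have size: "size (M - {#i#}) = r \<longleftrightarrow> size M = n" if "i \<in># M" for i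
    using that n(1) by (auto dest!: multi_member_split)
  have "2 * mps_coeff (\<Sum>w\<in>B_arc_perms n. fund_qsym n (Des n w)) M =
      2 * (\<Sum>i\<in>set_mset M. if size (M - {#i#}) = r then ?w (M - {#i#}) else 0) +
      of_nat n * (if size M = n then ?w M else 0)"
  proof (cases "size M = n")
    case True
    then have "(\<Sum>i\<in>set_mset M. if size (M - {#i#}) = r then ?w (M - {#i#}) else 0) =
        (\<Sum>i\<in>set_mset M. ?w (M - {#i#}))"
      by (intro sum.cong) (auto simp: size)
    then show ?thesis using coeff_sum_fund_qsym[of n M] True n(1) by (simp add: algebra_simps)
  next
    case False
    then show ?thesis by (simp add: mps_coeff_sum mps_coeff_fund_qsym size)
  qed
  then show "mps_coeff (\<Sum>w\<in>B_arc_perms n. fund_qsym n (Des n w)) M =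
      mps_coeff (frobenius_ch n (\<lambda>\<pi>.
        2 * (\<Sum>k = 1..n - 1. induce n (irr_char (hook k (n - k - 1))) \<pi>) + of_nat n * ?\<chi> n \<pi>)) M"
    unfolding rhs[symmetric] by (rule mult_left_cancel[THEN iffD1, rotated]) simp
qed

end
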